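(* Let $a,b$ be positive integers. Consider the $(a:b)$ connectivity Maker-PhantomBreaker game on $E(K_n)$. (a) If $b>2a$, then there exist a constant $c=c(a,b)>0$ and an integer $n_0$ such that for all $n\ge n_0$ Maker has a randomized strategy which, against every strategy of PhantomBreaker, wins with probability at least $c$. (b) If $b\le 2a$, then Maker has a randomized strategy that wins asymptotically almost surely; that is, for every $n$ large enough there is a randomized strategy for Maker and a number $p_n$ with $p_n\to 1$ as $n\to\infty$ such that, against every strategy of PhantomBreaker, this strategy wins with probability at least $p_n$.
   Context: Maker-PhantomBreaker game. The board is the edge set $E(K_n)$ of the complete graph on $n$ vertices, and there is a family of winning sets (edge sets of certain subgraphs of $K_n$). Initially all edges are unclaimed. Two players, Maker and PhantomBreaker, alternate turns, Maker going first. In an $(a:b)$ game, in each round Maker first makes $a$ moves, one after another, each consisting of attempting to claim one edge of $K_n$; then PhantomBreaker claims $b$ unclaimed edges (all remaining unclaimed edges if fewer than $b$ remain). If the edge Maker attempts to claim is unclaimed, it becomes hers. If it has already been claimed by PhantomBreaker, then that move of Maker is lost (she gets no replacement move) and she learns that this edge belongs to PhantomBreaker. Information: PhantomBreaker has complete information about the game so far (he sees all previous moves of Maker, including failed attempts, but not the outcomes of Maker's future random choices). Maker sees none of PhantomBreaker's moves; her only information about them is the success or failure of her own previous attempts. Maker wins if at some point she has claimed all edges of some winning set; otherwise PhantomBreaker wins. Both players may use randomized strategies, where each decision of PhantomBreaker may depend only on all previous moves of both players (including Maker's failed attempts) and his own randomness, and each decision of Maker may depend only on her own previous attempts, their success or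 failure, and her own randomness. Connectivity game: the winning sets are the edge sets of all spanning trees of $K_n$ (equivalently, Maker wins iff the graph of her claimed edges eventually is connected and spanning). *)

theory Defs
  imports "HOL-Probability.Probability"
begin

subsection \<open>Spanning trees of the complete graph\<close>

type_synonym edge = "nat set"

definition complete_edges :: "nat \<Rightarrow> edge set" where
  "complete_edges n = {e. e \<subseteq> {..<n} \<and> card e = 2}"

definition connected_spanning :: "nat \<Rightarrow> edge set \<Rightarrow> bool" where
  "connected_spanning n T \<longleftrightarrow> (\<forall>u<n. \<forall>v<n. (\<lambda>x y. {x, y} \<in> T)\<^sup>*\<^sup>* u v)"

definition is_cycle :: "edge set \<Rightarrow> nat list \<Rightarrow> bool" where
  "is_cycle T c \<longleftrightarrow> length c \<ge> 3 \<and> distinct c \<and>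
     (\<forall>i<length c. {c ! i, c ! (Suc i mod length c)} \<in> T)"

definition spanning_trees :: "nat \<Rightarrow> edge set set" where
  "spanning_trees n =
     {T. T \<subseteq> complete_edges n \<and> connected_spanning n T \<and> (\<nexists>c. is_cycle T c)}"

subsection \<open>Positions and information\<close>

text \<open>A history lists all moves of both players, most recent move first. One entry
  \<open>Claim S\<close> records all edges that PhantomBreaker claims in one of his turns.\<close>

datatype move = Attempt edge | Claim "edge set"

fun breaker_edges :: "move list \<Rightarrow> edge set" where
  "breaker_edges [] = {}"
| "breaker_edges (Attempt e # h) = breaker_edges h"
| "breaker_edges (Claim S # h) = S \<union> breaker_edges h"

fun maker_edges :: "move list \<Rightarrow> edge set" where
  "maker_edges [] = {}"
| "maker_edges (Attempt e # h) =
     (if e \<in> breaker_edges h then maker_edges h else insert e (maker_edges h))"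
| "maker_edges (Claim S # h) = maker_edges h"

definition unclaimed :: "nat \<Rightarrow> move list \<Rightarrow> edge set" where
  "unclaimed n h = complete_edges n - (maker_edges h \<union> breaker_edges h)"

text \<open>All that Maker knows: her own attempts, most recent first, each with a flag telling
  whether it succeeded. An attempt at an edge that she already owns is a wasted
  move, whose flag \<open>True\<close> tells her nothing new.\<close>

fun maker_view :: "move list \<Rightarrow> (edge \<times> bool) list" where
  "maker_view [] = []"
| "maker_view (Attempt e # h) = (e, e \<notin> breaker_edges h) # maker_view h"
| "maker_view (Claim S # h) = maker_view h"

subsection \<open>Strategies\<close>

text \<open>A randomized strategy is a distribution over deterministic ones: a player's
  private randomness is drawn before the game and revealed to the opponent only through
  the moves made. As the game is finite, discrete distributions are no restriction.
  Conditions on histories that cannot occur in play are harmless, since a legal move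
  always exists (for Maker, as soon as \<open>n \<ge> 2\<close>).\<close>

type_synonym maker_strategy = "(edge \<times> bool) list \<Rightarrow> edge"
type_synonym breaker_strategy = "move list \<Rightarrow> edge set"

definition maker_legal :: "nat \<Rightarrow> maker_strategy \<Rightarrow> bool" where
  "maker_legal n \<mu> \<longleftrightarrow> (\<forall>v. \<mu> v \<in> complete_edges n)"

definition breaker_legal :: "nat \<Rightarrow> nat \<Rightarrow> breaker_strategy \<Rightarrow> bool" where
  "breaker_legal n b \<beta> \<longleftrightarrow>
     (\<forall>h. \<beta> h \<subseteq> unclaimed n h \<and> card (\<beta> h) = min b (card (unclaimed n h)))"

definition randomized_maker :: "nat \<Rightarrow> maker_strategy pmf \<Rightarrow> bool" where
  "randomized_maker n M \<longleftrightarrow> (\<forall>\<mu>\<in>set_pmf M. maker_legal n \<mu>)"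

definition randomized_breaker :: "nat \<Rightarrow> nat \<Rightarrow> breaker_strategy pmf \<Rightarrow> bool" where
  "randomized_breaker n b B \<longleftrightarrow> (\<forall>\<beta>\<in>set_pmf B. breaker_legal n b \<beta>)"

subsection \<open>The game\<close>

definition maker_move :: "maker_strategy \<Rightarrow> move list \<Rightarrow> move list" where
  "maker_move \<mu> h = Attempt (\<mu> (maker_view h)) # h"

definition breaker_turn :: "breaker_strategy \<Rightarrow> move list \<Rightarrow> move list" where
  "breaker_turn \<beta> h = Claim (\<beta> h) # h"

definition play :: "nat \<Rightarrow> maker_strategy \<Rightarrow> breaker_strategy \<Rightarrow> nat \<Rightarrow> move list" where
  "play a \<mu> \<beta> k = ((\<lambda>h. breaker_turn \<beta> ((maker_move \<mu> ^^ a) h)) ^^ k) []"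

text \<open>Maker's edge set only grows, and does not change in PhantomBreaker's turns, so it
  suffices to look at the position after each full round. Rounds that follow the
  exhaustion of the board change nothing. The bias \<open>b\<close> enters through the
  legality of \<open>\<beta>\<close>.\<close>

definition maker_wins ::
    "edge set set \<Rightarrow> nat \<Rightarrow> maker_strategy \<Rightarrow> breaker_strategy \<Rightarrow> bool" where
  "maker_wins F a \<mu> \<beta> \<longleftrightarrow> (\<exists>k. \<exists>W\<in>F. W \<subseteq> maker_edges (play a \<mu> \<beta> k))"

definition win_prob ::
    "edge set set \<Rightarrow> nat \<Rightarrow> maker_strategy pmf \<Rightarrow> breaker_strategy pmf \<Rightarrow> real" where
  "win_prob F a M B =
     measure_pmf.prob (pair_pmf M B) {(\<mu>, \<beta>). maker_wins F a \<mu> \<beta>}"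

definition guarantees_win ::
    "edge set set \<Rightarrow> nat \<Rightarrow> nat \<Rightarrow> nat \<Rightarrow> maker_strategy pmf \<Rightarrow> real \<Rightarrow> bool" where
  "guarantees_win F n a b M p \<longleftrightarrow>
     (\<forall>B. randomized_breaker n b B \<longrightarrow> win_prob F a M B \<ge> p)"

end

theory Submission
  imports Defs
begin

text \<open>All of Maker's attempts join distinct components of her graph, so \<open>n - 1\<close> successes win. In
  linear time PhantomBreaker claims only \<open>O(n)\<close> edges, hence he can block the cut around a component
  only if the component is small and all its vertices have large PhantomBreaker degree.

  For an arbitrary bias Maker repeatedly attempts a uniformly random edge between different
  components. Only boundedly many vertices ever acquire degree above \<open>n / 4\<close>. Cut the game into
  boundedly many short windows: in each of them, with probability bounded away from \<open>0\<close>, the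
  component of one prescribed dangerous vertex grows, and after enough windows every dangerous vertex
  lies in a component that is too large to be isolated.

  For \<open>b \<le> 2 a\<close> PhantomBreaker owns at most \<open>2 t\<close> edges after \<open>t\<close> attempts. Maker first tries a random
  almost perfect matching. Isolating a vertex costs almost all edges available during this phase, so
  half-way through it at most four candidates remain, and these are unlikely to be among the few
  vertices untried at the end. She then attaches the leftover vertices, pairs up the components of
  size two, and finally joins components of size at least three, whose isolation costs about \<open>3 n\<close>
  edges while PhantomBreaker owns fewer than \<open>2.3 n\<close>.\<close>

subsection \<open>Connectivity\<close>

text \<open>PhantomBreaker adapts to all of Maker's past, so events belonging to different attempts
  cannot be treated as independent. Every probability bound therefore comes from a potential whose
  average over Maker's next choice is controlled at each relevant history; \<open>2 ^ k\<close>,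
  with \<open>k\<close> the number of successes still missing, takes the place of a concentration
  inequality.

  For an arbitrary bias the obstacle is that the set of dangerous vertices keeps changing. A degree
  threshold that rises as fast as degrees can grow freezes this set through a cycle of windows;
  newcomers wait for the next cycle with degree at most \<open>3 * n / 4\<close>. Each window must
  also remove its share of components, since only linear time is available.

  For \<open>b \<le> 2 * a\<close> the matching stops about \<open>d = n div K\<close> vertices
  early. This slack leaves free edges at every vertex while the failures of the matching are
  repaired, which are \<open>O(K ^ 2)\<close> vertices on average. It also keeps at least
  \<open>d * d / 4\<close> pairs on offer, so that an attempt fails with probability
  \<open>O(1 / n)\<close>. For fixed \<open>K\<close> the total risk is \<open>O(1 / K)\<close>;
  \<open>K\<close> tends to infinity only at the very end.\<close>

lemma spanning_tree_exists:
  assumes "E \<subseteq> complete_edges n" "connected_spanning n E"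
  shows "\<exists>W\<in>spanning_trees n. W \<subseteq> E"
proof -
  have fin: "finite (complete_edges n)"
    by (rule finite_subset[of _ "Pow {..<n}"]) (auto simp: complete_edges_def)
  define P where "P W \<longleftrightarrow> W \<subseteq> E \<and> connected_spanning n W" for W
  \<comment> \<open>A connected spanning edge set of least size has no cycle, since the rest of a
    cycle is a detour around any of its edges.\<close>
  obtain W where W: "P W" and min: "\<And>W'. P W' \<Longrightarrow> card W \<le> card W'"
    using ex_has_least_nat[of P E card] assms by (auto simp: P_def)
  have finW: "finite W" using W assms fin by (meson P_def finite_subset)
  have "\<not> is_cycle W c" for c
  proof
    assume c: "is_cycle W c"
    define L where "L = length c"
    have L: "L \<ge> 3" and dist: "distinct c"
      and edges: "\<And>i. i < L \<Longrightarrow> {c ! i, c ! (Suc i mod L)} \<in> W"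
      using c by (auto simp: is_cycle_def L_def)
    define e where "e = {c ! 0, c ! 1}"
    define R where "R = (\<lambda>x y. {x, y} \<in> W - {e})"
    have nth_eq: "c ! i = c ! j \<longleftrightarrow> i = j" if "i < L" "j < L" for i j
      using that dist by (simp add: L_def nth_eq_iff_index_eq)
    have path: "R\<^sup>*\<^sup>* (c ! 1) (c ! i)" if "1 \<le> i" "i < L" for i
      using that
    proof (induction i rule: dec_induct)
      case (step i)
      have "{c ! i, c ! Suc i} \<in> W" using edges[of i] step by simp
      moreover have "{c ! i, c ! Suc i} \<noteq> e"
        using step L nth_eq[of i 0] nth_eq[of "Suc i" 0] by (auto simp: e_def doubleton_eq_iff)
      ultimately have "R (c ! i) (c ! Suc i)" by (simp add: R_def)
      then show ?case using step by (metis Suc_lessD rtranclp.rtrancl_into_rtrancl)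
    qed simp
    have "{c ! (L - 1), c ! 0} \<in> W" using edges[of "L - 1"] L by simp
    moreover have "{c ! (L - 1), c ! 0} \<noteq> e"
      using L nth_eq[of "L - 1" 0] nth_eq[of "L - 1" 1] by (auto simp: e_def doubleton_eq_iff)
    ultimately have "R (c ! (L - 1)) (c ! 0)" by (simp add: R_def)
    moreover have "R\<^sup>*\<^sup>* (c ! 1) (c ! (L - 1))" using path[of "L - 1"] L by simp
    ultimately have c10: "R\<^sup>*\<^sup>* (c ! 1) (c ! 0)"
      by (rule rtranclp.rtrancl_into_rtrancl[rotated])
    have symR: "symp R" by (auto simp: symp_def R_def insert_commute)
    have c01: "R\<^sup>*\<^sup>* (c ! 0) (c ! 1)"
      using sympD[OF symp_rtranclp[OF symR] c10] .
    have "R\<^sup>*\<^sup>* u v" if "(\<lambda>x y. {x, y} \<in> W)\<^sup>*\<^sup>* u v" for u v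
      using that
    proof (induction rule: rtranclp_induct)
      case (step y z)
      have "R\<^sup>*\<^sup>* y z"
      proof (cases "{y, z} = e")
        case True
        then show ?thesis using c01 c10 by (auto simp: e_def doubleton_eq_iff)
      next
        case False
        then show ?thesis using step by (auto simp: R_def)
      qed
      then show ?case using step by (meson rtranclp_trans)
    qed simp
    then have "P (W - {e})"
      using W by (auto simp: P_def connected_spanning_def R_def)
    then have "card W \<le> card (W - {e})" by (rule min)
    moreover have "e \<in> W" using edges[of 0] L by (simp add: e_def)
    ultimately show False using finW by (metis card_Diff1_less not_less)
  qed
  then show ?thesis using W assms by (auto simp: P_def spanning_trees_def)
qed

subsection \<open>Realizing behavioural strategies\<close>

text \<open>One attempt is the unit of time. Whose turn it is can be read off the number of
  attempts, so rounds disappear from all later arguments.\<close>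

definition attempt :: "nat \<Rightarrow> breaker_strategy \<Rightarrow> move list \<Rightarrow> edge \<Rightarrow> move list" where
  "attempt a \<beta> h e =
     (let h' = Attempt e # h
      in if length (maker_view h') mod a = 0 then breaker_turn \<beta> h' else h')"

text \<open>Every strategy below is behavioural: each attempt is uniform in a set determined by Maker's
  view, with fresh randomness. Expectations over the random play are then iterated finite
  averages.\<close>

primrec expect ::
    "nat \<Rightarrow> breaker_strategy \<Rightarrow> ((edge \<times> bool) list \<Rightarrow> edge set) \<Rightarrow> nat \<Rightarrow>
     (move list \<Rightarrow> real) \<Rightarrow> move list \<Rightarrow> real" where
  "expect a \<beta> A 0 f h = f h"
| "expect a \<beta> A (Suc s) f h =
     (\<Sum>e\<in>A (maker_view h). expect a \<beta> A s f (attempt a \<beta> h e)) / card (A (maker_view h))"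

lemma length_maker_view_attempt [simp]:
  "length (maker_view (attempt a \<beta> h e)) = Suc (length (maker_view h))"
  by (simp add: attempt_def breaker_turn_def Let_def)

primrec run :: "nat \<Rightarrow> maker_strategy \<Rightarrow> breaker_strategy \<Rightarrow> nat \<Rightarrow> move list \<Rightarrow> move list" where
  "run a \<mu> \<beta> 0 h = h"
| "run a \<mu> \<beta> (Suc s) h = run a \<mu> \<beta> s (attempt a \<beta> h (\<mu> (maker_view h)))"

lemma attempt_maker_move:
  "attempt a \<beta> h (\<mu> (maker_view h)) =
     (if Suc (length (maker_view h)) mod a = 0 then breaker_turn \<beta> (maker_move \<mu> h)
      else maker_move \<mu> h)"
  by (simp add: attempt_def maker_move_def)

lemma run_add: "run a \<mu> \<beta> (s + t) h = run a \<mu> \<beta> t (run a \<mu> \<beta> s h)"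
  by (induction s arbitrary: h) auto

text \<open>Counted from a multiple of \<open>a\<close>, the next multiple is reached only with the
  last of the \<open>a\<close> attempts, so PhantomBreaker does not interrupt the round.\<close>

lemma run_round:
  assumes "a > 0" "a dvd length (maker_view h)"
  shows "run a \<mu> \<beta> a h = breaker_turn \<beta> ((maker_move \<mu> ^^ a) h)"
proof -
  have len: "length (maker_view ((maker_move \<mu> ^^ j) h)) = length (maker_view h) + j" for j
    by (induction j) (auto simp: maker_move_def)
  have part: "run a \<mu> \<beta> j h = (maker_move \<mu> ^^ j) h" if "j < a" for j
    using that
  proof (induction j)
    case (Suc j)
    have "Suc (length (maker_view h) + j) mod a \<noteq> 0"
    proof
      assume "Suc (length (maker_view h) + j) mod a = 0"
      then have "a dvd length (maker_view h) + Suc j" by (simp add: mod_eq_0_iff_dvd)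
      then have "a dvd Suc j" using assms(2) by (simp only: dvd_add_right_iff)
      then show False using Suc.prems by (meson dvd_imp_le not_less zero_less_Suc)
    qed
    moreover have "run a \<mu> \<beta> (Suc j) h = run a \<mu> \<beta> 1 (run a \<mu> \<beta> j h)"
      using run_add[of a \<mu> \<beta> j 1 h] by simp
    ultimately show ?case using Suc len[of j] by (simp add: attempt_maker_move)
  qed simp
  obtain j where j: "a = Suc j" using assms by (cases a) auto
  have "run a \<mu> \<beta> a h = run a \<mu> \<beta> 1 (run a \<mu> \<beta> j h)"
    using run_add[of a \<mu> \<beta> j 1 h] j by simp
  also have "run a \<mu> \<beta> j h = (maker_move \<mu> ^^ j) h" using part j by simp
  also have "run a \<mu> \<beta> 1 \<dots> = breaker_turn \<beta> ((maker_move \<mu> ^^ Suc j) h)"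
  proof -
    have "(length (maker_view h) + a) mod a = 0" using assms by auto
    then show ?thesis using len[of j] j by (simp add: attempt_maker_move)
  qed
  finally show ?thesis by (simp add: j)
qed

lemma play_eq_run:
  assumes "a > 0"
  shows "play a \<mu> \<beta> k = run a \<mu> \<beta> (k * a) []"
proof -
  have "play a \<mu> \<beta> k = run a \<mu> \<beta> (k * a) [] \<and> a dvd length (maker_view (play a \<mu> \<beta> k))"
  proof (induction k)
    case (Suc k)
    have len: "length (maker_view ((maker_move \<mu> ^^ j) h)) = length (maker_view h) + j" for j h
      by (induction j) (auto simp: maker_move_def)
    have s: "play a \<mu> \<beta> (Suc k) = breaker_turn \<beta> ((maker_move \<mu> ^^ a) (play a \<mu> \<beta> k))"
      by (simp add: play_def)
    have "run a \<mu> \<beta> (Suc k * a) [] = run a \<mu> \<beta> a (play a \<mu> \<beta> k)"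
      using Suc run_add[of a \<mu> \<beta> "k * a" a "[]"] by (simp add: add.commute)
    also have "\<dots> = play a \<mu> \<beta> (Suc k)"
      unfolding s by (rule run_round[OF assms]) (use Suc in blast)
    finally show ?case using Suc s by (auto simp: breaker_turn_def len)
  qed (simp add: play_def)
  then show ?thesis ..
qed

text \<open>The fresh randomness is drawn in advance as a list of independent choice functions, one for
  each attempt.\<close>

definition choices_strategy ::
    "((edge \<times> bool) list \<Rightarrow> edge set) \<Rightarrow> edge \<Rightarrow> nat \<Rightarrow> (edge set \<Rightarrow> edge) list \<Rightarrow> maker_strategy" where
  "choices_strategy A d l gs v =
     (if l \<le> length v \<and> length v - l < length gs then (gs ! (length v - l)) (A v) else d)"

lemma run_cong:
  assumes "\<And>v. length v \<ge> length (maker_view h) \<Longrightarrow> \<mu> v = \<mu>' v"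
  shows "run a \<mu> \<beta> s h = run a \<mu>' \<beta> s h"
  using assms
proof (induction s arbitrary: h)
  case (Suc s)
  have "run a \<mu> \<beta> s (attempt a \<beta> h e) = run a \<mu>' \<beta> s (attempt a \<beta> h e)" for e
    by (rule Suc.IH) (use Suc.prems in simp)
  then show ?case using Suc.prems by simp
qed simp

text \<open>Induction on the number of attempts. Conditioning on the first choice function fixes the
  first edge; the offset \<open>length (maker_view h)\<close> then makes the tail of the list act as
  a complete list at the next position.\<close>

lemma expectation_replicate_eq_expect:
  fixes G :: "(edge set \<Rightarrow> edge) pmf" and f :: "move list \<Rightarrow> real"
  assumes finG: "finite (set_pmf G)"
    and G: "\<And>v. map_pmf (\<lambda>g. g (A v)) G = pmf_of_set (A v)"
    and A: "\<And>v. finite (A v)" "\<And>v. A v \<noteq> {}"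
  shows "measure_pmf.expectation (replicate_pmf s G)
           (\<lambda>gs. f (run a (choices_strategy A d (length (maker_view h)) gs) \<beta> s h))
         = expect a \<beta> A s f h"
proof (induction s arbitrary: h)
  case (Suc s)
  let ?l = "length (maker_view h)"
  have fin: "finite (set_pmf (replicate_pmf s G))" for s
    using finG by (induction s) auto
  define F where "F gs = f (run a (choices_strategy A d ?l gs) \<beta> (Suc s) h)" for gs
  have F: "F (g # gs) = f (run a (choices_strategy A d
      (length (maker_view (attempt a \<beta> h (g (A (maker_view h)))))) gs) \<beta> s (attempt a \<beta> h (g (A (maker_view h)))))"
    for g gs
  proof -
    have 1: "choices_strategy A d ?l (g # gs) (maker_view h) = g (A (maker_view h))"
      by (simp add: choices_strategy_def)
    have "run a (choices_strategy A d ?l (g # gs)) \<beta> s (attempt a \<beta> h (g (A (maker_view h))))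
        = run a (choices_strategy A d (Suc ?l) gs) \<beta> s (attempt a \<beta> h (g (A (maker_view h))))"
    proof (rule run_cong)
      fix v :: "(edge \<times> bool) list"
      assume "length (maker_view (attempt a \<beta> h (g (A (maker_view h))))) \<le> length v"
      then have "length v - ?l = Suc (length v - Suc ?l)" by simp
      then show "choices_strategy A d ?l (g # gs) v = choices_strategy A d (Suc ?l) gs v"
        by (auto simp: choices_strategy_def)
    qed
    then show ?thesis by (simp add: F_def 1)
  qed
  have "measure_pmf.expectation (replicate_pmf (Suc s) G) F
      = (\<Sum>g\<in>set_pmf G. pmf G g *\<^sub>R measure_pmf.expectation
           (replicate_pmf s G \<bind> (\<lambda>gs. return_pmf (g # gs))) F)"
    unfolding replicate_pmf.simps
    by (rule pmf_expectation_bind) (auto simp: finG fin)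
  also have "\<dots> = (\<Sum>g\<in>set_pmf G. pmf G g *\<^sub>R expect a \<beta> A s f (attempt a \<beta> h (g (A (maker_view h)))))"
    using Suc.IH[of "attempt a \<beta> h (g (A (maker_view h)))" for g]
    by (simp add: map_pmf_def[symmetric] F)
  also have "\<dots> = measure_pmf.expectation G (\<lambda>g. expect a \<beta> A s f (attempt a \<beta> h (g (A (maker_view h)))))"
    by (subst integral_measure_pmf[of "set_pmf G"]) (auto simp: finG)
  also have "\<dots> = measure_pmf.expectation (map_pmf (\<lambda>g. g (A (maker_view h))) G)
                      (\<lambda>e. expect a \<beta> A s f (attempt a \<beta> h e))"
    by simp
  also have "\<dots> = expect a \<beta> A (Suc s) f h"
    unfolding G by (simp add: integral_pmf_of_set A)
  finally show ?case unfolding F_def .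
qed simp

lemma maker_edges_run_subset:
  assumes "maker_legal n \<mu>"
  shows "maker_edges h \<subseteq> complete_edges n \<Longrightarrow> maker_edges (run a \<mu> \<beta> s h) \<subseteq> complete_edges n"
proof (induction s arbitrary: h)
  case (Suc s)
  have "maker_edges (attempt a \<beta> h (\<mu> (maker_view h))) \<subseteq> complete_edges n"
    using Suc.prems assms by (auto simp: attempt_def Let_def breaker_turn_def maker_legal_def)
  then show ?case using Suc.IH by simp
qed simp

text \<open>Reduces the game to iterated averages against deterministic opponents: PhantomBreaker's
  private randomness is independent of Maker's, so a randomized opponent is a mixture of
  deterministic ones. The number of attempts is a multiple of \<open>a\<close> because positions are
  inspected after full rounds.\<close>

lemma strategy_from_expect:
  assumes "a > 0"
    and A: "\<And>v. A v \<subseteq> complete_edges n" "\<And>v. A v \<noteq> {}"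
    and p: "\<And>\<beta>. breaker_legal n b \<beta> \<Longrightarrow>
       p \<le> expect a \<beta> A (k * a) (\<lambda>h. of_bool (connected_spanning n (maker_edges h))) []"
  shows "\<exists>M. randomized_maker n M \<and> guarantees_win (spanning_trees n) n a b M p"
proof -
  obtain d where d: "d \<in> complete_edges n" using A[of "[]"] by blast
  have fin: "finite (complete_edges n)"
    by (rule finite_subset[of _ "Pow {..<n}"]) (auto simp: complete_edges_def)
  have finA: "finite (A v)" for v using A fin finite_subset by blast
  define X where "X = Pow (complete_edges n) - {{}}"
  have finX: "finite X" using fin by (simp add: X_def)
  have AX: "A v \<in> X" for v using A by (auto simp: X_def)
  \<comment> \<open>Choice functions are indexed by option sets instead of views to make the product
    finite. Each attempt needs its own copy, since the same option set can recur, for instance after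
    a failure.\<close>
  define G where "G = Pi_pmf X d pmf_of_set"
  have setG: "set_pmf G = PiE_dflt X d (set_pmf \<circ> pmf_of_set)"
    unfolding G_def by (rule set_Pi_pmf[OF finX])
  have finS: "finite S \<and> S \<noteq> {}" if "S \<in> X" for S
    using that fin by (auto simp: X_def intro: finite_subset)
  have setG': "g S \<in> S" if "g \<in> set_pmf G" "S \<in> X" for g S
  proof -
    have "g S \<in> set_pmf (pmf_of_set S)" using that by (simp add: setG PiE_dflt_def)
    then show ?thesis using finS[OF that(2)] set_pmf_of_set[of S] by simp
  qed
  have finG: "finite (set_pmf G)"
    unfolding setG by (rule finite_PiE_dflt[OF finX]) (simp add: finS)
  have marg: "map_pmf (\<lambda>g. g (A v)) G = pmf_of_set (A v)" for v
    unfolding G_def by (subst Pi_pmf_component) (auto simp: finX AX)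
  define T where "T = k * a"
  define M where "M = map_pmf (choices_strategy A d 0) (replicate_pmf T G)"
  have legal: "maker_legal n \<mu>" if "\<mu> \<in> set_pmf M" for \<mu>
  proof -
    from that obtain gs where gs: "gs \<in> set_pmf (replicate_pmf T G)" "\<mu> = choices_strategy A d 0 gs"
      by (auto simp: M_def)
    have gs': "g \<in> set_pmf G" if "g \<in> set gs" for g
      using gs(1) that by (auto simp: set_replicate_pmf)
    show ?thesis unfolding maker_legal_def gs(2) choices_strategy_def
      using d setG'[OF gs' AX] A(1) by (auto dest!: nth_mem)
  qed
  have win: "p \<le> measure_pmf.prob M {\<mu>. maker_wins (spanning_trees n) a \<mu> \<beta>}"
    if \<beta>: "breaker_legal n b \<beta>" for \<beta>
  proof -
    define con where "con = (\<lambda>h. connected_spanning n (maker_edges h))"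
    have "p \<le> measure_pmf.expectation (replicate_pmf T G)
           (\<lambda>gs. of_bool (con (run a (choices_strategy A d 0 gs) \<beta> T [])))"
      using p[OF \<beta>] expectation_replicate_eq_expect[OF finG marg finA A(2),
          where f = "\<lambda>h. of_bool (con h)" and h = "[]" and a = a and d = d and \<beta> = \<beta> and s = T]
      by (simp add: T_def con_def)
    also have "\<dots> = measure_pmf.expectation M (\<lambda>\<mu>. of_bool (con (run a \<mu> \<beta> T [])))"
      by (simp add: M_def)
    also have "\<dots> = measure_pmf.prob M {\<mu>. con (run a \<mu> \<beta> T [])}"
    proof -
      have "(\<lambda>\<mu>. of_bool (con (run a \<mu> \<beta> T []))) = (indicator {\<mu>. con (run a \<mu> \<beta> T [])} :: _ \<Rightarrow> real)"
        by (auto simp: indicator_def)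
      then show ?thesis by simp
    qed
    also have "\<dots> \<le> measure_pmf.prob M {\<mu>. maker_wins (spanning_trees n) a \<mu> \<beta>}"
    proof (rule measure_pmf.finite_measure_mono_AE)
      have "maker_wins (spanning_trees n) a \<mu> \<beta>" if "\<mu> \<in> set_pmf M" "con (run a \<mu> \<beta> T [])" for \<mu>
      proof -
        have "maker_edges (run a \<mu> \<beta> T []) \<subseteq> complete_edges n"
          by (rule maker_edges_run_subset[OF legal[OF that(1)]]) simp
        then have "\<exists>W\<in>spanning_trees n. W \<subseteq> maker_edges (play a \<mu> \<beta> k)"
          using spanning_tree_exists that(2) play_eq_run[OF \<open>a > 0\<close>, of \<mu> \<beta> k]
          by (simp add: con_def T_def)
        then show ?thesis by (auto simp: maker_wins_def)
      qed
      then show "AE \<mu> in M. \<mu> \<in> {\<mu>. con (run a \<mu> \<beta> T [])} \<longrightarrow>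
          \<mu> \<in> {\<mu>. maker_wins (spanning_trees n) a \<mu> \<beta>}"
        by (auto simp: AE_measure_pmf_iff)
    qed simp
    finally show ?thesis .
  qed
  have "p \<le> win_prob (spanning_trees n) a M B" if B: "randomized_breaker n b B" for B
  proof -
    let ?W = "{(\<mu>, \<beta>). maker_wins (spanning_trees n) a \<mu> \<beta>}"
    \<comment> \<open>Drawing \<open>\<beta>\<close> first exhibits the game as a mixture over fixed
      opponents.\<close>
    have "pair_pmf M B = B \<bind> (\<lambda>\<beta>. M \<bind> (\<lambda>\<mu>. return_pmf (\<mu>, \<beta>)))"
      unfolding pair_pmf_def by (rule bind_commute_pmf)
    also have "\<dots> = B \<bind> (\<lambda>\<beta>. map_pmf (\<lambda>\<mu>. (\<mu>, \<beta>)) M)" by (simp add: map_pmf_def)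
    finally have "ennreal (win_prob (spanning_trees n) a M B)
        = (\<integral>\<^sup>+\<beta>. emeasure (map_pmf (\<lambda>\<mu>. (\<mu>, \<beta>)) M) ?W \<partial>B)"
      by (simp add: win_prob_def measure_pmf.emeasure_eq_measure[symmetric])
    also have "\<dots> \<ge> (\<integral>\<^sup>+\<beta>. ennreal p \<partial>B)"
    proof (rule nn_integral_mono_AE)
      have "ennreal p \<le> emeasure (map_pmf (\<lambda>\<mu>. (\<mu>, \<beta>)) M) ?W" if "\<beta> \<in> set_pmf B" for \<beta>
      proof -
        have "breaker_legal n b \<beta>" using B that by (simp add: randomized_breaker_def)
        from win[OF this] show ?thesis
          by (simp add: vimage_def measure_pmf.emeasure_eq_measure ennreal_leI)
      qed
      then show "AE \<beta> in B. ennreal p \<le> emeasure (map_pmf (\<lambda>\<mu>. (\<mu>, \<beta>)) M) ?W"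
        by (auto simp: AE_measure_pmf_iff)
    qed
    finally have "ennreal p \<le> ennreal (win_prob (spanning_trees n) a M B)" by simp
    then show ?thesis by (simp add: win_prob_def)
  qed
  then show ?thesis using legal by (auto simp: randomized_maker_def guarantees_win_def)
qed

subsection \<open>Connected components\<close>

definition component :: "edge set \<Rightarrow> nat \<Rightarrow> nat set" where
  "component E x = {y. (\<lambda>u v. {u, v} \<in> E)\<^sup>*\<^sup>* x y}"

definition component_set :: "nat \<Rightarrow> edge set \<Rightarrow> nat set set" where
  "component_set n E = component E ` {..<n}"

lemma self_in_component [simp]: "x \<in> component E x"
  by (simp add: component_def)

lemma component_closed: "u \<in> component E x \<Longrightarrow> {u, v} \<in> E \<Longrightarrow> v \<in> component E x"
  by (auto simp: component_def intro: rtranclp.rtrancl_into_rtrancl)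

lemma component_least:
  assumes "x \<in> S" "\<And>u v. u \<in> S \<Longrightarrow> {u, v} \<in> E \<Longrightarrow> v \<in> S"
  shows "component E x \<subseteq> S"
proof -
  have "y \<in> S" if "(\<lambda>u v. {u, v} \<in> E)\<^sup>*\<^sup>* x y" for y
    using that by (induction rule: rtranclp_induct) (auto intro: assms)
  then show ?thesis by (auto simp: component_def)
qed

lemma component_eqI:
  assumes "y \<in> component E x"
  shows "component E y = component E x"
proof -
  have "symp (\<lambda>u v. {u, v} \<in> E)\<^sup>*\<^sup>*"
    by (rule symp_rtranclp) (auto simp: symp_def insert_commute)
  then have "x \<in> component E y" using assms by (auto simp: component_def dest: sympD)
  then show ?thesis using assms by (auto simp: component_def intro: rtranclp_trans)
qed

lemma component_disjoint: "component E x \<inter> component E y = {} \<or> component E x = component E y"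
  using component_eqI by blast

lemma component_subset:
  assumes "E \<subseteq> complete_edges n" "x < n"
  shows "component E x \<subseteq> {..<n}"
  by (rule component_least) (use assms in \<open>auto simp: complete_edges_def\<close>)

lemma component_mono: "E \<subseteq> E' \<Longrightarrow> component E x \<subseteq> component E' x"
  by (rule component_least) (auto intro: component_closed)

lemma component_insert:
  "component (insert {x, y} E) z =
     (if z \<in> component E x \<union> component E y then component E x \<union> component E y else component E z)"
proof -
  let ?E = "insert {x, y} E"
  have sub: "component E w \<subseteq> component ?E w" for w by (rule component_mono) auto
  have xy: "component ?E x = component ?E y"
    by (rule sym, rule component_eqI, rule component_closed[of x]) auto
  show ?thesis
  proof (cases "z \<in> component E x \<union> component E y")
    case True
    then have z: "component ?E z = component ?E x" using sub[of x] sub[of y] component_eqI xy by blast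
    have "component ?E z \<subseteq> component E x \<union> component E y"
    proof (rule component_least)
      fix u v assume "u \<in> component E x \<union> component E y" "{u, v} \<in> ?E"
      then show "v \<in> component E x \<union> component E y"
        by (cases "{u, v} \<in> E") (auto simp: doubleton_eq_iff intro: component_closed)
    qed (rule True)
    moreover have "component E x \<union> component E y \<subseteq> component ?E z" using sub[of x] sub[of y] xy z by auto
    ultimately show ?thesis using True by auto
  next
    case False
    then have nin: "x \<notin> component E z" "y \<notin> component E z"
      using component_eqI self_in_component by blast+
    have "component ?E z \<subseteq> component E z"
    proof (rule component_least)
      fix u v assume "u \<in> component E z" "{u, v} \<in> ?E"
      then show "v \<in> component E z"
        using nin by (cases "{u, v} \<in> E") (auto simp: doubleton_eq_iff intro: component_closed)
    qed simp
    then show ?thesis using sub[of z] False by auto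
  qed
qed

lemma component_set_insert:
  assumes "x < n" "y < n"
  shows "component_set n (insert {x, y} E) = insert (component E x \<union> component E y) (component_set n E - {component E x, component E y})"
    (is "?L = ?R")
proof
  show "?L \<subseteq> ?R"
  proof
    fix X assume "X \<in> ?L"
    then obtain z where z: "z < n" "X = component (insert {x, y} E) z" by (auto simp: component_set_def)
    show "X \<in> ?R"
    proof (cases "z \<in> component E x \<union> component E y")
      case False
      then have "component E z \<noteq> component E x" "component E z \<noteq> component E y" using self_in_component by blast+
      then show ?thesis using z False by (auto simp: component_insert component_set_def)
    qed (use z in \<open>auto simp: component_insert\<close>)
  qed
  show "?R \<subseteq> ?L"
  proof
    fix X assume X: "X \<in> ?R"
    show "X \<in> ?L"
    proof (cases "X = component E x \<union> component E y")
      case True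
      then have "X = component (insert {x, y} E) x" by (simp add: component_insert)
      then show ?thesis using assms by (auto simp: component_set_def)
    next
      case False
      then obtain z where z: "z < n" "X = component E z" "X \<noteq> component E x" "X \<noteq> component E y"
        using X by (auto simp: component_set_def)
      then have "z \<notin> component E x \<union> component E y" using component_eqI by blast
      then have "X = component (insert {x, y} E) z" using z by (simp add: component_insert)
      then show ?thesis using z by (auto simp: component_set_def)
    qed
  qed
qed

lemma component_set_cases:
  assumes "X \<in> component_set n E" "x \<in> X"
  shows "X = component E x"
  using assms component_eqI by (auto simp: component_set_def)

lemma component_in_component_set: "x < n \<Longrightarrow> component E x \<in> component_set n E"
  by (simp add: component_set_def)

lemma finite_component_set [simp]: "finite (component_set n E)"
  by (simp add: component_set_def)

lemma
  assumes "E \<subseteq> complete_edges n" "X \<in> component_set n E"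
  shows component_set_subset: "X \<subseteq> {..<n}" and component_set_nonempty: "X \<noteq> {}" and component_set_finite: "finite X"
proof -
  show "X \<subseteq> {..<n}" using assms component_subset[OF assms(1)] by (auto simp: component_set_def)
  then show "finite X" using finite_subset by blast
  obtain x where "X = component E x" using assms by (auto simp: component_set_def)
  then have "x \<in> X" by simp
  then show "X \<noteq> {}" by blast
qed

lemma component_set_disjoint:
  assumes "X \<in> component_set n E" "Y \<in> component_set n E" "X \<noteq> Y"
  shows "X \<inter> Y = {}"
  using assms component_disjoint by (auto simp: component_set_def)

lemma sum_card_component_set:
  assumes "E \<subseteq> complete_edges n"
  shows "(\<Sum>X\<in>component_set n E. card X) = n"
proof -
  have "\<Union> (component_set n E) = {..<n}"
    using component_set_subset[OF assms] self_in_component by (auto simp: component_set_def)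
  then have "n = card (\<Union> (component_set n E))" by simp
  also have "\<dots> = (\<Sum>X\<in>component_set n E. card X)"
    by (rule card_Union_disjoint)
       (auto simp: pairwise_def disjnt_def component_set_finite[OF assms] dest: component_set_disjoint)
  finally show ?thesis ..
qed

lemma connected_spanning_comp:
  assumes "\<And>x. x < n \<Longrightarrow> x \<in> component E z"
  shows "connected_spanning n E"
proof -
  have "component E u = component E z" if "u < n" for u using component_eqI[OF assms[OF that]] .
  then have "v \<in> component E u" if "u < n" "v < n" for u v using assms that by metis
  then show ?thesis by (simp add: connected_spanning_def component_def)
qed

lemma connected_spanning_card_component_set:
  assumes "card (component_set n E) \<le> 1"
  shows "connected_spanning n E"
proof (cases "n = 0")
  case False
  have "component E x = component E 0" if "x < n" for x
    using assms card_le_Suc0_iff_eq[of "component_set n E"] that False component_in_component_set by simp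
  then have "x \<in> component E 0" if "x < n" for x using that self_in_component by metis
  then show ?thesis by (rule connected_spanning_comp)
qed (simp add: connected_spanning_def)

section \<open>Vertex pairs and edge cuts\<close>

definition pairs :: "nat set \<Rightarrow> edge set" where
  "pairs S = {e. e \<subseteq> S \<and> card e = 2}"

lemma complete_edges_pairs: "complete_edges n = pairs {..<n}"
  by (simp add: complete_edges_def pairs_def)

lemma card_pairs: "finite S \<Longrightarrow> card (pairs S) = card S choose 2"
  by (simp add: pairs_def n_subsets)

lemma finite_complete_edges [simp]: "finite (complete_edges n)"
  by (rule finite_subset[of _ "Pow {..<n}"]) (auto simp: complete_edges_def)

definition edge_cut :: "nat \<Rightarrow> nat set \<Rightarrow> edge set" where
  "edge_cut n X = (\<lambda>(x, y). {x, y}) ` (X \<times> ({..<n} - X))"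

lemma card_edge_cut:
  assumes "X \<subseteq> {..<n}"
  shows "card (edge_cut n X) = card X * (n - card X)"
proof -
  have "inj_on (\<lambda>(x, y). {x, y}) (X \<times> ({..<n} - X))"
    by (auto simp: inj_on_def doubleton_eq_iff)
  then have "card (edge_cut n X) = card (X \<times> ({..<n} - X))" unfolding edge_cut_def by (rule card_image)
  also have "\<dots> = card X * (n - card X)"
    using assms by (simp add: card_cartesian_product card_Diff_subset finite_subset)
  finally show ?thesis .
qed

lemma edge_cut_subset: "X \<subseteq> {..<n} \<Longrightarrow> edge_cut n X \<subseteq> complete_edges n"
  by (auto simp: edge_cut_def complete_edges_def card_2_iff)

lemma edge_cut_nonempty: "X \<subseteq> {..<n} \<Longrightarrow> X \<noteq> {} \<Longrightarrow> X \<noteq> {..<n} \<Longrightarrow> edge_cut n X \<noteq> {}"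
  by (auto simp: edge_cut_def)

subsection \<open>The game seen by a behavioural strategy\<close>

locale game =
  fixes n a b :: nat and \<beta> :: breaker_strategy
    and A :: "(edge \<times> bool) list \<Rightarrow> edge set"
  assumes a_pos: "a > 0"
    and legal: "breaker_legal n b \<beta>"
    and opt_complete: "\<And>v. A v \<subseteq> complete_edges n"
    and opt_nonempty: "\<And>v. A v \<noteq> {}"
begin

abbreviation opt :: "move list \<Rightarrow> edge set" where
  "opt h \<equiv> A (maker_view h)"

abbreviation nxt :: "move list \<Rightarrow> edge \<Rightarrow> move list" where
  "nxt \<equiv> attempt a \<beta>"

abbreviation tm :: "move list \<Rightarrow> nat" where
  "tm h \<equiv> length (maker_view h)"

abbreviation Ev :: "nat \<Rightarrow> (move list \<Rightarrow> real) \<Rightarrow> move list \<Rightarrow> real" where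
  "Ev \<equiv> expect a \<beta> A"

text \<open>Failure probability: the chance that \<open>S\<close> does not hold after \<open>s\<close> more attempts.\<close>

definition fp :: "nat \<Rightarrow> (move list \<Rightarrow> bool) \<Rightarrow> move list \<Rightarrow> real" where
  "fp s S h = Ev s (\<lambda>h. of_bool (\<not> S h)) h"

text \<open>Bounds on PhantomBreaker's edges fail for arbitrary lists of moves; they hold for the
  histories that Maker's options and the legal \<open>\<beta>\<close> produce.\<close>

inductive reach :: "move list \<Rightarrow> bool" where
  reach_Nil: "reach []"
| reach_nxt: "reach h \<Longrightarrow> e \<in> opt h \<Longrightarrow> reach (nxt h e)"

lemma finite_opt [simp]: "finite (opt h)"
  using opt_complete finite_complete_edges finite_subset by blast

lemma card_opt_pos: "0 < card (opt h)"
  using opt_nonempty by (simp add: card_gt_0_iff)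

lemma view_nxt: "maker_view (nxt h e) = (e, e \<notin> breaker_edges h) # maker_view h"
  by (simp add: attempt_def breaker_turn_def Let_def)

lemma maker_nxt:
  "maker_edges (nxt h e) = (if e \<in> breaker_edges h then maker_edges h else insert e (maker_edges h))"
  by (simp add: attempt_def breaker_turn_def Let_def)

lemma breaker_nxt:
  "breaker_edges (nxt h e) =
     (if Suc (tm h) mod a = 0 then \<beta> (Attempt e # h) else {}) \<union> breaker_edges h"
  by (simp add: attempt_def breaker_turn_def Let_def)

lemma breaker_claim: "\<beta> h \<subseteq> complete_edges n" "finite (\<beta> h)" "card (\<beta> h) \<le> b"
proof -
  have "\<beta> h \<subseteq> unclaimed n h" "card (\<beta> h) = min b (card (unclaimed n h))"
    using legal by (auto simp: breaker_legal_def)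
  then show "\<beta> h \<subseteq> complete_edges n" "card (\<beta> h) \<le> b" by (auto simp: unclaimed_def)
  then show "finite (\<beta> h)" using finite_complete_edges finite_subset by blast
qed

lemma reach_complete:
  assumes "reach h"
  shows "maker_edges h \<subseteq> complete_edges n" "breaker_edges h \<subseteq> complete_edges n"
    "finite (breaker_edges h)"
proof -
  show "maker_edges h \<subseteq> complete_edges n" using assms
    by induction (use opt_complete in \<open>auto simp: maker_nxt\<close>)
  show "breaker_edges h \<subseteq> complete_edges n" using assms
    by induction (use breaker_claim in \<open>auto simp: breaker_nxt\<close>)
  then show "finite (breaker_edges h)" using finite_complete_edges finite_subset by blast
qed

text \<open>Subtraction-free form of a monotonicity:
  \<open>card (breaker_edges h \<inter> P) - b * (tm h div a)\<close> never increases, because a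
  turn of at most \<open>b\<close> edges occurs exactly when \<open>tm h div a\<close> grows by one.
  \<open>P\<close> is \<open>UNIV\<close> for the total and a star for a degree.\<close>

lemma card_breaker_nxt:
  assumes "reach h"
  shows "card (breaker_edges (nxt h e) \<inter> P) + b * (tm h div a)
       \<le> card (breaker_edges h \<inter> P) + b * (Suc (tm h) div a)"
proof (cases "Suc (tm h) mod a = 0")
  case True
  have "card (breaker_edges (nxt h e) \<inter> P)
      \<le> card (breaker_edges h \<inter> P \<union> \<beta> (Attempt e # h))"
    by (rule card_mono) (use reach_complete[OF assms] breaker_claim in \<open>auto simp: breaker_nxt\<close>)
  also have "\<dots> \<le> card (breaker_edges h \<inter> P) + card (\<beta> (Attempt e # h))"
    by (rule card_Un_le)
  finally show ?thesis using True breaker_claim(3)[of "Attempt e # h"]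
    by (simp add: div_Suc algebra_simps)
qed (simp add: breaker_nxt div_Suc)

lemma card_breaker:
  assumes "reach h"
  shows "card (breaker_edges h) \<le> b * (tm h div a)"
  using assms
proof induction
  case (reach_nxt h e)
  then show ?case using card_breaker_nxt[OF reach_nxt(1), of e UNIV] by simp
qed simp

text \<open>Supermartingale principle: a one-step inequality for \<open>\<phi>\<close> propagates to
  any number of attempts. The invariant \<open>I\<close> and the horizon \<open>tmax\<close> limit
  the positions at which that inequality has to be verified.\<close>

lemma expect_upper:
  fixes f :: "move list \<Rightarrow> real" and \<phi> :: "nat \<Rightarrow> move list \<Rightarrow> real"
  assumes "\<And>h e. reach h \<Longrightarrow> I h \<Longrightarrow> tm h < tmax \<Longrightarrow> e \<in> opt h \<Longrightarrow> I (nxt h e)"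
    and "\<And>h. reach h \<Longrightarrow> I h \<Longrightarrow> f h \<le> \<phi> 0 h"
    and "\<And>s h. reach h \<Longrightarrow> I h \<Longrightarrow> tm h + Suc s \<le> tmax \<Longrightarrow>
           (\<Sum>e\<in>opt h. \<phi> s (nxt h e)) \<le> card (opt h) * \<phi> (Suc s) h"
  shows "reach h \<Longrightarrow> I h \<Longrightarrow> tm h + s \<le> tmax \<Longrightarrow> Ev s f h \<le> \<phi> s h"
proof (induction s arbitrary: h)
  case (Suc s)
  have "(\<Sum>e\<in>opt h. Ev s f (nxt h e)) \<le> (\<Sum>e\<in>opt h. \<phi> s (nxt h e))"
    using Suc assms(1) by (intro sum_mono Suc.IH) (auto intro: reach_nxt)
  also have "\<dots> \<le> card (opt h) * \<phi> (Suc s) h" using Suc assms(3) by blast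
  finally show ?case
    using card_opt_pos[of h] by (simp add: divide_le_eq mult.commute)
qed (use assms(2) in auto)

section \<open>Calculus of expectations and failure probabilities\<close>

lemma expect_mono:
  assumes "reach h" "\<And>h'. reach h' \<Longrightarrow> tm h' = tm h + s \<Longrightarrow> f h' \<le> g h'"
  shows "Ev s f h \<le> Ev s g h"
  using assms
proof (induction s arbitrary: h)
  case (Suc s)
  have "Ev s f (nxt h e) \<le> Ev s g (nxt h e)" if "e \<in> opt h" for e
    by (rule Suc.IH) (use Suc.prems that in \<open>auto intro: reach_nxt\<close>)
  then show ?case by (auto intro!: divide_right_mono sum_mono)
qed simp

lemma expect_add: "Ev (s + t) f h = Ev s (Ev t f) h"
  by (induction s arbitrary: h) auto

lemma expect_affine: "Ev s (\<lambda>h. c + d * f h) h = c + d * Ev s f h"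
proof (induction s arbitrary: h)
  case (Suc s)
  then show ?case using opt_nonempty
    by (simp add: sum.distrib sum_distrib_left[symmetric] add_divide_distrib)
qed simp

lemma expect_const: "Ev s (\<lambda>_. c) h = c"
  using expect_affine[of s c 0 "\<lambda>_. 0" h] by simp

lemma expect_plus: "Ev s (\<lambda>h. f h + g h) h = Ev s f h + Ev s g h"
  by (induction s arbitrary: h) (auto simp: sum.distrib add_divide_distrib)

lemma expect_sum: "finite J \<Longrightarrow> Ev s (\<lambda>h. \<Sum>i\<in>J. f i h) h = (\<Sum>i\<in>J. Ev s (f i) h)"
proof (induction J rule: finite_induct)
  case empty
  show ?case by (simp add: expect_const)
qed (simp add: expect_plus)

lemma expect_win: "Ev s (\<lambda>h. of_bool (S h)) h = 1 - fp s S h"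
proof -
  have "(\<lambda>h. of_bool (S h)) = (\<lambda>h. 1 + (-1) * of_bool (\<not> S h) :: real)" by auto
  then show ?thesis unfolding fp_def by (simp only: expect_affine)
qed

lemma fp_nonneg: "reach h \<Longrightarrow> 0 \<le> fp s S h"
  unfolding fp_def by (subst expect_const[of s 0 h, symmetric]) (rule expect_mono, auto)

lemma fp_mono:
  assumes "reach h" "\<And>h'. reach h' \<Longrightarrow> tm h' = tm h + s \<Longrightarrow> S h' \<Longrightarrow> S' h'"
  shows "fp s S' h \<le> fp s S h"
  unfolding fp_def by (rule expect_mono) (use assms in auto)

lemma fp_conj:
  assumes "reach h"
  shows "fp s (\<lambda>h. S h \<and> S' h) h \<le> fp s S h + fp s S' h"
  unfolding fp_def expect_plus[symmetric] by (rule expect_mono) (use assms in auto)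

lemma fp_le_1: "reach h \<Longrightarrow> fp s S h \<le> 1"
  unfolding fp_def by (subst expect_const[of s 1 h, symmetric]) (rule expect_mono, auto)

text \<open>Success probabilities multiply, because the second bound holds from every position in
  which the first phase has succeeded. The product form keeps a positive chance over a bounded
  number of windows even though \<open>\<epsilon>\<close> may be close to \<open>1\<close>.\<close>

lemma fp_then:
  assumes "reach h" "0 \<le> \<epsilon>" "\<epsilon> \<le> 1" "fp s S h \<le> \<delta>"
    and "\<And>h'. reach h' \<Longrightarrow> tm h' = tm h + s \<Longrightarrow> S h' \<Longrightarrow> fp t S' h' \<le> \<epsilon>"
  shows "fp (s + t) S' h \<le> \<epsilon> + (1 - \<epsilon>) * \<delta>"
proof -
  have "fp (s + t) S' h \<le> \<epsilon> + (1 - \<epsilon>) * fp s S h"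
    unfolding fp_def expect_add expect_affine[symmetric]
    by (rule expect_mono[OF assms(1)])
       (use assms(5) fp_le_1 in \<open>auto simp: fp_def\<close>)
  also have "\<dots> \<le> \<epsilon> + (1 - \<epsilon>) * \<delta>" using assms by (auto intro!: mult_left_mono)
  finally show ?thesis .
qed

text \<open>Carries deterministic information, such as degree bounds, through a phase at no cost in
  probability.\<close>

lemma fp_invariant:
  assumes "\<And>h e. reach h \<Longrightarrow> I h \<Longrightarrow> tm h < tmax \<Longrightarrow> e \<in> opt h \<Longrightarrow> I (nxt h e)"
    and "reach h" "I h" "tm h + s \<le> tmax"
  shows "fp s (\<lambda>h. S h \<and> I h) h \<le> fp s S h"
  using assms(2-)
proof (induction s arbitrary: h)
  case (Suc s)
  have "fp s (\<lambda>h. S h \<and> I h) (nxt h e) \<le> fp s S (nxt h e)" if "e \<in> opt h" for e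
    by (rule Suc.IH) (use Suc.prems that assms(1) in \<open>auto intro: reach_nxt\<close>)
  then show ?case by (auto simp: fp_def intro!: divide_right_mono sum_mono)
qed (simp add: fp_def)

section \<open>Tail bounds from one-step estimates\<close>

lemma fp_leave:
  fixes \<epsilon> :: real
  assumes "\<And>h. reach h \<Longrightarrow> S h \<Longrightarrow> tm h < tmax \<Longrightarrow>
      real (card {e \<in> opt h. \<not> S (nxt h e)}) \<le> \<epsilon> * card (opt h)"
    and "0 \<le> \<epsilon>" "reach h" "S h" "tm h + s \<le> tmax"
  shows "fp s S h \<le> s * \<epsilon>"
proof -
  define \<phi> where "\<phi> t h = of_bool (\<not> S h) + real t * \<epsilon>" for t h
  have "fp s S h \<le> \<phi> s h" unfolding fp_def
  proof (rule expect_upper[where I = "\<lambda>_. True" and tmax = tmax and \<phi> = \<phi>])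
    fix t h assume h: "reach h" "tm h + Suc t \<le> tmax"
    have "(\<Sum>e\<in>opt h. \<phi> t (nxt h e))
        = card {e \<in> opt h. \<not> S (nxt h e)} + card (opt h) * (t * \<epsilon>)"
      by (simp add: \<phi>_def sum.distrib of_bool_def sum.If_cases Int_def)
    also have "card {e \<in> opt h. \<not> S (nxt h e)} \<le> card (opt h) * (of_bool (\<not> S h) + \<epsilon>)"
    proof (cases "S h")
      case True
      then show ?thesis using assms(1)[OF h(1) True] h(2) by (simp add: mult.commute)
    next
      case False
      have "real (card {e \<in> opt h. \<not> S (nxt h e)}) \<le> card (opt h)"
        by (simp add: card_mono)
      also have "\<dots> \<le> card (opt h) * (1 + \<epsilon>)" using assms(2) by (simp add: algebra_simps)
      finally show ?thesis using False by simp
    qed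
    finally show "(\<Sum>e\<in>opt h. \<phi> t (nxt h e)) \<le> real (card (opt h)) * \<phi> (Suc t) h"
      by (simp add: \<phi>_def algebra_simps)
  qed (use assms in \<open>auto simp: \<phi>_def\<close>)
  then show ?thesis using assms by (simp add: \<phi>_def)
qed

text \<open>The potential \<open>2 ^ \<mu> h\<close> is at least halved with probability at least
  \<open>q\<close> and otherwise does not grow, so its mean shrinks by the factor
  \<open>1 - q / 2\<close> per attempt; as long as \<open>S\<close> fails it is at least
  \<open>1\<close>. Hence \<open>c * k\<close> attempts work off \<open>k\<close> missing successes,
  up to an exponentially small risk, as soon as \<open>2 * (1 - q / 2) ^ c < 1\<close>.\<close>

lemma fp_progress:
  fixes \<mu> :: "move list \<Rightarrow> nat" and q :: real
  assumes inv: "\<And>h e. reach h \<Longrightarrow> I h \<Longrightarrow> tm h < tmax \<Longrightarrow> e \<in> opt h \<Longrightarrow> I (nxt h e)"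
    and stop: "\<And>h e. reach h \<Longrightarrow> I h \<Longrightarrow> tm h < tmax \<Longrightarrow> S h \<Longrightarrow> e \<in> opt h \<Longrightarrow> S (nxt h e)"
    and few: "\<And>h. reach h \<Longrightarrow> I h \<Longrightarrow> tm h < tmax \<Longrightarrow> \<not> S h \<Longrightarrow>
      real (card (opt h \<inter> breaker_edges h)) \<le> (1 - q) * card (opt h)"
    and succ: "\<And>h e. reach h \<Longrightarrow> I h \<Longrightarrow> tm h < tmax \<Longrightarrow> \<not> S h \<Longrightarrow> e \<in> opt h \<Longrightarrow>
      e \<notin> breaker_edges h \<Longrightarrow> S (nxt h e) \<or> \<mu> (nxt h e) < \<mu> h"
    and fail: "\<And>h e. reach h \<Longrightarrow> I h \<Longrightarrow> tm h < tmax \<Longrightarrow> \<not> S h \<Longrightarrow> e \<in> opt h \<Longrightarrow>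
      e \<in> breaker_edges h \<Longrightarrow> S (nxt h e) \<or> \<mu> (nxt h e) \<le> \<mu> h"
    and q: "0 \<le> q" "q \<le> 1"
    and h: "reach h" "I h" "tm h + s \<le> tmax"
  shows "fp s S h \<le> 2 ^ \<mu> h * (1 - q / 2) ^ s"
proof -
  define r where "r = 1 - q / 2"
  have r: "0 \<le> r" using q by (simp add: r_def)
  define \<phi> :: "nat \<Rightarrow> move list \<Rightarrow> real" where "\<phi> t h = (if S h then 0 else 2 ^ \<mu> h * r ^ t)" for t h
  have "fp s S h \<le> \<phi> s h" unfolding fp_def
  proof (rule expect_upper[where I = I and tmax = tmax and \<phi> = \<phi>])
    fix t h assume h: "reach h" "I h" "tm h + Suc t \<le> tmax"
    then have t: "tm h < tmax" by simp
    show "(\<Sum>e\<in>opt h. \<phi> t (nxt h e)) \<le> real (card (opt h)) * \<phi> (Suc t) h"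
    proof (cases "S h")
      case True
      then show ?thesis using stop[OF h(1,2) t] by (simp add: \<phi>_def)
    next
      case False
      let ?w = "2 ^ \<mu> h * r ^ t"
      have \<phi>: "\<phi> t (nxt h e) \<le> ?w / 2 + ?w / 2 * of_bool (e \<in> breaker_edges h)" if e: "e \<in> opt h" for e
      proof (cases "e \<in> breaker_edges h")
        case True
        then have "\<phi> t (nxt h e) \<le> ?w"
          using fail[OF h(1,2) t False e] r by (auto simp: \<phi>_def intro!: mult_right_mono)
        then show ?thesis using True by (simp add: mult.commute)
      next
        case e2: False
        have "\<phi> t (nxt h e) \<le> ?w / 2"
        proof (cases "S (nxt h e)")
          case True
          then show ?thesis using r by (simp add: \<phi>_def)
        next
          case not_S: False
          then have "Suc (\<mu> (nxt h e)) \<le> \<mu> h" using succ[OF h(1,2) t False e e2] by simp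
          then have "(2::real) ^ Suc (\<mu> (nxt h e)) \<le> 2 ^ \<mu> h" by (intro power_increasing) auto
          then have "2 * 2 ^ \<mu> (nxt h e) * r ^ t \<le> ?w" using r by (intro mult_right_mono) auto
          then show ?thesis using not_S by (simp add: \<phi>_def)
        qed
        then show ?thesis using e2 by simp
      qed
      have "(\<Sum>e\<in>opt h. \<phi> t (nxt h e)) \<le> (\<Sum>e\<in>opt h. ?w / 2 + ?w / 2 * of_bool (e \<in> breaker_edges h))"
        by (rule sum_mono[OF \<phi>])
      also have "\<dots> = ?w / 2 * (card (opt h) + card (opt h \<inter> breaker_edges h))"
        by (simp only: sum.distrib sum_distrib_left[symmetric])
           (simp add: of_bool_def sum.If_cases Int_def algebra_simps)
      also have "\<dots> \<le> ?w / 2 * (card (opt h) + (1 - q) * card (opt h))"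
        using few[OF h(1,2) t False] r by (intro mult_left_mono) auto
      also have "\<dots> = card (opt h) * \<phi> (Suc t) h"
        using False by (simp add: \<phi>_def r_def field_simps)
      finally show ?thesis .
    qed
  qed (use h inv in \<open>auto simp: \<phi>_def\<close>)
  also have "\<dots> \<le> 2 ^ \<mu> h * r ^ s" using r by (simp add: \<phi>_def)
  finally show ?thesis by (simp add: r_def)
qed

lemma fp_decay:
  fixes \<rho> :: real
  assumes inv: "\<And>h e. reach h \<Longrightarrow> I h \<Longrightarrow> tm h < tmax \<Longrightarrow> e \<in> opt h \<Longrightarrow> I (nxt h e)"
    and stop: "\<And>h e. reach h \<Longrightarrow> I h \<Longrightarrow> tm h < tmax \<Longrightarrow> S h \<Longrightarrow> e \<in> opt h \<Longrightarrow> S (nxt h e)"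
    and hit: "\<And>h. reach h \<Longrightarrow> I h \<Longrightarrow> tm h < tmax \<Longrightarrow> \<not> S h \<Longrightarrow>
      \<rho> * card (opt h) \<le> real (card {e \<in> opt h. S (nxt h e)})"
    and \<rho>: "0 \<le> \<rho>" "\<rho> \<le> 1"
    and h: "reach h" "I h" "tm h + s \<le> tmax"
  shows "fp s S h \<le> (1 - \<rho>) ^ s"
proof -
  define \<phi> :: "nat \<Rightarrow> move list \<Rightarrow> real" where "\<phi> t h = (1 - \<rho>) ^ t * of_bool (\<not> S h)" for t h
  have "fp s S h \<le> \<phi> s h" unfolding fp_def
  proof (rule expect_upper[where I = I and tmax = tmax and \<phi> = \<phi>])
    fix t h assume h: "reach h" "I h" "tm h + Suc t \<le> tmax"
    then have t: "tm h < tmax" by simp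
    show "(\<Sum>e\<in>opt h. \<phi> t (nxt h e)) \<le> real (card (opt h)) * \<phi> (Suc t) h"
    proof (cases "S h")
      case True
      then show ?thesis using stop[OF h(1,2) t] by (simp add: \<phi>_def)
    next
      case False
      have "(\<Sum>e\<in>opt h. \<phi> t (nxt h e)) = (1 - \<rho>) ^ t * card {e \<in> opt h. \<not> S (nxt h e)}"
        by (simp add: \<phi>_def sum_distrib_left[symmetric] of_bool_def sum.If_cases Int_def)
      also have "real (card {e \<in> opt h. \<not> S (nxt h e)})
          = real (card (opt h)) - real (card {e \<in> opt h. S (nxt h e)})"
      proof -
        have "card (opt h) = card {e \<in> opt h. S (nxt h e)} + card {e \<in> opt h. \<not> S (nxt h e)}"
          by (subst card_Un_disjoint[symmetric]) (auto intro: arg_cong[where f = card])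
        then show ?thesis by simp
      qed
      also have "(1 - \<rho>) ^ t * \<dots> \<le> (1 - \<rho>) ^ t * (card (opt h) - \<rho> * card (opt h))"
        using hit[OF h(1,2) t False] \<rho> by (intro mult_left_mono) auto
      also have "\<dots> = card (opt h) * \<phi> (Suc t) h" using False by (simp add: \<phi>_def algebra_simps)
      finally show ?thesis .
    qed
  qed (use h inv in \<open>auto simp: \<phi>_def\<close>)
  also have "\<dots> \<le> (1 - \<rho>) ^ s" using \<rho> by (simp add: \<phi>_def)
  finally show ?thesis .
qed

lemma expect_drift:
  fixes f :: "move list \<Rightarrow> real" and \<epsilon> :: real
  assumes inv: "\<And>h e. reach h \<Longrightarrow> I h \<Longrightarrow> tm h < tmax \<Longrightarrow> e \<in> opt h \<Longrightarrow> I (nxt h e)"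
    and drift: "\<And>h. reach h \<Longrightarrow> I h \<Longrightarrow> tm h < tmax \<Longrightarrow>
      (\<Sum>e\<in>opt h. f (nxt h e)) \<le> card (opt h) * (f h + \<epsilon>)"
    and h: "reach h" "I h" "tm h + s \<le> tmax"
  shows "Ev s f h \<le> f h + s * \<epsilon>"
proof (rule expect_upper[where I = I and tmax = tmax and \<phi> = "\<lambda>t h. f h + t * \<epsilon>"])
  fix t h assume h: "reach h" "I h" "tm h + Suc t \<le> tmax"
  then have "(\<Sum>e\<in>opt h. f (nxt h e)) \<le> card (opt h) * (f h + \<epsilon>)" by (intro drift) auto
  then show "(\<Sum>e\<in>opt h. f (nxt h e) + t * \<epsilon>) \<le> card (opt h) * (f h + (Suc t) * \<epsilon>)"
    by (simp add: sum.distrib algebra_simps)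
qed (use h inv in auto)

lemma fp_markov:
  fixes f :: "move list \<Rightarrow> real"
  assumes "reach h" "0 < c" "\<And>h. 0 \<le> f h" "Ev s f h \<le> m"
  shows "fp s (\<lambda>h. f h < c) h \<le> m / c"
proof -
  have "fp s (\<lambda>h. f h < c) h \<le> Ev s (\<lambda>h. 0 + (1 / c) * f h) h"
    unfolding fp_def by (rule expect_mono) (use assms in \<open>auto simp: field_simps\<close>)
  also have "\<dots> = Ev s f h / c" by (subst expect_affine) simp
  also have "\<dots> \<le> m / c" using assms by (intro divide_right_mono) auto
  finally show ?thesis .
qed

end

definition successes :: "(edge \<times> bool) list \<Rightarrow> edge set" where
  "successes v = {e. (e, True) \<in> set v}"

lemma successes_maker_view: "successes (maker_view h) = maker_edges h"
  by (induction h rule: maker_edges.induct) (auto simp: successes_def)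

subsection \<open>Random Kruskal steps\<close>

definition cross :: "nat \<Rightarrow> edge set \<Rightarrow> edge set" where
  "cross n E = {{x, y} | x y. x < n \<and> y < n \<and> component E x \<noteq> component E y}"

lemma cross_subset: "cross n E \<subseteq> complete_edges n"
  by (auto simp: cross_def complete_edges_def card_2_iff)

lemma finite_cross [simp]: "finite (cross n E)"
  using cross_subset finite_complete_edges finite_subset by blast

lemma edge_cut_subset_cross:
  assumes "E \<subseteq> complete_edges n" "X \<in> component_set n E"
  shows "edge_cut n X \<subseteq> cross n E"
proof
  fix e assume "e \<in> edge_cut n X"
  then obtain x y where xy: "x \<in> X" "y < n" "y \<notin> X" "e = {x, y}" by (auto simp: edge_cut_def)
  have "x < n" using component_set_subset[OF assms] xy by auto
  moreover have "component E x \<noteq> component E y"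
    using xy component_set_cases[OF assms(2) xy(1)] self_in_component by blast
  ultimately show "e \<in> cross n E" using xy by (auto simp: cross_def)
qed

lemma complete_edgeE:
  assumes "e \<in> complete_edges n"
  obtains x y where "e = {x, y}" "x < n" "y < n" "x \<noteq> y"
proof -
  obtain x y where "e = {x, y}" "x \<noteq> y"
    using assms by (auto simp: complete_edges_def card_2_iff)
  then show ?thesis using assms that by (auto simp: complete_edges_def)
qed

lemma card_component_set_insert_le:
  assumes "e \<in> complete_edges n"
  shows "card (component_set n (insert e E)) \<le> card (component_set n E)"
proof -
  obtain x y where e: "e = {x, y}" "x < n" "y < n" using assms by (rule complete_edgeE)
  have "card (component_set n (insert e E))
      \<le> Suc (card (component_set n E - {component E x, component E y}))"
    unfolding e(1) component_set_insert[OF e(2,3)] by (rule card_insert_le_m1) auto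
  also have "\<dots> \<le> Suc (card (component_set n E - {component E x}))"
    by (intro Suc_le_mono[THEN iffD2] card_mono) auto
  also have "\<dots> = card (component_set n E)"
    by (rule card_Suc_Diff1) (use e in \<open>auto simp: component_in_component_set\<close>)
  finally show ?thesis .
qed

lemma card_component_set_insert_cross:
  assumes "e \<in> cross n E"
  shows "Suc (card (component_set n (insert e E))) = card (component_set n E)"
proof -
  obtain x y where e: "e = {x, y}" "x < n" "y < n" "component E x \<noteq> component E y"
    using assms by (auto simp: cross_def)
  let ?U = "component E x \<union> component E y"
  have "?U \<notin> component_set n E"
  proof
    assume "?U \<in> component_set n E"
    then have "?U = component E x" "?U = component E y"
      by (auto intro!: component_set_cases[of ?U n E])
    then show False using e(4) by simp
  qed
  then have "card (component_set n (insert e E))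
      = Suc (card (component_set n E - {component E x, component E y}))"
    unfolding e(1) component_set_insert[OF e(2,3)] by (subst card_insert_disjoint) auto
  also have "\<dots> = Suc (card (component_set n E) - 2)"
    using e by (subst card_Diff_subset) (auto simp: component_in_component_set)
  moreover have "card {component E x, component E y} \<le> card (component_set n E)"
    by (rule card_mono) (use e in \<open>auto simp: component_in_component_set\<close>)
  ultimately show ?thesis using e(4) by simp
qed

lemma cross_nonempty:
  assumes "card (component_set n E) > 1"
  shows "cross n E \<noteq> {}"
proof -
  have "\<not> card (component_set n E) \<le> Suc 0" using assms by simp
  then obtain X Y where "X \<in> component_set n E" "Y \<in> component_set n E" "X \<noteq> Y"
    using card_le_Suc0_iff_eq[OF finite_component_set] by blast
  then show ?thesis by (auto simp: component_set_def cross_def)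
qed

lemma two_card_component_le:
  assumes "E \<subseteq> complete_edges n" "X \<in> component_set n E" "Y \<in> component_set n E" "X \<noteq> Y" "card X \<le> card Y"
  shows "2 * card X \<le> n"
proof -
  have "card X + card Y = card (X \<union> Y)"
    using component_set_disjoint[OF assms(2-4)] component_set_finite[OF assms(1)] assms(2,3)
    by (simp add: card_Un_disjoint)
  also have "\<dots> \<le> card {..<n}"
    by (rule card_mono) (use component_set_subset[OF assms(1)] assms(2,3) in auto)
  finally show ?thesis using assms(5) by simp
qed

text \<open>Every crossing edge lies in the cut of some component other than one fixed largest
  component \<open>G\<close>, and all those have at most \<open>n / 2\<close> vertices. A free
  crossing edge belongs to at most two cuts, which costs the factor \<open>2\<close>.\<close>

lemma card_cross_blocked:
  fixes \<kappa> :: real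
  assumes E: "E \<subseteq> complete_edges n" and n: "n > 0"
    and edge_cut: "\<And>X. X \<in> component_set n E \<Longrightarrow> 2 * card X \<le> n \<Longrightarrow>
      \<kappa> * card (edge_cut n X) \<le> card (edge_cut n X - B)"
  shows "\<kappa> / 2 * card (cross n E) \<le> card (cross n E - B)"
proof -
  have ne: "component_set n E \<noteq> {}" using n by (auto simp: component_set_def)
  obtain G where G: "G \<in> component_set n E" "\<And>X. X \<in> component_set n E \<Longrightarrow> card X \<le> card G"
  proof -
    have "Max (card ` component_set n E) \<in> card ` component_set n E" using ne by (intro Max_in) auto
    then obtain G where "G \<in> component_set n E" "card G = Max (card ` component_set n E)" by auto
    then show ?thesis using that by simp
  qed
  define F where "F = component_set n E - {G}"
  have F: "finite F" "F \<subseteq> component_set n E" by (auto simp: F_def)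
  have small: "2 * card X \<le> n" if "X \<in> F" for X
    using two_card_component_le[OF E _ G(1)] G(2) that by (auto simp: F_def)
  have fincut: "finite (edge_cut n X)" if "X \<in> F" for X
    using edge_cut_subset_cross[OF E] F that finite_cross finite_subset by blast
  have "cross n E \<subseteq> (\<Union>X\<in>F. edge_cut n X)"
  proof
    fix e assume "e \<in> cross n E"
    then obtain x y where e: "e = {x, y}" "x < n" "y < n" "component E x \<noteq> component E y"
      by (auto simp: cross_def)
    show "e \<in> (\<Union>X\<in>F. edge_cut n X)"
    proof (cases "component E x = G")
      case False
      have "y \<notin> component E x" using component_eqI e(4) by blast
      then have "e \<in> edge_cut n (component E x)" using e by (auto simp: edge_cut_def)
      then show ?thesis using False e by (auto simp: F_def component_in_component_set)
    next
      case True
      have "x \<notin> component E y" using component_eqI e(4) by blast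
      then have "e \<in> edge_cut n (component E y)" using e by (auto simp: edge_cut_def)
      then show ?thesis using True e by (auto simp: F_def component_in_component_set)
    qed
  qed
  then have "card (cross n E) \<le> card (\<Union>X\<in>F. edge_cut n X)"
    by (rule card_mono[rotated]) (use F fincut in auto)
  also have "\<dots> \<le> (\<Sum>X\<in>F. card (edge_cut n X))" by (rule card_UN_le[OF F(1)])
  finally have 1: "card (cross n E) \<le> (\<Sum>X\<in>F. card (edge_cut n X))" .
  have "(\<Sum>X\<in>F. card (edge_cut n X - B)) = (\<Sum>X\<in>F. \<Sum>e\<in>cross n E - B. of_bool (e \<in> edge_cut n X))"
  proof (intro sum.cong refl)
    fix X assume "X \<in> F"
    then have "edge_cut n X - B = {e \<in> cross n E - B. e \<in> edge_cut n X}"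
      using edge_cut_subset_cross[OF E] F by auto
    then show "card (edge_cut n X - B) = (\<Sum>e\<in>cross n E - B. of_bool (e \<in> edge_cut n X))"
      by (simp add: of_bool_def sum.If_cases Int_def)
  qed
  also have "\<dots> = (\<Sum>e\<in>cross n E - B. \<Sum>X\<in>F. of_bool (e \<in> edge_cut n X))" by (rule sum.swap)
  also have "\<dots> \<le> (\<Sum>e\<in>cross n E - B. 2)"
  proof (rule sum_mono)
    fix e assume "e \<in> cross n E - B"
    then obtain x y where e: "e = {x, y}" by (auto simp: cross_def)
    have "{X \<in> F. e \<in> edge_cut n X} \<subseteq> {component E x, component E y}"
      using F e component_set_cases by (fastforce simp: edge_cut_def doubleton_eq_iff)
    then have "card {X \<in> F. e \<in> edge_cut n X} \<le> card {component E x, component E y}"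
      by (rule card_mono[rotated]) simp
    also have "\<dots> \<le> 2" by (simp add: card_insert_if)
    finally show "(\<Sum>X\<in>F. of_bool (e \<in> edge_cut n X)) \<le> (2::nat)"
      using F by (simp add: of_bool_def sum.If_cases Int_def)
  qed
  finally have 2: "(\<Sum>X\<in>F. card (edge_cut n X - B)) \<le> 2 * card (cross n E - B)" by simp
  show ?thesis
  proof (cases "\<kappa> \<ge> 0")
    case True
    have "\<kappa> * card (cross n E) \<le> \<kappa> * (\<Sum>X\<in>F. card (edge_cut n X))"
      using 1 True by (intro mult_left_mono) linarith+
    also have "\<dots> \<le> (\<Sum>X\<in>F. card (edge_cut n X - B))"
      unfolding of_nat_sum sum_distrib_left using edge_cut small F by (intro sum_mono) auto
    also have "\<dots> \<le> 2 * card (cross n E - B)" using 2 by linarith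
    finally show ?thesis by simp
  next
    case False
    then have "\<kappa> / 2 * card (cross n E) \<le> 0" by (simp add: mult_nonpos_nonneg)
    then show ?thesis by linarith
  qed
qed

lemma card_cross_le: "2 * card (cross n E) \<le> n * n"
proof -
  have "card (cross n E) \<le> card (complete_edges n)" by (rule card_mono) (auto intro: cross_subset[THEN subsetD])
  also have "\<dots> = n * (n - 1) div 2" by (simp add: complete_edges_pairs card_pairs choose_two)
  finally have "2 * card (cross n E) \<le> n * (n - 1)" by linarith
  also have "\<dots> \<le> n * n" by simp
  finally show ?thesis .
qed

lemma component_insert_cut:
  assumes "E \<subseteq> complete_edges n" "v < n" "e \<in> edge_cut n (component E v)"
  shows "card (component E v) < card (component (insert e E) v)"
proof (rule psubset_card_mono)
  obtain x y where e: "x \<in> component E v" "y < n" "y \<notin> component E v" "e = {x, y}"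
    using assms by (auto simp: edge_cut_def)
  have "insert e E \<subseteq> complete_edges n"
    using assms edge_cut_subset[OF component_subset[OF assms(1,2)]] by auto
  then show "finite (component (insert e E) v)" 
    by (rule finite_subset[OF component_subset[OF _ assms(2)]]) simp
  have ev: "component E x = component E v" by (rule component_eqI[OF e(1)])
  have "component (insert e E) v = component E v \<union> component E y"
    unfolding e(4) component_insert ev by simp
  moreover have "y \<in> component E y" by simp
  ultimately show "component E v \<subset> component (insert e E) v" using e(3) by blast
qed

context game
begin

section \<open>PhantomBreaker's degrees and blocked cut edges\<close>

definition deg :: "move list \<Rightarrow> nat \<Rightarrow> nat" where
  "deg h v = card (breaker_edges h \<inter> {e. v \<in> e})"

lemma deg_nxt:
  assumes "reach h"
  shows "deg (nxt h e) v + b * (tm h div a) \<le> deg h v + b * (Suc (tm h) div a)"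
  using card_breaker_nxt[OF assms] by (simp add: deg_def)

lemma sum_deg:
  assumes "reach h"
  shows "(\<Sum>v<n. deg h v) = 2 * card (breaker_edges h)"
proof -
  have fin: "finite (breaker_edges h)" using reach_complete[OF assms] by blast
  have "(\<Sum>v<n. deg h v) = (\<Sum>v<n. \<Sum>e\<in>breaker_edges h. of_bool (v \<in> e))"
    using fin by (simp add: deg_def of_bool_def sum.If_cases)
  also have "\<dots> = (\<Sum>e\<in>breaker_edges h. \<Sum>v<n. of_bool (v \<in> e))" by (rule sum.swap)
  also have "\<dots> = (\<Sum>e\<in>breaker_edges h. 2)"
  proof (intro sum.cong refl)
    fix e assume "e \<in> breaker_edges h"
    then have "e \<subseteq> {..<n}" "card e = 2" using reach_complete[OF assms] by (auto simp: complete_edges_def)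
    then show "(\<Sum>v<n. of_bool (v \<in> e)) = (2::nat)"
      by (simp add: of_bool_def sum.If_cases Int_absorb1)
  qed
  finally show ?thesis by simp
qed

text \<open>Markov's inequality for the degrees, whose sum is twice the number of edges.\<close>

lemma card_heavy:
  assumes "reach h"
  shows "card {v. v < n \<and> k \<le> c * deg h v} * k \<le> 2 * c * card (breaker_edges h)"
proof -
  have "card {v. v < n \<and> k \<le> c * deg h v} * k = (\<Sum>v\<in>{v. v < n \<and> k \<le> c * deg h v}. k)" by simp
  also have "\<dots> \<le> (\<Sum>v\<in>{v. v < n \<and> k \<le> c * deg h v}. c * deg h v)" by (rule sum_mono) simp
  also have "\<dots> \<le> (\<Sum>v<n. c * deg h v)" by (rule sum_mono2) auto
  also have "\<dots> = 2 * c * card (breaker_edges h)"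
    by (simp add: sum_distrib_left[symmetric] sum_deg[OF assms])
  finally show ?thesis .
qed

abbreviation graph_comp :: "move list \<Rightarrow> nat \<Rightarrow> nat set" where
  "graph_comp h \<equiv> component (maker_edges h)"

abbreviation graph_comps :: "move list \<Rightarrow> nat set set" where
  "graph_comps h \<equiv> component_set n (maker_edges h)"

lemma graph_comp_mono: "graph_comp h v \<subseteq> graph_comp (nxt h e) v"
  by (rule component_mono) (auto simp: maker_nxt)

lemma card_graph_comp_mono:
  assumes "reach h" "e \<in> opt h" "v < n"
  shows "card (graph_comp h v) \<le> card (graph_comp (nxt h e) v)"
proof (rule card_mono[OF _ graph_comp_mono])
  show "finite (graph_comp (nxt h e) v)"
    by (rule finite_subset[OF component_subset[OF reach_complete(1)[OF reach_nxt[OF assms(1,2)]] assms(3)]]) simp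
qed

lemma card_graph_comps_mono:
  assumes "e \<in> opt h"
  shows "card (graph_comps (nxt h e)) \<le> card (graph_comps h)"
  using card_component_set_insert_le[of e n] assms opt_complete by (auto simp: maker_nxt)

lemma cut_blocked_le_deg:
  assumes "reach h" "X \<subseteq> {..<n}"
  shows "card (edge_cut n X \<inter> breaker_edges h) \<le> (\<Sum>v\<in>X. deg h v)"
proof -
  have X: "finite X" using assms(2) by (rule finite_subset) simp
  have fin: "finite (breaker_edges h)" using reach_complete[OF assms(1)] by blast
  have "card (edge_cut n X \<inter> breaker_edges h) \<le> card (\<Union>v\<in>X. breaker_edges h \<inter> {e. v \<in> e})"
    by (rule card_mono) (use X fin in \<open>auto simp: edge_cut_def\<close>)
  also have "\<dots> \<le> (\<Sum>v\<in>X. deg h v)" unfolding deg_def by (rule card_UN_le[OF X])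
  finally show ?thesis .
qed

lemma cut_free:
  assumes "X \<subseteq> {..<n}"
  shows "card (edge_cut n X - breaker_edges h) + card (edge_cut n X \<inter> breaker_edges h) = card X * (n - card X)"
proof -
  have "finite (edge_cut n X)" using edge_cut_subset[OF assms] finite_complete_edges finite_subset by blast
  then show ?thesis unfolding card_edge_cut[OF assms, symmetric]
    by (subst card_Un_disjoint[symmetric]) (auto intro: arg_cong[where f = card])
qed

end

subsection \<open>Arbitrary bias: winning with positive probability\<close>

lemma connected_spanning_mono:
  assumes "E \<subseteq> E'" "connected_spanning n E"
  shows "connected_spanning n E'"
proof -
  have "(\<lambda>x y. {x, y} \<in> E)\<^sup>*\<^sup>* \<le> (\<lambda>x y. {x, y} \<in> E')\<^sup>*\<^sup>*"
    by (rule rtranclp_mono) (use assms(1) in auto)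
  then show ?thesis using assms(2) unfolding connected_spanning_def by blast
qed

context game
begin

lemma fp_extend:
  assumes "\<And>h e. reach h \<Longrightarrow> S h \<Longrightarrow> e \<in> opt h \<Longrightarrow> S (nxt h e)" "reach h"
  shows "fp (s + r) S h \<le> fp s S h"
proof -
  have "fp r S h' \<le> real r * 0" if "reach h'" "S h'" for h'
    by (rule fp_leave[where tmax = "tm h' + r"])
       (use assms(1) that in \<open>auto simp: card_eq_0_iff\<close>)
  then show ?thesis
    using fp_then[OF assms(2), of 0 s S "fp s S h" r S] by simp
qed

lemma connected_nxt:
  "connected_spanning n (maker_edges h) \<Longrightarrow> connected_spanning n (maker_edges (nxt h e))"
  by (erule connected_spanning_mono[rotated]) (auto simp: maker_nxt)

lemma deg_nxt_le:
  assumes "reach h"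
  shows "deg (nxt h e) v \<le> deg h v + b"
proof -
  have "Suc (tm h) div a \<le> tm h div a + 1" by (simp add: div_Suc)
  then have "b * (Suc (tm h) div a) \<le> b * (tm h div a + 1)" by (rule mult_le_mono2)
  also have "\<dots> = b * (tm h div a) + b" by simp
  finally show ?thesis using deg_nxt[OF assms, of e v] by linarith
qed

text \<open>Pads \<open>T\<close> attempts to \<open>T\<close> full rounds. Connectivity persists,
  so the additional attempts are harmless.\<close>

lemma win_prob_connected:
  assumes "fp T (\<lambda>h. connected_spanning n (maker_edges h)) [] \<le> 1 - p"
  shows "p \<le> expect a \<beta> A (T * a) (\<lambda>h. of_bool (connected_spanning n (maker_edges h))) []"
proof -
  have "T * a = T + T * (a - 1)" using a_pos by (cases a) auto
  then have "fp (T * a) (\<lambda>h. connected_spanning n (maker_edges h)) []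
      \<le> fp T (\<lambda>h. connected_spanning n (maker_edges h)) []"
    by (simp only:) (rule fp_extend, auto intro: connected_nxt reach_Nil)
  then show ?thesis using assms by (simp add: expect_win)
qed

end

text \<open>The default \<open>complete_edges n\<close> keeps the strategy legal once Maker's graph
  is connected.\<close>

definition kruskal_opt :: "nat \<Rightarrow> (edge \<times> bool) list \<Rightarrow> edge set" where
  "kruskal_opt n v = (let X = cross n (successes v) in if X = {} then complete_edges n else X)"

lemma complete_edges_nonempty: "n \<ge> 2 \<Longrightarrow> complete_edges n \<noteq> {}"
proof -
  assume "n \<ge> 2"
  then have "{0, 1} \<in> complete_edges n" by (simp add: complete_edges_def)
  then show ?thesis by blast
qed

lemma kruskal_opt_legal:
  "kruskal_opt n v \<subseteq> complete_edges n" "n \<ge> 2 \<Longrightarrow> kruskal_opt n v \<noteq> {}"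
  using cross_subset complete_edges_nonempty by (auto simp: kruskal_opt_def Let_def)

section \<open>The Kruskal strategy in windows\<close>

locale kruskal_game =
  fixes n a b :: nat and \<beta> :: breaker_strategy
  assumes a_pos': "a > 0" and legal': "breaker_legal n b \<beta>" and n2: "n \<ge> 2"

sublocale kruskal_game \<subseteq> game n a b \<beta> "kruskal_opt n"
  by standard (use a_pos' legal' n2 kruskal_opt_legal in auto)

text \<open>\<open>heavy i h\<close> collects the vertices at risk, namely those of large PhantomBreaker degree in
  small components. Its threshold rises by \<open>64 b s\<close>, which is four times the increase of any
  degree within one window of \<open>16 s\<close> attempts.\<close>

locale kruskal_windows = kruskal_game +
  fixes C s R tmax :: nat
  assumes C_pos: "C > 0" and R_def: "R = 32 * C * C" and Rs: "R * (64 * b * s) \<le> n"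
    and tmax: "b * tmax \<le> C * n" and n_large: "64 * C \<le> n"
begin

definition heavy :: "nat \<Rightarrow> move list \<Rightarrow> nat set" where
  "heavy i h = {v. v < n \<and> card (graph_comp h v) < 4 * C \<and> n + i * (64 * b * s) < 4 * deg h v}"

text \<open>The sum is a deficit: the growth that heavy vertices still lack until their components
  have \<open>4 * C\<close> vertices. Each successful window of a cycle lowers it by at least one
  until it vanishes. The last conjunct keeps the cuts of all small components open, including those
  whose vertices still wait for a later cycle.\<close>

definition ctrl :: "nat \<Rightarrow> nat \<Rightarrow> move list \<Rightarrow> bool" where
  "ctrl i m h \<longleftrightarrow> card (graph_comps h) \<le> max 1 m \<and>
     (\<Sum>v\<in>heavy i h. 4 * C - card (graph_comp h v)) \<le> R - i \<and>
     (\<forall>v<n. card (graph_comp h v) < 4 * C \<longrightarrow> 4 * deg h v \<le> 2 * n + i * (64 * b * s))"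

lemma finite_heavy: "finite (heavy i h)"
  by (simp add: heavy_def)

lemma breaker_bound:
  assumes "reach h" "tm h \<le> tmax"
  shows "card (breaker_edges h) \<le> C * n"
proof -
  have "tm h div a \<le> tmax" using assms(2) div_le_dividend[of "tm h" a] by linarith
  then have "b * (tm h div a) \<le> b * tmax" by (rule mult_le_mono2)
  then show ?thesis using card_breaker[OF assms(1)] tmax by linarith
qed

text \<open>A component of fewer than \<open>4 * C \<le> n / 16\<close> vertices has at least
  \<open>card X * 15 * n / 16\<close> cut edges, and degrees of at most \<open>3 * n / 4\<close>
  block at most four fifths of them. A larger one has at least \<open>2 * C * n\<close> cut edges,
  twice the bound on all of PhantomBreaker's edges; this is the origin of
  \<open>4 * C\<close>.\<close>

lemma cut_thin:
  assumes h: "reach h" "tm h \<le> tmax"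
    and deg: "\<And>v. v < n \<Longrightarrow> card (graph_comp h v) < 4 * C \<Longrightarrow> 4 * deg h v \<le> 3 * n"
    and X: "X \<in> graph_comps h" "2 * card X \<le> n"
  shows "card (edge_cut n X) \<le> 5 * card (edge_cut n X - breaker_edges h)"
proof -
  note E = reach_complete(1)[OF h(1)]
  have Xn: "X \<subseteq> {..<n}" by (rule component_set_subset[OF E X(1)])
  let ?x = "card X" and ?e = "card (edge_cut n X \<inter> breaker_edges h)"
  have split: "card (edge_cut n X - breaker_edges h) + ?e = ?x * (n - ?x)" by (rule cut_free[OF Xn])
  have "5 * ?e \<le> 4 * (?x * (n - ?x))"
  proof (cases "?x < 4 * C")
    case True
    have comp: "graph_comp h v = X" if "v \<in> X" for v using component_set_cases[OF X(1) that] by simp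
    have "4 * ?e \<le> 4 * (\<Sum>v\<in>X. deg h v)" using cut_blocked_le_deg[OF h(1) Xn] by simp
    also have "\<dots> = (\<Sum>v\<in>X. 4 * deg h v)" by (simp add: sum_distrib_left)
    also have "\<dots> \<le> (\<Sum>v\<in>X. 3 * n)"
      using True comp Xn by (intro sum_mono deg) auto
    finally have "4 * ?e \<le> ?x * (3 * n)" by simp
    moreover have "15 * n \<le> 16 * (n - ?x)" using True n_large by linarith
    then have "?x * (15 * n) \<le> ?x * (16 * (n - ?x))" by (rule mult_le_mono2)
    ultimately show ?thesis by (simp add: algebra_simps)
  next
    case False
    have "?e \<le> card (breaker_edges h)" by (rule card_mono) (use reach_complete[OF h(1)] in auto)
    then have "?e \<le> C * n" using breaker_bound[OF h] by linarith
    moreover have "4 * C * n \<le> ?x * (2 * (n - ?x))"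
      by (rule mult_le_mono) (use False X(2) in linarith)+
    ultimately show ?thesis by (simp add: algebra_simps)
  qed
  then show ?thesis using split card_edge_cut[OF Xn] by linarith
qed

lemma opt_cross: "card (graph_comps h) > 1 \<Longrightarrow> opt h = cross n (maker_edges h)"
  using cross_nonempty[of n "maker_edges h"] by (simp add: kruskal_opt_def successes_maker_view)

text \<open>Two failures are added: too few mergers, and no growth of the component of one selected
  heavy vertex. The first is exponentially unlikely. The second is only bounded away from
  \<open>1\<close> when \<open>s\<close> is linear in \<open>n\<close>, because an attempt is
  guaranteed to hit the selected cut only with a chance of order \<open>1 / n\<close>.\<close>

lemma window:
  assumes h0: "reach h0" "ctrl i m h0" and i: "i < R" and t: "tm h0 + 16 * s \<le> tmax"
  shows "fp (16 * s) (ctrl (Suc i) (m - s)) h0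
    \<le> 2 ^ s * (1 - (1 / 10) / 2) ^ (16 * s) + (1 - 1 / (5 * n)) ^ (16 * s)"
proof -
  define d where "d = 64 * b * s"
  define t1 where "t1 = tm h0 + 16 * s"
  define I where "I h \<longleftrightarrow> (\<forall>v<n. card (graph_comp h0 v) \<le> card (graph_comp h v)) \<and>
     (\<forall>v. deg h v + b * tm h0 \<le> deg h0 v + b * tm h)" for h
  have I0: "I h0" by (simp add: I_def)
  have inv: "I (nxt h e)" if "reach h" "I h" "tm h < t1" "e \<in> opt h" for h e
  proof -
    have "deg (nxt h e) v + b * tm h0 \<le> deg h0 v + b * tm (nxt h e)" for v
    proof -
      have "deg h v + b * tm h0 \<le> deg h0 v + b * tm h" using that(2) by (simp add: I_def)
      then show ?thesis using deg_nxt_le[OF that(1), of e v] by simp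
    qed
    then show ?thesis
      using that card_graph_comp_mono[OF that(1,4)] by (fastforce simp: I_def intro: le_trans)
  qed
  have deg: "4 * deg h v \<le> 4 * deg h0 v + d" if "I h" "tm h \<le> t1" for h v
  proof -
    have "deg h v + b * tm h0 \<le> deg h0 v + b * tm h" using that(1) by (simp add: I_def)
    moreover have "b * tm h \<le> b * tm h0 + 16 * b * s"
      using mult_le_mono2[OF that(2), of b] by (simp add: t1_def algebra_simps)
    ultimately show ?thesis by (simp add: d_def)
  qed
  have deg2: "4 * deg h v \<le> 2 * n + Suc i * d"
    if "I h" "tm h \<le> t1" "v < n" "card (graph_comp h v) < 4 * C" for h v
  proof -
    have "card (graph_comp h0 v) \<le> card (graph_comp h v)" using that(1,3) unfolding I_def by blast
    then have "card (graph_comp h0 v) < 4 * C" using that(4) by simp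
    then have "4 * deg h0 v \<le> 2 * n + i * d" using h0(2) that(3) by (auto simp: ctrl_def d_def)
    then show ?thesis using deg[OF that(1,2), of v] by simp
  qed
  have thin: "card (edge_cut n X) \<le> 5 * card (edge_cut n X - breaker_edges h)"
    if "reach h" "I h" "tm h < t1" "X \<in> graph_comps h" "2 * card X \<le> n" for h X
  proof (rule cut_thin[OF that(1) _ _ that(4,5)])
    show "tm h \<le> tmax" using that(3) t by (simp add: t1_def)
    fix v assume v: "v < n" "card (graph_comp h v) < 4 * C"
    \<comment> \<open>A whole cycle of \<open>R\<close> windows raises the bound
      \<open>2 * n\<close> by at most \<open>n\<close>.\<close>
    have "Suc i * d \<le> R * d" using i by (intro mult_le_mono1) simp
    then have "Suc i * d \<le> n" using Rs by (simp add: d_def)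
    then show "4 * deg h v \<le> 3 * n" using deg2[OF that(2) _ v] that(3) by simp
  qed
  define m' where "m' = max 1 (m - s)"
  define S1 where "S1 h \<longleftrightarrow> card (graph_comps h) \<le> m'" for h
  have opt: "opt h = cross n (maker_edges h)" if "\<not> S1 h" for h
    using that by (intro opt_cross) (simp add: S1_def m'_def)
  have "fp (16 * s) S1 h0 \<le> 2 ^ (card (graph_comps h0) - m') * (1 - (1 / 10) / 2) ^ (16 * s)"
  proof (rule fp_progress[where I = I and tmax = t1 and \<mu> = "\<lambda>h. card (graph_comps h) - m'"])
    show "S1 (nxt h e)" if "S1 h" "e \<in> opt h" for h e
      using that card_graph_comps_mono[OF that(2)] by (simp add: S1_def)
    show "real (card (opt h \<inter> breaker_edges h)) \<le> (1 - 1 / 10) * card (opt h)"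
      if "reach h" "I h" "tm h < t1" "\<not> S1 h" for h
    proof -
      have "(1 / 5) / 2 * card (cross n (maker_edges h)) \<le> card (cross n (maker_edges h) - breaker_edges h)"
      proof (rule card_cross_blocked[OF reach_complete(1)[OF that(1)]])
        fix X assume "X \<in> graph_comps h" "2 * card X \<le> n"
        from thin[OF that(1-3) this]
        show "1 / 5 * real (card (edge_cut n X)) \<le> card (edge_cut n X - breaker_edges h)" by linarith
      qed (use n2 in simp)
      moreover have "card (opt h) = card (opt h - breaker_edges h) + card (opt h \<inter> breaker_edges h)"
        by (subst card_Un_disjoint[symmetric]) (auto intro: arg_cong[where f = card])
      ultimately show ?thesis unfolding opt[OF that(4)] by simp
    qed
    show "S1 (nxt h e) \<or> card (graph_comps (nxt h e)) - m' < card (graph_comps h) - m'"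
      if "\<not> S1 h" "e \<in> opt h" "e \<notin> breaker_edges h" for h e
      using that card_component_set_insert_cross[of e n "maker_edges h"] opt[OF that(1)]
      by (auto simp: S1_def maker_nxt)
    show "S1 (nxt h e) \<or> card (graph_comps (nxt h e)) - m' \<le> card (graph_comps h) - m'"
      if "e \<in> breaker_edges h" for h e
      using that by (simp add: maker_nxt)
  qed (use inv h0 I0 in \<open>auto simp: t1_def\<close>)
  also have "\<dots> \<le> 2 ^ s * (1 - (1 / 10) / 2) ^ (16 * s)"
    using h0(2) by (intro mult_right_mono power_increasing) (auto simp: ctrl_def m'_def)
  finally have fp1: "fp (16 * s) S1 h0 \<le> 2 ^ s * (1 - (1 / 10) / 2) ^ (16 * s)" .
  \<comment> \<open>Without heavy vertices \<open>v\<close> is arbitrary and \<open>S2\<close> holds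
    trivially.\<close>
  define v where "v = (SOME v. v \<in> heavy i h0)"
  have v: "v \<in> heavy i h0" if "heavy i h0 \<noteq> {}" using that by (auto simp: v_def intro: someI_ex)
  define S2 where "S2 h \<longleftrightarrow> heavy i h0 = {} \<or> card (graph_comp h0 v) < card (graph_comp h v)" for h
  have \<rho>: "0 \<le> 1 / real (5 * n)" "1 / real (5 * n) \<le> 1" using n2 by (auto simp: field_simps)
  have fp2: "fp (16 * s) S2 h0 \<le> (1 - 1 / (5 * n)) ^ (16 * s)"
  proof (rule fp_decay[where I = I and tmax = t1])
    show "S2 (nxt h e)" if "reach h" "S2 h" "e \<in> opt h" for h e
    proof -
      show ?thesis
      proof (cases "heavy i h0 = {}")
        case False
        then have "v < n" using v by (simp add: heavy_def)
        then have "card (graph_comp h v) \<le> card (graph_comp (nxt h e) v)"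
          by (rule card_graph_comp_mono[OF that(1,3)])
        moreover have "card (graph_comp h0 v) < card (graph_comp h v)"
          using that(2) False by (simp add: S2_def)
        ultimately show ?thesis by (simp add: S2_def)
      qed (simp add: S2_def)
    qed
    show "1 / real (5 * n) * card (opt h) \<le> card {e \<in> opt h. S2 (nxt h e)}"
      if h: "reach h" "I h" "tm h < t1" "\<not> S2 h" for h
    proof -
      have vh: "v < n" "card (graph_comp h0 v) < 4 * C" using h(4) v by (auto simp: S2_def heavy_def)
      let ?X = "graph_comp h v"
      have X: "?X \<in> graph_comps h" using vh by (simp add: component_in_component_set)
      have Xn: "?X \<subseteq> {..<n}" by (rule component_subset[OF reach_complete(1)[OF h(1)] vh(1)])
      have "card ?X < 4 * C" using h(4) vh by (simp add: S2_def)
      then have x: "2 * card ?X \<le> n" using n_large by linarith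
      have "v \<in> ?X" by simp
      then have x0: "0 < card ?X" using finite_subset[OF Xn] by (metis card_gt_0_iff empty_iff finite_lessThan)
      have sub: "edge_cut n ?X \<subseteq> cross n (maker_edges h)" by (rule edge_cut_subset_cross[OF reach_complete(1)[OF h(1)] X])
      have "card (edge_cut n ?X) = card ?X * (n - card ?X)" by (rule card_edge_cut[OF Xn])
      also have "\<dots> \<ge> 1 * (n - card ?X)" using x0 by (intro mult_le_mono1) simp
      finally have cut_ge: "n \<le> 2 * card (edge_cut n ?X)" using x by linarith
      then have "edge_cut n ?X \<noteq> {}" using n2 by auto
      then have opt: "opt h = cross n (maker_edges h)"
        using sub by (auto simp: kruskal_opt_def successes_maker_view Let_def)
      have "edge_cut n ?X - breaker_edges h \<subseteq> {e \<in> opt h. S2 (nxt h e)}"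
      proof
        fix e assume e: "e \<in> edge_cut n ?X - breaker_edges h"
        then have "card ?X < card (component (insert e (maker_edges h)) v)"
          by (intro component_insert_cut[OF reach_complete(1)[OF h(1)] vh(1)]) simp
        moreover have "card (graph_comp h0 v) \<le> card ?X" using h(2) vh(1) unfolding I_def by blast
        ultimately show "e \<in> {e \<in> opt h. S2 (nxt h e)}"
          using e sub opt by (auto simp: S2_def maker_nxt)
      qed
      then have "card (edge_cut n ?X - breaker_edges h) \<le> card {e \<in> opt h. S2 (nxt h e)}"
        by (intro card_mono) auto
      \<comment> \<open>The cut has at least \<open>n / 2\<close> edges and a fifth of them is free,
        against at most \<open>n * n / 2\<close> options: the chance of a hit is at least
        \<open>1 / (5 * n)\<close>.\<close>
      then have "n \<le> 10 * card {e \<in> opt h. S2 (nxt h e)}"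
        using thin[OF h(1-3) X x] cut_ge by linarith
      then have "real n / 10 \<le> card {e \<in> opt h. S2 (nxt h e)}" by linarith
      moreover have "2 * real (card (opt h)) \<le> real n * real n"
        using card_cross_le[of n "maker_edges h"] unfolding opt by (metis of_nat_le_iff of_nat_mult of_nat_numeral)
      then have "1 / real (5 * n) * card (opt h) \<le> n / 10" using n2 by (simp add: field_simps)
      ultimately show ?thesis by linarith
    qed
  qed (use inv h0 I0 \<rho> in \<open>auto simp: t1_def\<close>)
  have "fp (16 * s) (ctrl (Suc i) (m - s)) h0 \<le> fp (16 * s) (\<lambda>h. (S1 h \<and> S2 h) \<and> I h) h0"
  proof (rule fp_mono[OF h0(1)])
    fix h assume h: "reach h" "tm h = tm h0 + 16 * s" and S: "(S1 h \<and> S2 h) \<and> I h"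
    have t1: "tm h \<le> t1" using h by (simp add: t1_def)
    have mono: "card (graph_comp h0 w) \<le> card (graph_comp h w)" if "w < n" for w
      using S that unfolding I_def by blast
    \<comment> \<open>No vertex becomes heavy: the rising threshold absorbs any gain in degree, and
      components only grow.\<close>
    have sub: "heavy (Suc i) h \<subseteq> heavy i h0"
    proof
      fix w assume "w \<in> heavy (Suc i) h"
      then show "w \<in> heavy i h0"
        using mono[of w] deg[of h w] S t1 by (auto simp: heavy_def d_def)
    qed
    have "(\<Sum>w\<in>heavy (Suc i) h. 4 * C - card (graph_comp h w)) \<le> R - Suc i"
    proof (cases "heavy i h0 = {}")
      case True
      then show ?thesis using sub by auto
    next
      case False
      have "(\<Sum>w\<in>heavy (Suc i) h. 4 * C - card (graph_comp h w))
          \<le> (\<Sum>w\<in>heavy i h0. 4 * C - card (graph_comp h w))"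
        by (rule sum_mono2[OF finite_heavy sub]) simp
      also have "\<dots> < (\<Sum>w\<in>heavy i h0. 4 * C - card (graph_comp h0 w))"
      proof (rule sum_strict_mono_ex1[OF finite_heavy])
        show "\<forall>w\<in>heavy i h0. 4 * C - card (graph_comp h w) \<le> 4 * C - card (graph_comp h0 w)"
          using mono by (auto simp: heavy_def intro: diff_le_mono2)
        have "4 * C - card (graph_comp h v) < 4 * C - card (graph_comp h0 v)"
          using v[OF False] S False by (auto simp: S2_def heavy_def)
        then show "\<exists>w\<in>heavy i h0. 4 * C - card (graph_comp h w) < 4 * C - card (graph_comp h0 w)"
          using v[OF False] by blast
      qed
      also have "\<dots> \<le> R - i" using h0(2) by (simp add: ctrl_def)
      finally show ?thesis using i by simp
    qed
    then show "ctrl (Suc i) (m - s) h"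
      using S deg2[of h] t1 by (simp add: ctrl_def S1_def m'_def d_def)
  qed
  also have "\<dots> \<le> fp (16 * s) (\<lambda>h. S1 h \<and> S2 h) h0"
    by (rule fp_invariant[where tmax = t1]) (use inv h0 I0 in \<open>auto simp: t1_def\<close>)
  also have "\<dots> \<le> fp (16 * s) S1 h0 + fp (16 * s) S2 h0" by (rule fp_conj[OF h0(1)])
  finally show ?thesis using fp1 fp2 by simp
qed

text \<open>End of a cycle. The deficit is exhausted, so no heavy vertex is left and degrees in
  small components satisfy \<open>4 * deg h v \<le> n + R * (64 * b * s) \<le> 2 * n\<close>. In the
  new cycle at most \<open>8 * C\<close> vertices have degree above \<open>n / 4\<close>, each with
  deficit at most \<open>4 * C\<close>, which explains \<open>R = 32 * C * C\<close>.\<close>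

lemma ctrl_reset:
  assumes "reach h" "tm h \<le> tmax" "ctrl R m h"
  shows "ctrl 0 m h"
proof -
  have fin: "finite (heavy R h)" by (simp add: heavy_def)
  have "(\<Sum>v\<in>heavy R h. 4 * C - card (graph_comp h v)) = 0" using assms(3) by (simp add: ctrl_def)
  then have "\<forall>v\<in>heavy R h. 4 * C - card (graph_comp h v) = 0" using fin by simp
  then have empty: "heavy R h = {}" by (auto simp: heavy_def)
  have "4 * deg h v \<le> 2 * n" if "v < n" "card (graph_comp h v) < 4 * C" for v
  proof -
    have "v \<notin> heavy R h" using empty by simp
    then have "4 * deg h v \<le> n + R * (64 * b * s)" using that by (simp add: heavy_def)
    then show ?thesis using Rs by linarith
  qed
  moreover have "(\<Sum>v\<in>heavy 0 h. 4 * C - card (graph_comp h v)) \<le> R"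
  proof -
    have "(\<Sum>v\<in>heavy 0 h. 4 * C - card (graph_comp h v)) \<le> (\<Sum>v\<in>heavy 0 h. 4 * C)"
      by (rule sum_mono) simp
    also have "\<dots> = card (heavy 0 h) * (4 * C)" by simp
    also have "card (heavy 0 h) \<le> card {v. v < n \<and> n \<le> 4 * deg h v}"
      by (rule card_mono) (auto simp: heavy_def)
    also have "\<dots> \<le> 8 * C"
    proof -
      have "card {v. v < n \<and> n \<le> 4 * deg h v} * n \<le> 8 * card (breaker_edges h)"
        using card_heavy[OF assms(1), of n 4] by simp
      also have "\<dots> \<le> 8 * C * n" using breaker_bound[OF assms(1,2)] by simp
      finally show ?thesis using n2 by simp
    qed
    finally show ?thesis by (simp add: R_def algebra_simps)
  qed
  ultimately show ?thesis using assms(3) by (simp add: ctrl_def)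
qed

lemma windows:
  fixes \<epsilon> :: real
  assumes "2 ^ s * (1 - (1 / 10) / 2) ^ (16 * s) + (1 - 1 / (5 * n)) ^ (16 * s) \<le> \<epsilon>" "0 \<le> \<epsilon>" "\<epsilon> \<le> 1"
  shows "k * (16 * s) \<le> tmax \<Longrightarrow> fp (k * (16 * s)) (ctrl (k mod R) (n - k * s)) [] \<le> 1 - (1 - \<epsilon>) ^ k"
proof (induction k)
  case 0
  have "heavy 0 [] = {}" by (auto simp: heavy_def deg_def)
  moreover have "card (graph_comps []) \<le> n"
    using card_image_le[of "{..<n}" "component {}"] by (simp add: component_set_def)
  ultimately have "ctrl 0 n []" using n2 by (simp add: ctrl_def deg_def)
  then show ?case by (simp add: fp_def)
next
  case (Suc k)
  have R: "R > 0" using C_pos by (simp add: R_def)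
  have "fp (k * (16 * s) + 16 * s) (ctrl (Suc k mod R) (n - Suc k * s)) []
      \<le> \<epsilon> + (1 - \<epsilon>) * (1 - (1 - \<epsilon>) ^ k)"
  proof (rule fp_then[OF reach_Nil assms(2,3) Suc.IH])
    show "k * (16 * s) \<le> tmax" using Suc.prems by simp
    fix h assume h: "reach h" "tm h = tm [] + k * (16 * s)" "ctrl (k mod R) (n - k * s) h"
    have t: "tm h + 16 * s \<le> tmax" using h(2) Suc.prems by simp
    have "fp (16 * s) (ctrl (Suc k mod R) (n - Suc k * s)) h
        \<le> fp (16 * s) (ctrl (Suc (k mod R)) (n - k * s - s)) h"
    proof (rule fp_mono[OF h(1)])
      fix h' assume h': "reach h'" "tm h' = tm h + 16 * s" "ctrl (Suc (k mod R)) (n - k * s - s) h'"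
      have eq: "n - Suc k * s = n - k * s - s" by simp
      show "ctrl (Suc k mod R) (n - Suc k * s) h'"
      proof (cases "Suc (k mod R) = R")
        case True
        then show ?thesis using ctrl_reset[OF h'(1)] h' t eq by (simp add: mod_Suc)
      next
        case False
        then show ?thesis using h'(3) eq by (simp add: mod_Suc)
      qed
    qed
    also have "\<dots> \<le> 2 ^ s * (1 - (1 / 10) / 2) ^ (16 * s) + (1 - 1 / (5 * n)) ^ (16 * s)"
      by (rule window[OF h(1,3) _ t]) (use R in simp)
    also have "\<dots> \<le> \<epsilon>" by (rule assms(1))
    finally show "fp (16 * s) (ctrl (Suc k mod R) (n - Suc k * s)) h \<le> \<epsilon>" .
  qed
  also have "\<dots> = 1 - (1 - \<epsilon>) ^ Suc k" by (simp add: algebra_simps)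
  finally show ?case by (simp add: add.commute)
qed

end

section \<open>Choice of the constants for an arbitrary bias\<close>

lemma filterlim_div_at_top:
  fixes k :: nat
  assumes "k > 0"
  shows "filterlim (\<lambda>n. n div k) at_top sequentially"
  unfolding filterlim_at_top
proof
  fix m
  have "m \<le> n div k" if "m * k \<le> n" for n
    using that assms by (simp add: less_eq_div_iff_mult_less_eq)
  then show "eventually (\<lambda>n. m \<le> n div k) sequentially"
    by (auto simp: eventually_sequentially)
qed

lemma connectivity_positive_probability:
  fixes a b :: nat
  assumes "a > 0" "b > 0"
  shows "\<exists>c::real. c > 0 \<and> (\<exists>n0. \<forall>n\<ge>n0. \<exists>M. randomized_maker n M \<and>
     guarantees_win (spanning_trees n) n a b M c)"
proof -
  \<comment> \<open>The \<open>2 * K\<close> windows of \<open>16 * s\<close> attempts take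
    \<open>32 * K * s \<le> 32 * n\<close> attempts in all, hence \<open>C = 32 * b\<close>. The
    value of \<open>K\<close> turns \<open>R * (64 * b * s) \<le> n\<close> into
    \<open>K * s \<le> n\<close>.\<close>
  define C where "C = 32 * b"
  define R where "R = 32 * C * C"
  define K where "K = 64 * b * R"
  have pos: "C > 0" "R > 0" "K > 0" using assms by (auto simp: C_def R_def K_def)
  define e1 where "e1 = exp (- 1 / real K)"
  have e1: "0 < e1" "e1 < 1" using pos by (auto simp: e1_def)
  \<comment> \<open>\<open>e1\<close> will bound the chance that the selected component does not
    grow; the midpoint between \<open>e1\<close> and \<open>1\<close> leaves room for the vanishing
    term \<open>x ^ s\<close>.\<close>
  define \<epsilon> where "\<epsilon> = (1 + e1) / 2"
  have \<epsilon>: "0 \<le> \<epsilon>" "\<epsilon> < 1" using e1 by (auto simp: \<epsilon>_def)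
  define x :: real where "x = 2 * (1 - (1 / 10) / 2) ^ 16"
  have x: "0 \<le> x" "x < 1" by (auto simp: x_def power_numeral_even power_numeral_odd)
  have "(\<lambda>n. x ^ (n div K)) \<longlonglongrightarrow> 0"
    by (rule filterlim_compose[OF LIMSEQ_power_zero filterlim_div_at_top[OF pos(3)]]) (use x in auto)
  then have "eventually (\<lambda>n. x ^ (n div K) < (1 - e1) / 2) sequentially"
    by (rule order_tendstoD) (use e1 in simp)
  then obtain n1 where n1: "\<And>n. n \<ge> n1 \<Longrightarrow> x ^ (n div K) < (1 - e1) / 2"
    by (auto simp: eventually_sequentially)
  define p where "p = (1 - \<epsilon>) ^ (2 * K)"
  have "\<exists>M. randomized_maker n M \<and> guarantees_win (spanning_trees n) n a b M p"
    if n: "n \<ge> max (max n1 K) (max 2 (64 * C))" for n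
  proof (rule strategy_from_expect[OF assms(1)])
    have n2: "n \<ge> 2" using n by simp
    show "kruskal_opt n v \<subseteq> complete_edges n" "kruskal_opt n v \<noteq> {}" for v
      using kruskal_opt_legal n2 by auto
    define s where "s = n div K"
    \<comment> \<open>Each window removes \<open>s\<close> components and
      \<open>n \<le> 2 * K * s\<close>, so \<open>2 * K\<close> windows leave only one.\<close>
    define T where "T = 2 * K * (16 * s)"
    have Ks: "K * s \<le> n" by (simp add: s_def)
    have "n < K * s + K" using dividend_less_times_div[OF pos(3), of n] by (simp add: s_def)
    moreover have "s \<ge> 1" using n pos by (simp add: s_def less_eq_div_iff_mult_less_eq)
    then have "K \<le> K * s" using pos by simp
    ultimately have "n \<le> 2 * (K * s)" by linarith
    then have ns: "n \<le> 2 * K * s" by (simp only: mult.assoc)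
    fix \<beta> assume \<beta>: "breaker_legal n b \<beta>"
    have "b * T = 32 * b * (K * s)" by (simp add: T_def)
    also have "\<dots> \<le> C * n" unfolding C_def using Ks by (rule mult_le_mono2)
    finally have bT: "b * T \<le> C * n" .
    have "R * (64 * b * s) = K * s" by (simp add: K_def)
    then interpret kruskal_windows n a b \<beta> C s R T
      using assms \<beta> n n2 pos Ks bT by unfold_locales (auto simp: R_def)
    have "2 ^ s * (1 - (1 / 10) / 2) ^ (16 * s) = x ^ s"
      by (simp add: x_def power_mult power_mult_distrib)
    moreover have "(1 - 1 / real (5 * n)) ^ (16 * s) \<le> e1"
    proof -
      have "(1 - 1 / real (5 * n)) ^ (16 * s) \<le> exp (- (1 / real (5 * n))) ^ (16 * s)"
        using n2 exp_ge_add_one_self[of "- (1 / real (5 * n))"] by (intro power_mono) auto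
      also have "\<dots> = exp (- (16 * s / (5 * n)))" by (simp add: exp_of_nat_mult[symmetric])
      also have "\<dots> \<le> e1"
      proof -
        have "real n \<le> 2 * K * s" using ns of_nat_le_iff[of n "2 * K * s", where 'a = real] by simp
        then have "1 / real K \<le> 16 * s / (5 * n)" using pos n2 by (simp add: field_simps)
        then show ?thesis by (simp add: e1_def)
      qed
      finally show ?thesis .
    qed
    moreover have "x ^ s < (1 - e1) / 2" using n1[of n] n by (simp add: s_def)
    ultimately have *: "2 ^ s * (1 - (1 / 10) / 2) ^ (16 * s) + (1 - 1 / real (5 * n)) ^ (16 * s) \<le> \<epsilon>"
      unfolding \<epsilon>_def by argo
    have "fp T (ctrl (2 * K mod R) (n - 2 * K * s)) [] \<le> 1 - (1 - \<epsilon>) ^ (2 * K)"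
      using windows[OF *, of "2 * K"] \<epsilon> by (simp add: T_def)
    moreover have "fp T (\<lambda>h. connected_spanning n (maker_edges h)) [] \<le> fp T (ctrl (2 * K mod R) (n - 2 * K * s)) []"
      by (rule fp_mono[OF reach_Nil])
         (use ns in \<open>auto simp: ctrl_def intro!: connected_spanning_card_component_set\<close>)
    ultimately show "p \<le> expect a \<beta> (kruskal_opt n) (T * a) (\<lambda>h. of_bool (connected_spanning n (maker_edges h))) []"
      by (intro win_prob_connected) (simp add: p_def)
  qed
  moreover have "p > 0" using \<epsilon> by (simp add: p_def)
  ultimately show ?thesis by blast
qed

subsection \<open>Small bias: winning asymptotically almost surely\<close>

definition singles :: "nat \<Rightarrow> edge set \<Rightarrow> nat set" where
  "singles n E = {v. v < n \<and> component E v = {v}}"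

definition pair_comps :: "nat \<Rightarrow> edge set \<Rightarrow> nat set set" where
  "pair_comps n E = {X \<in> component_set n E. card X = 2}"

text \<open>Views list the most recent attempt first, so \<open>drop\<close> retains the first \<open>T\<close> attempts.\<close>

definition fresh :: "nat \<Rightarrow> nat \<Rightarrow> (edge \<times> bool) list \<Rightarrow> nat set" where
  "fresh n T v = {..<n} - \<Union> (fst ` set (drop (length v - T) v))"

text \<open>During the first \<open>T\<close> attempts Maker tries uniformly random pairs of vertices she never tried
  before, so that the set \<open>Q\<close> of untried vertices shrinks independently of PhantomBreaker's moves.
  Isolated vertices left over from failed attempts are urgent and come before those in \<open>Q\<close>.\<close>

definition fast_opt :: "nat \<Rightarrow> nat \<Rightarrow> nat \<Rightarrow> (edge \<times> bool) list \<Rightarrow> edge set" where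
  "fast_opt n d T v =
     (let E = successes v \<inter> complete_edges n;
          Q = fresh n T v; S = singles n E; P = pair_comps n E
      in if length v < T \<and> card Q \<ge> 2 then pairs Q
         else if S - Q \<noteq> {} then edge_cut n {Min (S - Q)}
         else if S \<noteq> {} then edge_cut n {Min S}
         else if card P \<ge> d then pairs (Min ` P)
         else if P \<noteq> {} then edge_cut n (SOME X. X \<in> P)
         else kruskal_opt n v)"

section \<open>Effect of a new edge on small components\<close>

lemma finite_singles [simp]: "finite (singles n E)"
  by (simp add: singles_def)

lemma finite_pair_comps [simp]: "finite (pair_comps n E)"
  by (simp add: pair_comps_def)

lemma singles_mono: "E \<subseteq> E' \<Longrightarrow> singles n E' \<subseteq> singles n E"
  using component_mono[of E E'] self_in_component by (fastforce simp: singles_def)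

lemma singles_insert:
  assumes "x \<noteq> y"
  shows "singles n (insert {x, y} E) \<subseteq> singles n E - {x, y}"
proof -
  have "y \<in> component (insert {x, y} E) x" "x \<in> component (insert {x, y} E) y"
    by (simp_all add: component_insert)
  then show ?thesis
    using singles_mono[of E "insert {x, y} E" n] assms by (auto simp: singles_def)
qed

lemma Min_in_component_set:
  assumes "E \<subseteq> complete_edges n" "X \<in> component_set n E"
  shows "Min X \<in> X" "Min X < n" "component E (Min X) = X"
proof -
  show "Min X \<in> X"
    by (rule Min_in[OF component_set_finite[OF assms] component_set_nonempty[OF assms]])
  then show "Min X < n" "component E (Min X) = X"
    using component_set_subset[OF assms] component_set_cases[OF assms(2)] by auto
qed

text \<open>Minima act as representatives: \<open>k\<close> components offer exactly
  \<open>k choose 2\<close> candidate edges, one for each pair of components.\<close>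

lemma card_Min_image:
  assumes "E \<subseteq> complete_edges n" "F \<subseteq> component_set n E"
  shows "card (Min ` F) = card F"
proof (rule card_image, rule inj_onI)
  fix X Y assume "X \<in> F" "Y \<in> F" "Min X = Min Y"
  then show "X = Y" using Min_in_component_set(3)[OF assms(1)] assms(2) by (metis subsetD)
qed

lemma pairs_Min_image:
  assumes "E \<subseteq> complete_edges n" "F \<subseteq> component_set n E" "e \<in> pairs (Min ` F)"
  obtains X Y where "X \<in> F" "Y \<in> F" "X \<noteq> Y" "e = {Min X, Min Y}"
proof -
  obtain x y where e: "e = {x, y}" "x \<noteq> y" using assms(3) by (auto simp: pairs_def card_2_iff)
  then obtain X Y where "X \<in> F" "Y \<in> F" "x = Min X" "y = Min Y" using assms(3) by (auto simp: pairs_def)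
  then show ?thesis using that e by blast
qed

lemma pairs_Min_image_cross:
  assumes "E \<subseteq> complete_edges n" "F \<subseteq> component_set n E"
  shows "pairs (Min ` F) \<subseteq> cross n E"
proof
  fix e assume "e \<in> pairs (Min ` F)"
  then obtain X Y where "X \<in> F" "Y \<in> F" "X \<noteq> Y" "e = {Min X, Min Y}"
    by (rule pairs_Min_image[OF assms])
  then show "e \<in> cross n E"
    using Min_in_component_set[OF assms(1)] assms(2) unfolding cross_def by blast
qed

lemma pairs_mono: "S \<subseteq> T \<Longrightarrow> pairs S \<subseteq> pairs T"
  by (auto simp: pairs_def)

lemma pairs_nonempty:
  assumes "finite S" "card S \<ge> 2"
  shows "pairs S \<noteq> {}"
proof -
  have "card (pairs S) > 0" using assms by (simp add: card_pairs)
  then show ?thesis by auto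
qed

lemma fast_opt_legal:
  assumes n: "n \<ge> 3" and d: "d \<ge> 2"
  shows "fast_opt n d T v \<subseteq> complete_edges n \<and> fast_opt n d T v \<noteq> {}"
proof -
  define E where "E = successes v \<inter> complete_edges n"
  define Q where "Q = fresh n T v"
  define S where "S = singles n E"
  define P where "P = pair_comps n E"
  have E: "E \<subseteq> complete_edges n" by (simp add: E_def)
  have P: "P \<subseteq> component_set n E" by (auto simp: P_def pair_comps_def)
  have opt: "fast_opt n d T v = (if length v < T \<and> card Q \<ge> 2 then pairs Q
         else if S - Q \<noteq> {} then edge_cut n {Min (S - Q)}
         else if S \<noteq> {} then edge_cut n {Min S}
         else if card P \<ge> d then pairs (Min ` P)
         else if P \<noteq> {} then edge_cut n (SOME X. X \<in> P)
         else kruskal_opt n v)"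
    by (simp add: fast_opt_def Let_def E_def Q_def S_def P_def)
  have single: "edge_cut n {x} \<subseteq> complete_edges n \<and> edge_cut n {x} \<noteq> {}" if "x < n" for x
  proof -
    have "{x} \<noteq> {..<n}"
    proof
      assume "{x} = {..<n}"
      then have "card {x} = card {..<n}" by simp
      then show False using n by simp
    qed
    then show ?thesis using that edge_cut_subset[of "{x}" n] edge_cut_nonempty[of "{x}" n] by simp
  qed
  have S: "finite S" "S \<subseteq> {..<n}" by (auto simp: S_def singles_def)
  have Q: "finite Q" "Q \<subseteq> {..<n}" by (auto simp: Q_def fresh_def)
  consider (1) "length v < T \<and> card Q \<ge> 2" | (2) "\<not> (length v < T \<and> card Q \<ge> 2)" "S - Q \<noteq> {}"
    | (3) "\<not> (length v < T \<and> card Q \<ge> 2)" "S - Q = {}" "S \<noteq> {}"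
    | (4) "\<not> (length v < T \<and> card Q \<ge> 2)" "S = {}" "card P \<ge> d"
    | (5) "\<not> (length v < T \<and> card Q \<ge> 2)" "S = {}" "\<not> card P \<ge> d" "P \<noteq> {}"
    | (6) "\<not> (length v < T \<and> card Q \<ge> 2)" "S = {}" "\<not> card P \<ge> d" "P = {}"
    by blast
  then show ?thesis
  proof cases
    case 1
    then show ?thesis
      using pairs_mono[OF Q(2)] pairs_nonempty[OF Q(1)] by (simp add: opt complete_edges_pairs)
  next
    case 2
    have "Min (S - Q) \<in> S - Q" by (rule Min_in) (use 2 S in auto)
    then show ?thesis using 2 S single by (auto simp: opt)
  next
    case 3
    have "Min S \<in> S" by (rule Min_in) (use 3 S in auto)
    then have "Min S < n" using S(2) by auto
    then show ?thesis using 3 single[of "Min S"] by (auto simp: opt)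
  next
    case 4
    have "card (Min ` P) \<ge> 2" using card_Min_image[OF E P] 4 d by simp
    then show ?thesis using 4 pairs_Min_image_cross[OF E P] cross_subset[of n E] pairs_nonempty[of "Min ` P"]
      by (auto simp: opt P_def)
  next
    case 5
    define X where "X = (SOME X. X \<in> P)"
    have "X \<in> P" unfolding X_def using 5(4) by (simp add: some_in_eq)
    then have X: "X \<in> component_set n E" "card X = 2" by (auto simp: P_def pair_comps_def)
    have "X \<noteq> {..<n}" using X n by auto
    moreover have "fast_opt n d T v = edge_cut n X" using 5 by (auto simp: opt X_def)
    ultimately show ?thesis
      using edge_cut_subset[of X n] edge_cut_nonempty[of X n] component_set_subset[OF E X(1)] component_set_nonempty[OF E X(1)]
      by simp
  next
    case 6
    then show ?thesis using kruskal_opt_legal[of n v] n by (auto simp: opt)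
  qed
qed

lemma component_set_insert_cases:
  assumes "e \<in> complete_edges n" "Z \<in> component_set n (insert e E)"
  obtains x y where "e = {x, y}" "x < n" "y < n" "Z = component E x \<union> component E y"
  | "Z \<in> component_set n E" "\<And>x. x \<in> e \<Longrightarrow> Z \<noteq> component E x"
proof -
  obtain x y where e: "e = {x, y}" "x < n" "y < n" using assms(1) by (rule complete_edgeE)
  show ?thesis using assms(2) that e unfolding e(1) component_set_insert[OF e(2,3)] by blast
qed

text \<open>When every component has at least two vertices, a union of two different ones has at
  least four, so an inserted edge never creates a pair.\<close>

lemma pair_comps_insert:
  assumes E: "E \<subseteq> complete_edges n" and ge2: "\<And>X. X \<in> component_set n E \<Longrightarrow> 2 \<le> card X"
    and e: "e \<in> complete_edges n"
  shows "pair_comps n (insert e E) \<subseteq> pair_comps n E"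
    and "e \<in> cross n E \<Longrightarrow> x \<in> e \<Longrightarrow> component E x \<notin> pair_comps n (insert e E)"
proof -
  have fin: "finite (component E x)" if "x < n" for x
    using component_set_finite[OF E component_in_component_set[OF that]] .
  have ge2': "2 \<le> card (component E x)" if "x < n" for x using ge2 component_in_component_set that by blast
  have union: "component E x = component E x \<union> component E y"
    if "x < n" "y < n" "card (component E x \<union> component E y) = 2" for x y
    by (rule card_seteq) (use fin ge2' that in auto)
  show "pair_comps n (insert e E) \<subseteq> pair_comps n E"
  proof
    fix Z assume Z: "Z \<in> pair_comps n (insert e E)"
    then have Z': "Z \<in> component_set n (insert e E)" "card Z = 2" by (auto simp: pair_comps_def)
    from e Z'(1) show "Z \<in> pair_comps n E"
    proof (cases rule: component_set_insert_cases)
      case (1 x y)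
      then have "Z = component E x" using union[of x y] Z'(2) by simp
      then show ?thesis using 1 Z'(2) by (simp add: pair_comps_def component_in_component_set)
    qed (use Z' in \<open>auto simp: pair_comps_def\<close>)
  qed
  show "component E x \<notin> pair_comps n (insert e E)" if cross: "e \<in> cross n E" and x: "x \<in> e"
  proof
    assume "component E x \<in> pair_comps n (insert e E)"
    then have Z: "component E x \<in> component_set n (insert e E)" "card (component E x) = 2"
      by (auto simp: pair_comps_def)
    from e Z(1) show False
    proof (cases rule: component_set_insert_cases)
      case (1 u v)
      then have "component E u = component E x" "component E v = component E x"
        using union[of u v] union[of v u] Z(2) by (auto simp: Un_commute)
      moreover obtain u' v' where "e = {u', v'}" "component E u' \<noteq> component E v'"
        using cross by (auto simp: cross_def)
      ultimately show False using 1(1) by (auto simp: doubleton_eq_iff)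
    qed (use x in blast)
  qed
qed

lemma component_set_ge_2:
  assumes "E \<subseteq> complete_edges n" "singles n E = {}" "X \<in> component_set n E"
  shows "2 \<le> card X"
proof (rule ccontr)
  assume "\<not> 2 \<le> card X"
  moreover have "card X \<noteq> 0"
    using component_set_nonempty[OF assms(1,3)] component_set_finite[OF assms(1,3)] by simp
  ultimately have "card X = 1" by linarith
  then obtain v where v: "X = {v}" by (auto simp: card_1_singleton_iff)
  then have "v < n" using component_set_subset[OF assms(1,3)] by blast
  moreover have "X = component E v" by (rule component_set_cases[OF assms(3)]) (simp add: v)
  ultimately have "v \<in> singles n E" using v by (simp add: singles_def)
  then show False using assms(2) by simp
qed

lemma card_component_set_le:
  assumes "E \<subseteq> complete_edges n" "\<And>X. X \<in> F \<Longrightarrow> m \<le> card X" "F \<subseteq> component_set n E"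
  shows "card F * m \<le> n"
proof -
  have "card F * m = (\<Sum>X\<in>F. m)" by simp
  also have "\<dots> \<le> (\<Sum>X\<in>F. card X)" by (rule sum_mono) (rule assms(2))
  also have "\<dots> \<le> (\<Sum>X\<in>component_set n E. card X)"
    by (rule sum_mono2) (use assms(3) in auto)
  also have "\<dots> = n" by (rule sum_card_component_set[OF assms(1)])
  finally show ?thesis .
qed

lemma two_choose_two: "2 * (m choose 2) = m * (m - 1)"
proof -
  have "even (m * (m - 1))" by (cases m) auto
  then show ?thesis by (simp add: choose_two)
qed

lemma real_choose_two: "real (m choose 2) = real m * (real m - 1) / 2"
proof -
  have "2 * real (m choose 2) = real (m * (m - 1))"
    by (simp only: two_choose_two[symmetric] of_nat_mult of_nat_numeral)
  also have "\<dots> = real m * (real m - 1)" by (cases m) (auto simp: algebra_simps)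
  finally show ?thesis by simp
qed

context game
begin

text \<open>Union bound form of \<open>fp_then\<close>, suited to phases whose failure probabilities
  are all small.\<close>

lemma fp_then_add:
  assumes "reach h" "0 \<le> \<epsilon>" "fp s S h \<le> \<delta>"
    and "\<And>h'. reach h' \<Longrightarrow> tm h' = tm h + s \<Longrightarrow> S h' \<Longrightarrow> fp t S' h' \<le> \<epsilon>"
  shows "fp (s + t) S' h \<le> \<delta> + \<epsilon>"
proof (cases "\<epsilon> \<le> 1")
  case True
  have "0 \<le> \<delta>" using fp_nonneg[OF assms(1), of s S] assms(3) by linarith
  then have "\<epsilon> * \<delta> \<ge> 0" using assms(2) by simp
  then show ?thesis using fp_then[OF assms(1,2) True assms(3,4)] by (simp add: algebra_simps)
next
  case False
  then show ?thesis using fp_le_1[OF assms(1), of "s + t" S'] fp_nonneg[OF assms(1), of s S] assms(3) by linarith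
qed

end

section \<open>The matching strategy: setting and bookkeeping\<close>

locale fast_game =
  fixes n a b d T :: nat and \<beta> :: breaker_strategy
  assumes a_pos': "a > 0" and legal': "breaker_legal n b \<beta>" and b_le: "b \<le> 2 * a"
    and T_def: "T = (n - d) div 2" and d4: "d \<ge> 4" and d_le: "1000 * d \<le> n"
    and n_large: "100 * b + 10000 \<le> n"

sublocale fast_game \<subseteq> game n a b \<beta> "fast_opt n d T"
proof
  show "a > 0" "breaker_legal n b \<beta>" by (fact a_pos' legal')+
  fix v
  have "fast_opt n d T v \<subseteq> complete_edges n \<and> fast_opt n d T v \<noteq> {}"
    by (rule fast_opt_legal) (use n_large d4 in auto)
  then show "fast_opt n d T v \<subseteq> complete_edges n" "fast_opt n d T v \<noteq> {}" by auto
qed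

context fast_game
begin

abbreviation Q :: "move list \<Rightarrow> nat set" where
  "Q h \<equiv> fresh n T (maker_view h)"

abbreviation S :: "move list \<Rightarrow> nat set" where
  "S h \<equiv> singles n (maker_edges h)"

abbreviation P :: "move list \<Rightarrow> nat set set" where
  "P h \<equiv> pair_comps n (maker_edges h)"

text \<open>Roughly half of the hidden phase. PhantomBreaker owns at most \<open>n / 2\<close> edges
  by then and gains about as many in the second half, so a vertex of degree at most
  \<open>n / 4\<close> at time \<open>H\<close> keeps about a quarter of its edges until the phase
  ends.\<close>

definition H :: nat where
  "H = n div 4"

lemma T_bounds: "2 * T + d \<le> n" "n \<le> 2 * T + d + 1" "H \<le> T" "4 * H \<le> n" "n \<le> 4 * H + 3"
  using d_le d4 n_large by (auto simp: T_def H_def)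

lemma fin_Q [simp]: "finite (Q h)"
  by (simp add: fresh_def)

lemma Q_nxt: "Q (nxt h e) = (if tm h < T then Q h - e else Q h)"
  by (auto simp: fresh_def view_nxt Suc_diff_le)

lemma breaker_edges_le:
  assumes "reach h"
  shows "card (breaker_edges h) \<le> 2 * tm h"
proof -
  have "b * (tm h div a) \<le> 2 * (a * (tm h div a))" using b_le by simp
  also have "\<dots> \<le> 2 * tm h" by simp
  finally show ?thesis using card_breaker[OF assms] by linarith
qed

lemma opt_eq:
  assumes "reach h"
  shows "opt h = (if tm h < T \<and> card (Q h) \<ge> 2 then pairs (Q h)
         else if S h - Q h \<noteq> {} then edge_cut n {Min (S h - Q h)}
         else if S h \<noteq> {} then edge_cut n {Min (S h)}
         else if card (P h) \<ge> d then pairs (Min ` P h)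
         else if P h \<noteq> {} then edge_cut n (SOME X. X \<in> P h)
         else kruskal_opt n (maker_view h))"
proof -
  have E: "successes (maker_view h) \<inter> complete_edges n = maker_edges h"
    using reach_complete(1)[OF assms] by (auto simp: successes_maker_view)
  show ?thesis unfolding fast_opt_def Let_def E by (rule refl)
qed

lemma S_nxt: "S (nxt h e) \<subseteq> S h"
  by (rule singles_mono) (auto simp: maker_nxt)

lemma S_nxt_success:
  assumes "e \<in> complete_edges n" "e \<notin> breaker_edges h"
  shows "S (nxt h e) \<subseteq> S h - e"
proof -
  obtain x y where "e = {x, y}" "x \<noteq> y" using assms(1) by (rule complete_edgeE)
  then show ?thesis using singles_insert[of x y n "maker_edges h"] assms(2) by (simp add: maker_nxt)
qed

lemma card_opt_split: "card (opt h) = card (opt h - breaker_edges h) + card (opt h \<inter> breaker_edges h)"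
  by (subst card_Un_disjoint[symmetric]) (auto intro: arg_cong[where f = card])

lemma card_opt_blocked:
  assumes "reach h"
  shows "card (opt h \<inter> breaker_edges h) \<le> 2 * tm h"
proof -
  have "card (opt h \<inter> breaker_edges h) \<le> card (breaker_edges h)"
    by (rule card_mono) (use reach_complete[OF assms] in auto)
  then show ?thesis using breaker_edges_le[OF assms] by linarith
qed

lemma choose_ge:
  assumes "d \<le> m"
  shows "d * d \<le> 4 * (m choose 2)"
proof -
  have "d * d \<le> d * (2 * (d - 1))" using d4 by (intro mult_le_mono2) simp
  also have "\<dots> = 2 * (d * (d - 1))" by simp
  also have "d * (d - 1) \<le> m * (m - 1)" by (rule mult_le_mono) (use assms in auto)
  also have "\<dots> = 2 * (m choose 2)" by (rule two_choose_two[symmetric])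
  finally show ?thesis by simp
qed

subsection \<open>The hidden phase\<close>

text \<open>A failed attempt uses up its two vertices just like a successful one, so the size of
  \<open>Q\<close> is deterministic.\<close>

lemma card_Q:
  assumes "reach h" "tm h \<le> T"
  shows "card (Q h) = n - 2 * tm h"
  using assms
proof induction
  case reach_Nil
  show ?case by (simp add: fresh_def)
next
  case (reach_nxt h e)
  then have t: "tm h < T" and q: "card (Q h) = n - 2 * tm h" by auto
  then have "card (Q h) \<ge> 2" using T_bounds by linarith
  then have "e \<in> pairs (Q h)" using reach_nxt(2) t by (simp add: opt_eq[OF reach_nxt(1)])
  then have "e \<subseteq> Q h" "card e = 2" "finite e" by (auto simp: pairs_def card_ge_0_finite)
  then show ?case using q t by (simp add: Q_nxt card_Diff_subset)
qed

lemma opt_hidden: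
  assumes "reach h" "tm h < T"
  shows "opt h = pairs (Q h)"
proof -
  have "card (Q h) \<ge> 2" using card_Q[of h] assms T_bounds by simp
  then show ?thesis using assms by (simp add: opt_eq)
qed

text \<open>A uniform pair out of \<open>q\<close> untried vertices misses a given one with
  probability \<open>(q - 2) / q\<close>, and these factors telescope. PhantomBreaker does not
  enter, because the options depend on \<open>Q\<close> alone.\<close>

lemma fp_fresh:
  assumes "reach h" "tm h + s \<le> T"
  shows "fp s (\<lambda>h. v \<notin> Q h) h \<le> (if v \<in> Q h then (real (card (Q h)) - 2 * s) / card (Q h) else 0)"
    (is "_ \<le> ?\<phi> s h")
  unfolding fp_def
proof (rule expect_upper[where I = "\<lambda>_. True" and tmax = T and \<phi> = ?\<phi>])
  fix h assume "reach h"
  show "of_bool (\<not> v \<notin> Q h) \<le> ?\<phi> 0 h" by (auto simp: card_gt_0_iff)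
next
  fix s h assume h: "reach h" "tm h + Suc s \<le> T"
  then have t: "tm h < T" by simp
  let ?q = "card (Q h)"
  have q: "?q = n - 2 * tm h" using card_Q h by simp
  have "2 * (tm h + Suc s) + d \<le> n"
    using mult_le_mono2[OF h(2), of 2] T_bounds(1) by simp
  then have q4: "4 \<le> ?q" "2 * Suc s \<le> ?q" using q d4 by simp_all
  have opt: "opt h = pairs (Q h)" by (rule opt_hidden[OF h(1) t])
  have cancel: "x * y / 2 * (z / y) = x * z / 2" if "y \<noteq> 0" for x y z :: real
    using that by simp
  show "(\<Sum>e\<in>opt h. ?\<phi> s (nxt h e)) \<le> real (card (opt h)) * ?\<phi> (Suc s) h"
  proof (cases "v \<in> Q h")
    case False
    then show ?thesis using t by (simp add: Q_nxt)
  next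
    case True
    have "?\<phi> s (nxt h e) = of_bool (e \<in> pairs (Q h - {v})) * ((real ?q - 2 - 2 * s) / (real ?q - 2))"
      if e: "e \<in> pairs (Q h)" for e
    proof (cases "v \<in> e")
      case True
      then show ?thesis using t by (auto simp: Q_nxt pairs_def)
    next
      case False
      have "e \<subseteq> Q h" "card e = 2" "finite e" using e by (auto simp: pairs_def card_ge_0_finite)
      then have "real (card (Q h - e)) = real ?q - 2" using q4 by (simp add: card_Diff_subset of_nat_diff)
      then show ?thesis using False True e t by (auto simp: Q_nxt pairs_def)
    qed
    then have "(\<Sum>e\<in>opt h. ?\<phi> s (nxt h e))
        = (\<Sum>e\<in>pairs (Q h). of_bool (e \<in> pairs (Q h - {v})) * ((real ?q - 2 - 2 * s) / (real ?q - 2)))"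
      unfolding opt by (intro sum.cong) auto
    also have "\<dots> = card (pairs (Q h) \<inter> pairs (Q h - {v})) * ((real ?q - 2 - 2 * s) / (real ?q - 2))"
    proof -
      have "finite (pairs (Q h))" using opt finite_opt[of h] by simp
      then show ?thesis by (simp only: sum_distrib_right[symmetric]) (simp add: of_bool_def sum.If_cases Int_def)
    qed
    also have "pairs (Q h) \<inter> pairs (Q h - {v}) = pairs (Q h - {v})" using pairs_mono[of "Q h - {v}" "Q h"] by auto
    also have "card (pairs (Q h - {v})) = (?q - 1) choose 2" using True by (simp add: card_pairs)
    also have "real ((?q - 1) choose 2) = (real ?q - 1) * (real ?q - 2) / 2"
      using q4 by (simp add: real_choose_two of_nat_diff)
    also have "\<dots> * ((real ?q - 2 - 2 * s) / (real ?q - 2)) = (real ?q - 1) * (real ?q - 2 - 2 * s) / 2"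
      by (rule cancel) (use q4 in simp)
    also have "\<dots> = (real ?q * (real ?q - 1) / 2) * ((real ?q - 2 * Suc s) / ?q)"
    proof -
      have "((real ?q - 1) * real ?q / 2) * ((real ?q - 2 * Suc s) / ?q) = (real ?q - 1) * (real ?q - 2 * Suc s) / 2"
        by (rule cancel) (simp only: of_nat_eq_0_iff, use q4(1) in linarith)
      then show ?thesis by (simp add: algebra_simps)
    qed
    also have "real ?q * (real ?q - 1) / 2 = real (?q choose 2)"
      by (simp add: real_choose_two)
    also have "?q choose 2 = card (opt h)" by (simp add: opt card_pairs)
    finally show ?thesis using True by simp
  qed
qed (use assms in auto)

text \<open>Measured against the claims possible since time \<open>H\<close>, the bound is preserved
  by every attempt, also after the hidden phase, when leftover vertices are attached.\<close>

definition deg_ctrl :: "move list \<Rightarrow> bool" where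
  "deg_ctrl h \<longleftrightarrow> (\<forall>v\<in>Q h. 4 * deg h v + 4 * (b * (H div a)) \<le> n + 4 * (b * (tm h div a)))"

lemma deg_ctrl_nxt:
  assumes "reach h" "deg_ctrl h"
  shows "deg_ctrl (nxt h e)"
  unfolding deg_ctrl_def
proof
  fix v assume "v \<in> Q (nxt h e)"
  then have "v \<in> Q h" by (auto simp: Q_nxt split: if_splits)
  then have "4 * deg h v + 4 * (b * (H div a)) \<le> n + 4 * (b * (tm h div a))"
    using assms(2) by (simp add: deg_ctrl_def)
  then show "4 * deg (nxt h e) v + 4 * (b * (H div a)) \<le> n + 4 * (b * (tm (nxt h e) div a))"
    using deg_nxt[OF assms(1), of e v] by simp
qed

text \<open>At time \<open>H\<close> the degree sum is at most \<open>n\<close>, so at most four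
  vertices have degree above \<open>n / 4\<close>. At least \<open>n / 2\<close> vertices are
  untried then and at most \<open>d + 1\<close> at the end, hence each candidate survives with
  probability at most \<open>2 * (d + 1) / n\<close>; the union bound multiplies this by
  four.\<close>

lemma fp_deg_ctrl_from_H:
  assumes "reach h0" "tm h0 = H"
  shows "fp (T - H) deg_ctrl h0 \<le> 8 * (real d + 1) / n"
proof -
  define D where "D = {v \<in> Q h0. n < 4 * deg h0 v}"
  have "card D \<le> card {v. v < n \<and> n \<le> 4 * deg h0 v}"
    by (rule card_mono) (auto simp: D_def fresh_def)
  moreover have "card {v. v < n \<and> n \<le> 4 * deg h0 v} * n \<le> 4 * n"
    using card_heavy[OF assms(1), of n 4] breaker_edges_le[OF assms(1)] assms(2) T_bounds by linarith
  ultimately have D: "card D \<le> 4" using n_large by simp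
  have finD: "finite D" by (simp add: D_def)
  define I where "I h \<longleftrightarrow> Q h \<subseteq> Q h0 \<and> (\<forall>v. deg h v + b * (H div a) \<le> deg h0 v + b * (tm h div a))" for h
  have inv: "I (nxt h e)" if "reach h" "I h" for h e
  proof -
    have "deg (nxt h e) v + b * (H div a) \<le> deg h0 v + b * (tm (nxt h e) div a)" for v
    proof -
      have "deg h v + b * (H div a) \<le> deg h0 v + b * (tm h div a)" using that(2) by (simp add: I_def)
      then show ?thesis using deg_nxt[OF that(1), of e v] by simp
    qed
    moreover have "Q (nxt h e) \<subseteq> Q h0" using that(2) by (auto simp: I_def Q_nxt)
    ultimately show ?thesis by (simp add: I_def)
  qed
  have I0: "I h0" by (simp add: I_def assms(2))
  have T: "tm h0 + (T - H) \<le> T" using assms(2) T_bounds by simp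
  have "fp (T - H) deg_ctrl h0 \<le> fp (T - H) (\<lambda>h. (\<forall>v\<in>D. v \<notin> Q h) \<and> I h) h0"
  proof (rule fp_mono[OF assms(1)])
    fix h assume h: "(\<forall>v\<in>D. v \<notin> Q h) \<and> I h"
    show "deg_ctrl h" unfolding deg_ctrl_def
    proof
      fix v assume v: "v \<in> Q h"
      then have "v \<in> Q h0" "v \<notin> D" using h by (auto simp: I_def)
      then have "4 * deg h0 v \<le> n" by (simp add: D_def)
      moreover have "deg h v + b * (H div a) \<le> deg h0 v + b * (tm h div a)" using h by (simp add: I_def)
      ultimately show "4 * deg h v + 4 * (b * (H div a)) \<le> n + 4 * (b * (tm h div a))" by linarith
    qed
  qed
  also have "\<dots> \<le> fp (T - H) (\<lambda>h. \<forall>v\<in>D. v \<notin> Q h) h0"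
    by (rule fp_invariant[where tmax = T]) (use inv I0 assms T in auto)
  also have "\<dots> \<le> Ev (T - H) (\<lambda>h. \<Sum>v\<in>D. of_bool (v \<in> Q h)) h0"
    unfolding fp_def
  proof (rule expect_mono[OF assms(1)])
    fix h
    show "of_bool (\<not> (\<forall>v\<in>D. v \<notin> Q h)) \<le> (\<Sum>v\<in>D. of_bool (v \<in> Q h) :: real)"
    proof (cases "\<forall>v\<in>D. v \<notin> Q h")
      case False
      then obtain v where "v \<in> D" "v \<in> Q h" by blast
      then have "(1::real) \<le> (\<Sum>v\<in>D. of_bool (v \<in> Q h))"
        using member_le_sum[of v D "\<lambda>v. of_bool (v \<in> Q h) :: real"] finD by simp
      then show ?thesis using False by simp
    qed (simp add: sum_nonneg)
  qed
  also have "\<dots> = (\<Sum>v\<in>D. fp (T - H) (\<lambda>h. v \<notin> Q h) h0)"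
    by (simp add: expect_sum[OF finD] fp_def)
  also have "\<dots> \<le> (\<Sum>v\<in>D. 2 * (real d + 1) / n)"
  proof (rule sum_mono)
    fix v assume "v \<in> D"
    then have "fp (T - H) (\<lambda>h. v \<notin> Q h) h0 \<le> (real (card (Q h0)) - 2 * real (T - H)) / real (card (Q h0))"
      using fp_fresh[OF assms(1) T, of v] by (simp add: D_def)
    also have "card (Q h0) = n - 2 * H" using card_Q[OF assms(1)] assms(2) T_bounds by simp
    also have "real (n - 2 * H) = real n - 2 * real H" using T_bounds by (simp add: of_nat_diff)
    also have "(real n - 2 * real H - 2 * real (T - H)) / (real n - 2 * real H) \<le> (real d + 1) / (real n / 2)"
    proof (rule frac_le)
      show "real n - 2 * real H - 2 * real (T - H) \<le> real d + 1" using T_bounds d_le by linarith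
    qed (use T_bounds n_large in linarith)+
    finally show "fp (T - H) (\<lambda>h. v \<notin> Q h) h0 \<le> 2 * (real d + 1) / n" by (simp add: field_simps)
  qed
  also have "\<dots> = real (card D) * (2 * (real d + 1) / n)" by simp
  also have "\<dots> \<le> 4 * (2 * (real d + 1) / n)" using D by (intro mult_right_mono) auto
  finally show ?thesis by (simp add: mult.assoc)
qed

lemma fp_deg_ctrl: "fp T deg_ctrl [] \<le> 8 * (real d + 1) / n"
proof -
  have "fp (H + (T - H)) deg_ctrl [] \<le> 0 + 8 * (real d + 1) / n"
  proof (rule fp_then_add[OF reach_Nil])
    have "fp H (\<lambda>_. True) [] \<le> H * (0::real)"
      by (rule fp_leave[where tmax = H]) (auto intro: reach_Nil)
    then show "fp H (\<lambda>_. True) [] \<le> 0" by simp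
  qed (use fp_deg_ctrl_from_H in auto)
  then show ?thesis using T_bounds by simp
qed

text \<open>Markov's inequality. A failure leaves at most two new pending vertices and has
  probability at most \<open>4 * n / d ^ 2\<close>, as at least \<open>d * d / 4\<close> pairs are
  offered against at most \<open>n\<close> claimed edges. There are at most \<open>n / 2\<close>
  attempts.\<close>

lemma fp_pending:
  assumes "L > 0"
  shows "fp T (\<lambda>h. real (card (S h - Q h)) < L) [] \<le> 4 * real n ^ 2 / real d ^ 2 / L"
proof (rule fp_markov[OF reach_Nil assms])
  let ?\<epsilon> = "8 * real n / real d ^ 2"
  have "Ev T (\<lambda>h. real (card (S h - Q h))) [] \<le> real (card (S [] - Q [])) + T * ?\<epsilon>"
  proof (rule expect_drift[where I = "\<lambda>_. True" and tmax = T])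
    fix h assume h: "reach h" "tm h < T"
    have opt: "opt h = pairs (Q h)" by (rule opt_hidden[OF h])
    have step: "real (card (S (nxt h e) - Q (nxt h e)))
        \<le> real (card (S h - Q h)) + 2 * of_bool (e \<in> breaker_edges h)" if e: "e \<in> opt h" for e
    proof (cases "e \<in> breaker_edges h")
      case True
      have fe: "finite e" "card e = 2" using e by (auto simp: opt pairs_def card_ge_0_finite)
      have "card (S (nxt h e) - Q (nxt h e)) \<le> card ((S h - Q h) \<union> e)"
        by (rule card_mono) (use S_nxt[of h e] fe h in \<open>auto simp: Q_nxt\<close>)
      also have "\<dots> \<le> card (S h - Q h) + card e" by (rule card_Un_le)
      finally show ?thesis using True fe by simp
    next
      case False
      have "S (nxt h e) \<subseteq> S h - e" by (rule S_nxt_success) (use e opt_complete False in auto)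
      then have "card (S (nxt h e) - Q (nxt h e)) \<le> card (S h - Q h)"
        by (intro card_mono) (use h in \<open>auto simp: Q_nxt\<close>)
      then show ?thesis using False by simp
    qed
    have "(\<Sum>e\<in>opt h. real (card (S (nxt h e) - Q (nxt h e))))
        \<le> (\<Sum>e\<in>opt h. real (card (S h - Q h)) + 2 * of_bool (e \<in> breaker_edges h))"
      by (rule sum_mono[OF step])
    also have "\<dots> = card (opt h) * real (card (S h - Q h)) + 2 * real (card (opt h \<inter> breaker_edges h))"
      by (simp add: sum.distrib of_bool_def sum.If_cases Int_def sum_distrib_left[symmetric])
    also have "2 * real (card (opt h \<inter> breaker_edges h)) \<le> card (opt h) * ?\<epsilon>"
    proof -
      have "d \<le> card (Q h)" using card_Q[of h] h T_bounds d_le by simp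
      then have "d * d \<le> 4 * card (opt h)" using choose_ge by (simp add: opt card_pairs)
      then have "real d ^ 2 \<le> 4 * real (card (opt h))" by (simp add: power2_eq_square flip: of_nat_mult)
      then have "real d ^ 2 * (2 * real n) \<le> 4 * real (card (opt h)) * (2 * real n)" by (rule mult_right_mono) simp
      then have "2 * real n \<le> card (opt h) * ?\<epsilon>" using d4 by (simp add: field_simps)
      moreover have "card (opt h \<inter> breaker_edges h) \<le> n" using card_opt_blocked[OF h(1)] h T_bounds by simp
      ultimately show ?thesis by linarith
    qed
    finally show "(\<Sum>e\<in>opt h. real (card (S (nxt h e) - Q (nxt h e))))
        \<le> card (opt h) * (real (card (S h - Q h)) + ?\<epsilon>)" by (simp add: algebra_simps)
  qed (auto intro: reach_Nil)
  moreover have "S [] - Q [] = {}" by (auto simp: singles_def fresh_def)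
  then have "real (card (S [] - Q [])) = 0" by (metis card.empty of_nat_0)
  moreover have "T * ?\<epsilon> \<le> (real n / 2) * ?\<epsilon>" using T_bounds by (intro mult_right_mono) auto
  moreover have "(real n / 2) * ?\<epsilon> = 4 * real n ^ 2 / real d ^ 2" by (simp add: power2_eq_square)
  ultimately show "Ev T (\<lambda>h. real (card (S h - Q h))) [] \<le> 4 * real n ^ 2 / real d ^ 2"
    by linarith
qed simp

end

lemma edge_cut_single: "v < n \<Longrightarrow> e \<in> edge_cut n {v} \<Longrightarrow> v \<in> e \<and> e \<in> complete_edges n"
  using edge_cut_subset[of "{v}" n] by (auto simp: edge_cut_def)

lemma card_edge_cut_single: "v < n \<Longrightarrow> card (edge_cut n {v}) = n - 1"
  using card_edge_cut[of "{v}" n] by simp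

context fast_game
begin

subsection \<open>The remaining phases\<close>

lemma Q_late: "T \<le> tm h \<Longrightarrow> Q (nxt h e) = Q h"
  by (simp add: Q_nxt)

lemma opt_late:
  assumes "reach h" "T \<le> tm h"
  shows "opt h = (if S h - Q h \<noteq> {} then edge_cut n {Min (S h - Q h)}
         else if S h \<noteq> {} then edge_cut n {Min (S h)}
         else if card (P h) \<ge> d then pairs (Min ` P h)
         else if P h \<noteq> {} then edge_cut n (SOME X. X \<in> P h)
         else kruskal_opt n (maker_view h))"
  using assms by (simp add: opt_eq)

lemma div_bounds: "8 * (d div 8) \<le> d" "4 * (n div 4) \<le> n" "3 * (n div 3) \<le> n"
  by simp_all

lemma P_nxt:
  assumes "reach h" "e \<in> opt h" "S h = {}"
  shows "P (nxt h e) \<subseteq> P h"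
proof (cases "e \<in> breaker_edges h")
  case False
  have E: "maker_edges h \<subseteq> complete_edges n" by (rule reach_complete(1)[OF assms(1)])
  show ?thesis
    using pair_comps_insert(1)[OF E component_set_ge_2[OF E assms(3)], of e] assms(2) opt_complete False
    by (auto simp: maker_nxt)
qed (simp add: maker_nxt)

lemma P_nxt_success:
  assumes "reach h" "S h = {}" "e \<in> cross n (maker_edges h)" "e \<notin> breaker_edges h" "x \<in> e"
  shows "graph_comp h x \<notin> P (nxt h e)"
proof -
  have "e \<in> complete_edges n" using assms(3) cross_subset by blast
  then show ?thesis
    using pair_comps_insert(2)[OF reach_complete(1)[OF assms(1)] component_set_ge_2[OF reach_complete(1)[OF assms(1)] assms(2)]]
      assms(3-5) by (simp add: maker_nxt)
qed

text \<open>Pending vertices have left \<open>Q\<close>, so \<open>deg_ctrl\<close> does not protect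
  them. The total count does: up to time \<open>T + d div 8\<close> PhantomBreaker owns at most
  \<open>n - 3 * d / 4\<close> edges, which leaves at least \<open>d / 2\<close> free edges at every
  isolated vertex. Hence these vertices are served first and quickly.\<close>

lemma fp_pending_phase:
  fixes q :: real
  assumes h0: "reach h0" "T \<le> tm h0" "tm h0 + w \<le> T + d div 8"
    and q: "0 \<le> q" "q \<le> 1" "q * n \<le> d / 2"
  shows "fp w (\<lambda>h. S h - Q h = {}) h0 \<le> 2 ^ card (S h0 - Q h0) * (1 - q / 2) ^ w"
proof (rule fp_progress[where I = "\<lambda>h. T \<le> tm h" and tmax = "T + d div 8"])
  show "S (nxt h e) - Q (nxt h e) = {}" if "T \<le> tm h" "S h - Q h = {}" for h e
    using that S_nxt[of h e] by (auto simp: Q_late)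
  fix h assume h: "reach h" "T \<le> tm h" "tm h < T + d div 8" "S h - Q h \<noteq> {}"
  define v where "v = Min (S h - Q h)"
  have v: "v \<in> S h - Q h" unfolding v_def by (rule Min_in) (use h in auto)
  then have vn: "v < n" by (simp add: singles_def)
  have opt: "opt h = edge_cut n {v}" using opt_late[OF h(1,2)] h(4) by (simp add: v_def)
  show "real (card (opt h \<inter> breaker_edges h)) \<le> (1 - q) * card (opt h)"
  proof -
    have "q * (real n - 1) \<le> d / 2" using q by (simp add: algebra_simps)
    moreover have "real (card (opt h)) = real n - 1" using vn by (simp add: opt card_edge_cut_single of_nat_diff)
    moreover have "card (opt h \<inter> breaker_edges h) \<le> 2 * tm h" by (rule card_opt_blocked[OF h(1)])
    then have "real (card (opt h \<inter> breaker_edges h)) \<le> real n - 1 - d / 2"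
      using T_bounds(1) h(3) d4 div_bounds by linarith
    moreover have "(1 - q) * (real n - 1) = real n - 1 - q * (real n - 1)" by (simp add: left_diff_distrib)
    ultimately show ?thesis by simp
  qed
  show "S (nxt h e) - Q (nxt h e) = {} \<or> card (S (nxt h e) - Q (nxt h e)) < card (S h - Q h)"
    if e: "e \<in> opt h" "e \<notin> breaker_edges h" for e
  proof -
    have "S (nxt h e) \<subseteq> S h - e" "v \<in> e"
      using S_nxt_success[of e h] edge_cut_single[OF vn, of e] e opt by auto
    then have "S (nxt h e) - Q (nxt h e) \<subset> S h - Q h" using v by (auto simp: Q_late[OF h(2)])
    then show ?thesis by (simp add: psubset_card_mono)
  qed
  show "S (nxt h e) - Q (nxt h e) = {} \<or> card (S (nxt h e) - Q (nxt h e)) \<le> card (S h - Q h)"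
    if "e \<in> breaker_edges h" for e
    using that by (simp add: maker_nxt Q_late[OF h(2)])
qed (use assms in auto)

text \<open>The final \<open>b\<close> pays for rounding: the time from \<open>H\<close> to
  \<open>t\<close> may contain one turn more than \<open>(t - H) div a\<close>.\<close>

lemma claims_diff:
  assumes "H \<le> t"
  shows "b * (t div a) \<le> b * (H div a) + 2 * (t - H) + b"
proof -
  define r where "r = t - H"
  have t: "t = H + r" using assms by (simp add: r_def)
  have "H < a * (H div a + 1)" "r < a * (r div a + 1)"
    using dividend_less_times_div[of a] a_pos by (auto simp: algebra_simps)
  then have "t < (H div a + r div a + 2) * a" unfolding t by (simp add: algebra_simps)
  then have "t div a < H div a + r div a + 2" by (rule less_mult_imp_div_less)
  then have "b * (t div a) \<le> b * (H div a + r div a + 1)" by (intro mult_le_mono2) simp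
  moreover have "b * (r div a) \<le> 2 * a * (r div a)" using b_le by (rule mult_le_mono1)
  moreover have "2 * a * (r div a) \<le> 2 * r" using times_div_less_eq_dividend[of a r] by (simp add: mult.assoc)
  moreover have "b * (H div a + r div a + 1) = b * (H div a) + b * (r div a) + b" by (simp add: algebra_simps)
  ultimately show ?thesis unfolding r_def[symmetric] by linarith
qed

text \<open>The isolated vertices that remain lie in \<open>Q\<close>. By \<open>deg_ctrl\<close>
  their degrees exceed \<open>3 * n / 4\<close> by at most a small multiple of \<open>d\<close> plus
  a constant, so an eighth of their edges is free.\<close>

lemma fp_single_phase:
  assumes h0: "reach h0" "T \<le> tm h0" "deg_ctrl h0" "S h0 - Q h0 = {}"
    and w: "tm h0 + w \<le> T + d div 8 + 12 * (d + 1)"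
  shows "fp w (\<lambda>h. S h = {}) h0 \<le> 2 ^ card (S h0) * (1 - (1 / 8) / 2) ^ w"
proof (rule fp_progress[where I = "\<lambda>h. T \<le> tm h \<and> deg_ctrl h \<and> S h - Q h = {}"
      and tmax = "T + d div 8 + 12 * (d + 1)"])
  show "S (nxt h e) = {}" if "S h = {}" for h e
    using that S_nxt[of h e] by auto
  show "T \<le> tm (nxt h e) \<and> deg_ctrl (nxt h e) \<and> S (nxt h e) - Q (nxt h e) = {}"
    if "reach h" "T \<le> tm h \<and> deg_ctrl h \<and> S h - Q h = {}" for h e
  proof -
    have T: "T \<le> tm h" using that(2) by blast
    have "S (nxt h e) - Q (nxt h e) = {}" using that(2) S_nxt[of h e] by (auto simp: Q_late[OF T])
    then show ?thesis using that deg_ctrl_nxt by auto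
  qed
  fix h assume h: "reach h" "T \<le> tm h \<and> deg_ctrl h \<and> S h - Q h = {}"
    "tm h < T + d div 8 + 12 * (d + 1)" "S h \<noteq> {}"
  define v where "v = Min (S h)"
  have v: "v \<in> S h" unfolding v_def by (rule Min_in) (use h in auto)
  then have vn: "v < n" and vQ: "v \<in> Q h" using h(2) by (auto simp: singles_def)
  have opt: "opt h = edge_cut n {v}" using opt_late[OF h(1)] h(2,4) by (simp add: v_def)
  show "real (card (opt h \<inter> breaker_edges h)) \<le> (1 - 1 / 8) * card (opt h)"
  proof -
    have "card (opt h \<inter> breaker_edges h) \<le> deg h v"
      using cut_blocked_le_deg[OF h(1), of "{v}"] vn by (simp add: opt)
    moreover have "4 * deg h v + 4 * (b * (H div a)) \<le> n + 4 * (b * (tm h div a))"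
      using h(2) vQ by (simp add: deg_ctrl_def)
    moreover have "H \<le> tm h" using T_bounds(3) h(2) by simp
    then have "b * (tm h div a) \<le> b * (H div a) + 2 * (tm h - H) + b" by (rule claims_diff)
    ultimately have "4 * card (opt h \<inter> breaker_edges h) + 8 * H \<le> n + 8 * tm h + 4 * b"
      using \<open>H \<le> tm h\<close> by linarith
    then have "8 * card (opt h \<inter> breaker_edges h) + 7 \<le> 7 * n"
      using h(3) T_bounds n_large d_le div_bounds by simp
    then have "8 * card (opt h \<inter> breaker_edges h) \<le> 7 * (n - 1)" by simp
    then show ?thesis using vn by (simp add: opt card_edge_cut_single)
  qed
  show "S (nxt h e) = {} \<or> card (S (nxt h e)) < card (S h)"
    if e: "e \<in> opt h" "e \<notin> breaker_edges h" for e
  proof -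
    have "S (nxt h e) \<subseteq> S h - e" "v \<in> e"
      using S_nxt_success[of e h] edge_cut_single[OF vn, of e] e opt by auto
    then have "S (nxt h e) \<subset> S h" using v by auto
    then show ?thesis by (simp add: psubset_card_mono)
  qed
  show "S (nxt h e) = {} \<or> card (S (nxt h e)) \<le> card (S h)"
    if "e \<in> breaker_edges h" for e
    using that by (simp add: maker_nxt)
qed (use assms in auto)

lemma sparse_nonneg: "0 \<le> 1 - (1 - 16 * real n / real d ^ 2) / 2"
proof -
  define x where "x = 16 * real n / real d ^ 2"
  have "0 \<le> x" by (simp add: x_def)
  then show ?thesis unfolding x_def[symmetric] by simp
qed

text \<open>At most \<open>4 * n\<close> claimed edges against at least \<open>d * d / 4\<close>
  options; for \<open>d\<close> linear in \<open>n\<close> the risk of a failure is of order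
  \<open>1 / n\<close>.\<close>

lemma few_blocked_sparse:
  assumes "reach h" "tm h \<le> 2 * n" "d * d \<le> 4 * card (opt h)"
  shows "real (card (opt h \<inter> breaker_edges h)) \<le> (1 - (1 - 16 * real n / real d ^ 2)) * card (opt h)"
proof -
  have "real d ^ 2 \<le> 4 * real (card (opt h))"
    using assms(3) by (simp add: power2_eq_square flip: of_nat_mult)
  then have "4 * real n * real d ^ 2 \<le> 4 * real n * (4 * real (card (opt h)))" by (rule mult_left_mono) simp
  then have "4 * real n \<le> 16 * real n / real d ^ 2 * card (opt h)"
    using d4 by (simp add: field_simps)
  moreover have "card (opt h \<inter> breaker_edges h) \<le> 4 * n"
    using card_opt_blocked[OF assms(1)] assms(2) by simp
  ultimately show ?thesis by simp
qed

text \<open>A success removes two pairs at once, hence the measure \<open>card (P h) div 2\<close>,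
  which starts at no more than \<open>n div 4\<close>.\<close>

lemma fp_matching_phase:
  assumes h0: "reach h0" "T \<le> tm h0" "S h0 = {}" "tm h0 + w \<le> 2 * n"
    and \<epsilon>: "16 * real n / real d ^ 2 \<le> 1"
  shows "fp w (\<lambda>h. card (P h) < d) h0 \<le> 2 ^ (n div 4) * (1 - (1 - 16 * real n / real d ^ 2) / 2) ^ w"
proof -
  have "fp w (\<lambda>h. card (P h) < d) h0 \<le> 2 ^ (card (P h0) div 2) * (1 - (1 - 16 * real n / real d ^ 2) / 2) ^ w"
  proof (rule fp_progress[where I = "\<lambda>h. T \<le> tm h \<and> S h = {}" and tmax = "2 * n" and \<mu> = "\<lambda>h. card (P h) div 2"])
    show "card (P (nxt h e)) < d" if "reach h" "T \<le> tm h \<and> S h = {}" "card (P h) < d" "e \<in> opt h" for h e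
      using that P_nxt[of h e] card_mono[of "P h" "P (nxt h e)"] by auto
    show "T \<le> tm (nxt h e) \<and> S (nxt h e) = {}" if "T \<le> tm h \<and> S h = {}" for h e
      using that S_nxt[of h e] by auto
    fix h assume h: "reach h" "T \<le> tm h \<and> S h = {}" "tm h < 2 * n" "\<not> card (P h) < d"
    note E = reach_complete(1)[OF h(1)]
    have P: "P h \<subseteq> graph_comps h" by (auto simp: pair_comps_def)
    have opt: "opt h = pairs (Min ` P h)" using opt_late[OF h(1)] h(2,4) by simp
    have "card (opt h) = card (P h) choose 2" by (simp add: opt card_pairs card_Min_image[OF E P])
    then show "real (card (opt h \<inter> breaker_edges h)) \<le> (1 - (1 - 16 * real n / real d ^ 2)) * card (opt h)"
      using few_blocked_sparse[OF h(1)] choose_ge[of "card (P h)"] h(3,4) by simp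
    show "card (P (nxt h e)) < d \<or> card (P (nxt h e)) div 2 < card (P h) div 2"
      if e: "e \<in> opt h" "e \<notin> breaker_edges h" for e
    proof -
      obtain X Y where XY: "X \<in> P h" "Y \<in> P h" "X \<noteq> Y" "e = {Min X, Min Y}"
        using pairs_Min_image[OF E P] e(1) opt by metis
      have "e \<in> cross n (maker_edges h)" using pairs_Min_image_cross[OF E P] e(1) opt by auto
      then have "graph_comp h x \<notin> P (nxt h e)" if "x \<in> e" for x
        using P_nxt_success[OF h(1) _ _ e(2) that] h(2) by blast
      moreover have "graph_comp h (Min X) = X" "graph_comp h (Min Y) = Y"
        using Min_in_component_set(3)[OF E] XY P by auto
      ultimately have "X \<notin> P (nxt h e)" "Y \<notin> P (nxt h e)" using XY(4) by force+
      then have "P (nxt h e) \<subseteq> P h - {X, Y}" using P_nxt[OF h(1) e(1)] h(2) by blast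
      then have "card (P (nxt h e)) \<le> card (P h - {X, Y})" by (intro card_mono) auto
      also have "\<dots> = card (P h) - 2" using XY by (simp add: card_Diff_subset)
      finally have "card (P (nxt h e)) + 2 \<le> card (P h)" using h(4) d4 by simp
      then show ?thesis by linarith
    qed
    show "card (P (nxt h e)) < d \<or> card (P (nxt h e)) div 2 \<le> card (P h) div 2"
      if "e \<in> breaker_edges h" for e
      using that by (simp add: maker_nxt)
  qed (use assms in auto)
  also have "\<dots> \<le> 2 ^ (n div 4) * (1 - (1 - 16 * real n / real d ^ 2) / 2) ^ w"
  proof (rule mult_right_mono)
    have "card (P h0) * 2 \<le> n"
      by (rule card_component_set_le[OF reach_complete(1)[OF h0(1)]]) (auto simp: pair_comps_def)
    then have "card (P h0) div 2 \<le> n div 4" by linarith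
    then show "(2::real) ^ (card (P h0) div 2) \<le> 2 ^ (n div 4)" by (rule power_increasing) simp
  qed (rule zero_le_power[OF sparse_nonneg])
  finally show ?thesis .
qed

text \<open>Until the end of this phase PhantomBreaker owns little more than
  \<open>3 * n / 2\<close> edges, while the cut of a pair has \<open>2 * (n - 2)\<close>, so an
  eighth of it is free.\<close>

lemma fp_pair_phase:
  assumes h0: "reach h0" "T \<le> tm h0" "S h0 = {}" "card (P h0) < d"
    and w: "tm h0 + w \<le> T + d div 8 + 12 * (d + 1) + (n div 4 + d) + 12 * d"
  shows "fp w (\<lambda>h. P h = {}) h0 \<le> 2 ^ card (P h0) * (1 - (1 / 8) / 2) ^ w"
proof (rule fp_progress[where I = "\<lambda>h. T \<le> tm h \<and> S h = {} \<and> card (P h) < d"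
      and tmax = "T + d div 8 + 12 * (d + 1) + (n div 4 + d) + 12 * d"])
  show "P (nxt h e) = {}" if "reach h" "T \<le> tm h \<and> S h = {} \<and> card (P h) < d" "P h = {}" "e \<in> opt h" for h e
    using that P_nxt[of h e] by auto
  show "T \<le> tm (nxt h e) \<and> S (nxt h e) = {} \<and> card (P (nxt h e)) < d"
    if "reach h" "T \<le> tm h \<and> S h = {} \<and> card (P h) < d" "e \<in> opt h" for h e
    using that P_nxt[of h e] S_nxt[of h e] card_mono[of "P h" "P (nxt h e)"] by auto
  fix h assume h: "reach h" "T \<le> tm h \<and> S h = {} \<and> card (P h) < d"
    "tm h < T + d div 8 + 12 * (d + 1) + (n div 4 + d) + 12 * d" "P h \<noteq> {}"
  note E = reach_complete(1)[OF h(1)]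
  define X where "X = (SOME X. X \<in> P h)"
  have X: "X \<in> P h" unfolding X_def using h(4) by (simp add: some_in_eq)
  then have X': "X \<in> graph_comps h" "card X = 2" by (auto simp: pair_comps_def)
  have opt: "opt h = edge_cut n X" using opt_late[OF h(1)] h(2,4) by (simp add: X_def)
  show "real (card (opt h \<inter> breaker_edges h)) \<le> (1 - 1 / 8) * card (opt h)"
  proof -
    have "card (opt h) = 2 * (n - 2)"
      using card_edge_cut[OF component_set_subset[OF E X'(1)]] X'(2) by (simp add: opt)
    moreover have "card (opt h \<inter> breaker_edges h) \<le> 2 * tm h" by (rule card_opt_blocked[OF h(1)])
    then have "8 * card (opt h \<inter> breaker_edges h) + 28 \<le> 14 * n"
      using h(3) T_bounds n_large d_le div_bounds by simp
    then have "8 * card (opt h \<inter> breaker_edges h) \<le> 14 * (n - 2)" by simp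
    ultimately show ?thesis by simp
  qed
  show "P (nxt h e) = {} \<or> card (P (nxt h e)) < card (P h)"
    if e: "e \<in> opt h" "e \<notin> breaker_edges h" for e
  proof -
    obtain x where x: "x \<in> X" "x \<in> e" using e(1) opt by (auto simp: edge_cut_def)
    have "e \<in> cross n (maker_edges h)" using edge_cut_subset_cross[OF E X'(1)] e(1) opt by auto
    then have "graph_comp h x \<notin> P (nxt h e)" using P_nxt_success[OF h(1) _ _ e(2) x(2)] h(2) by blast
    then have "X \<notin> P (nxt h e)" using component_set_cases[OF X'(1) x(1)] by simp
    then have "P (nxt h e) \<subset> P h" using P_nxt[OF h(1) e(1)] h(2) X by blast
    then show ?thesis by (simp add: psubset_card_mono)
  qed
  show "P (nxt h e) = {} \<or> card (P (nxt h e)) \<le> card (P h)"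
    if "e \<in> breaker_edges h" for e
    using that by (simp add: maker_nxt)
qed (use assms in auto)

section \<open>Merging components of size at least three\<close>

definition big_comps :: "move list \<Rightarrow> bool" where
  "big_comps h \<longleftrightarrow> T \<le> tm h \<and> S h = {} \<and> P h = {}"

lemma big_comps_ge_3:
  assumes "reach h" "big_comps h" "X \<in> graph_comps h"
  shows "3 \<le> card X"
proof -
  have "2 \<le> card X"
    by (rule component_set_ge_2[OF reach_complete(1)[OF assms(1)] _ assms(3)]) (use assms(2) in \<open>simp add: big_comps_def\<close>)
  moreover have "card X \<noteq> 2" using assms(2,3) by (auto simp: big_comps_def pair_comps_def)
  ultimately show ?thesis by simp
qed

lemma big_comps_nxt:
  assumes "reach h" "big_comps h" "e \<in> opt h"
  shows "big_comps (nxt h e)"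
  using assms P_nxt[of h e] S_nxt[of h e] by (auto simp: big_comps_def)

lemma opt_big_comps:
  assumes "reach h" "big_comps h" "card (graph_comps h) > 1"
  shows "opt h = cross n (maker_edges h)"
  using opt_late[OF assms(1)] assms(2,3) d4 cross_nonempty[of n "maker_edges h"]
  by (simp add: big_comps_def kruskal_opt_def successes_maker_view)

lemma card_graph_comps_success:
  assumes "reach h" "big_comps h" "card (graph_comps h) > 1" "e \<in> opt h" "e \<notin> breaker_edges h"
  shows "card (graph_comps (nxt h e)) < card (graph_comps h)"
  using card_component_set_insert_cross[of e n "maker_edges h"] opt_big_comps[OF assms(1-3)] assms(4,5)
  by (simp add: maker_nxt)

text \<open>Representatives alone provide at least \<open>d * d / 4\<close> crossing edges while
  \<open>d\<close> components exist, so failures are rare. As all components have at least three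
  vertices, at most \<open>n div 3\<close> mergers are needed.\<close>

lemma fp_merge_phase:
  assumes h0: "reach h0" "big_comps h0" "tm h0 + w \<le> 2 * n"
    and \<epsilon>: "16 * real n / real d ^ 2 \<le> 1"
  shows "fp w (\<lambda>h. card (graph_comps h) < d) h0 \<le> 2 ^ (n div 3) * (1 - (1 - 16 * real n / real d ^ 2) / 2) ^ w"
proof -
  have "fp w (\<lambda>h. card (graph_comps h) < d) h0
      \<le> 2 ^ card (graph_comps h0) * (1 - (1 - 16 * real n / real d ^ 2) / 2) ^ w"
  proof (rule fp_progress[where I = big_comps and tmax = "2 * n"])
    show "card (graph_comps (nxt h e)) < d" if "card (graph_comps h) < d" "e \<in> opt h" for h e
      using that card_graph_comps_mono[of e h] by simp
    fix h assume h: "reach h" "big_comps h" "tm h < 2 * n" "\<not> card (graph_comps h) < d"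
    note E = reach_complete(1)[OF h(1)]
    have gt1: "card (graph_comps h) > 1" using h(4) d4 by simp
    have "d * d \<le> 4 * (card (graph_comps h) choose 2)" using choose_ge h(4) by simp
    also have "card (graph_comps h) choose 2 = card (pairs (Min ` graph_comps h))"
      using card_Min_image[OF E subset_refl] by (simp add: card_pairs)
    also have "\<dots> \<le> card (opt h)"
      by (rule card_mono) (use pairs_Min_image_cross[OF E subset_refl] opt_big_comps[OF h(1,2) gt1] in auto)
    finally show "real (card (opt h \<inter> breaker_edges h)) \<le> (1 - (1 - 16 * real n / real d ^ 2)) * card (opt h)"
      using few_blocked_sparse[OF h(1)] h(3) by simp
    show "card (graph_comps (nxt h e)) < d \<or> card (graph_comps (nxt h e)) < card (graph_comps h)"
      if "e \<in> opt h" "e \<notin> breaker_edges h" for e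
      using card_graph_comps_success[OF h(1,2) gt1 that] by simp
    show "card (graph_comps (nxt h e)) < d \<or> card (graph_comps (nxt h e)) \<le> card (graph_comps h)"
      if "e \<in> breaker_edges h" for e
      using that by (simp add: maker_nxt)
  qed (use assms big_comps_nxt in auto)
  also have "\<dots> \<le> 2 ^ (n div 3) * (1 - (1 - 16 * real n / real d ^ 2) / 2) ^ w"
  proof (rule mult_right_mono)
    have "card (graph_comps h0) * 3 \<le> n"
      by (rule card_component_set_le[OF reach_complete(1)[OF h0(1)] big_comps_ge_3[OF h0(1,2)]]) auto
    then have "card (graph_comps h0) \<le> n div 3" by linarith
    then show "(2::real) ^ card (graph_comps h0) \<le> 2 ^ (n div 3)" by (rule power_increasing) simp
  qed (rule zero_le_power[OF sparse_nonneg])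
  finally show ?thesis .
qed

text \<open>The time bound \<open>23 * n / 20\<close> covers
  \<open>n / 2 + n / 4 + n / 3 = 13 * n / 12\<close> for the three long phases and about
  \<open>42 * d\<close> for everything else, with \<open>1000 * d \<le> n\<close>.\<close>

lemma fp_final_phase:
  assumes h0: "reach h0" "big_comps h0" "20 * (tm h0 + w) \<le> 23 * n"
  shows "fp w (\<lambda>h. card (graph_comps h) \<le> 1) h0 \<le> 2 ^ card (graph_comps h0) * (1 - (1 / 10) / 2) ^ w"
proof (rule fp_progress[where I = big_comps and tmax = "23 * n div 20"])
  show "card (graph_comps (nxt h e)) \<le> 1" if "card (graph_comps h) \<le> 1" "e \<in> opt h" for h e
    using that card_graph_comps_mono[of e h] by simp
  fix h assume h: "reach h" "big_comps h" "tm h < 23 * n div 20" "\<not> card (graph_comps h) \<le> 1"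
  note E = reach_complete(1)[OF h(1)]
  have gt1: "card (graph_comps h) > 1" using h(4) by simp
  have "(1 / 5) / 2 * card (cross n (maker_edges h)) \<le> card (cross n (maker_edges h) - breaker_edges h)"
  proof (rule card_cross_blocked[OF E])
    fix X assume X: "X \<in> graph_comps h" "2 * card X \<le> n"
    have Xn: "X \<subseteq> {..<n}" by (rule component_set_subset[OF E X(1)])
    have x3: "3 \<le> card X" by (rule big_comps_ge_3[OF h(1,2) X(1)])
    have "3 * (n - 3) \<le> card X * (n - card X)"
    proof -
      \<comment> \<open>\<open>x * (n - x)\<close> increases up to \<open>x = n / 2\<close>; the
        substitutions avoid truncated subtraction.\<close>
      obtain j where j: "card X = 3 + j" using x3 by (auto simp: le_iff_add)
      obtain m where m: "n = 2 * card X + m" using X(2) by (auto simp: le_iff_add)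
      show ?thesis unfolding m j by (simp add: algebra_simps)
    qed
    moreover have "card (edge_cut n X \<inter> breaker_edges h) \<le> card (breaker_edges h)"
      by (rule card_mono) (use reach_complete[OF h(1)] in auto)
    then have "10 * card (edge_cut n X \<inter> breaker_edges h) \<le> 23 * n"
      using breaker_edges_le[OF h(1)] h(3) by linarith
    moreover note cut_free[OF Xn, of h] card_edge_cut[OF Xn]
    ultimately have "card (edge_cut n X) \<le> 5 * card (edge_cut n X - breaker_edges h)"
      using n_large by linarith
    then show "1 / 5 * real (card (edge_cut n X)) \<le> card (edge_cut n X - breaker_edges h)" by linarith
  qed (use n_large in simp)
  then show "real (card (opt h \<inter> breaker_edges h)) \<le> (1 - 1 / 10) * card (opt h)"
    using card_opt_split[of h] unfolding opt_big_comps[OF h(1,2) gt1] by simp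
  show "card (graph_comps (nxt h e)) \<le> 1 \<or> card (graph_comps (nxt h e)) < card (graph_comps h)"
    if "e \<in> opt h" "e \<notin> breaker_edges h" for e
    using card_graph_comps_success[OF h(1,2) gt1 that] by simp
  show "card (graph_comps (nxt h e)) \<le> 1 \<or> card (graph_comps (nxt h e)) \<le> card (graph_comps h)"
    if "e \<in> breaker_edges h" for e
    using that by (simp add: maker_nxt)
qed (use assms big_comps_nxt in auto)

end

section \<open>Composition of the phases\<close>

context fast_game
begin

lemma card_Q_late:
  assumes "reach h" "T \<le> tm h"
  shows "card (Q h) \<le> d + 1"
  using assms
proof induction
  case reach_Nil
  then show ?case using card_Q[OF reach.reach_Nil] T_bounds by simp
next
  case (reach_nxt h e)
  show ?case
  proof (cases "T \<le> tm h")
    case True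
    then show ?thesis using reach_nxt by (simp add: Q_late)
  next
    case False
    then show ?thesis using card_Q[OF reach.reach_nxt[OF reach_nxt(1,2)]] reach_nxt.prems T_bounds by simp
  qed
qed

lemma S_nxt_empty: "S h = {} \<Longrightarrow> S (nxt h e) = {}"
  using S_nxt[of h e] by auto

text \<open>The base is \<open>(1 + \<epsilon>) / 2\<close> with
  \<open>\<epsilon> = 16 * n / d ^ 2\<close>. The \<open>m\<close> required successes cancel
  \<open>2 ^ m\<close>, the \<open>d\<close> surplus attempts yield \<open>(1 / 2) ^ d\<close>, and
  the accumulated risk \<open>(1 + \<epsilon>) ^ n \<le> exp (n * \<epsilon>)\<close> stays bounded
  because \<open>n / d \<le> 2 * K\<close>.\<close>

lemma sparse_power_le:
  fixes m K :: nat
  assumes "n \<le> 2 * K * d" "m + d \<le> n"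
  shows "2 ^ m * (1 - (1 - 16 * real n / real d ^ 2) / 2) ^ (m + d) \<le> (1 / 2) ^ d * exp (64 * real K ^ 2)"
proof -
  define \<epsilon> where "\<epsilon> = 16 * real n / real d ^ 2"
  have \<epsilon>: "0 \<le> \<epsilon>" by (simp add: \<epsilon>_def)
  have "(2::real) ^ m * (1 - (1 - \<epsilon>) / 2) ^ (m + d) = (1 / 2) ^ d * (1 + \<epsilon>) ^ (m + d)"
  proof -
    have "1 - (1 - \<epsilon>) / 2 = (1 / 2) * (1 + \<epsilon>)" by (simp add: field_simps)
    then have "(1 - (1 - \<epsilon>) / 2) ^ (m + d) = (1 / 2) ^ m * (1 / 2) ^ d * (1 + \<epsilon>) ^ (m + d)"
      by (simp only: power_mult_distrib power_add ac_simps)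
    moreover have "(2::real) ^ m * (1 / 2) ^ m = 1" by (simp flip: power_mult_distrib)
    ultimately show ?thesis by (simp add: mult.assoc[symmetric])
  qed
  also have "(1 + \<epsilon>) ^ (m + d) \<le> exp \<epsilon> ^ (m + d)"
    using \<epsilon> exp_ge_add_one_self by (intro power_mono) auto
  also have "\<dots> = exp (real (m + d) * \<epsilon>)" by (simp only: exp_of_nat_mult)
  also have "\<dots> \<le> exp (64 * real K ^ 2)"
  proof -
    have "real (m + d) * \<epsilon> \<le> real n * \<epsilon>" using assms(2) \<epsilon> by (intro mult_right_mono) auto
    also have "\<dots> = 16 * (real n / real d) ^ 2" by (simp add: \<epsilon>_def power2_eq_square)
    also have "\<dots> \<le> 16 * (2 * real K) ^ 2"
    proof (intro mult_left_mono power_mono)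
      have "real n \<le> 2 * real K * real d"
        using of_nat_le_iff[of n "2 * K * d", where 'a = real] assms(1) by simp
      then show "real n / real d \<le> 2 * real K" using d4 by (simp add: field_simps)
    qed auto
    finally show ?thesis by (simp add: power2_eq_square)
  qed
  finally show ?thesis by (simp add: \<epsilon>_def mult_left_mono)
qed

text \<open>The summands follow the order of play: degree control, too many pending vertices, and
  the six phases after the hidden one. The long phases have \<open>d\<close> attempts to spare; the
  factors \<open>12\<close> and \<open>16\<close> in the short ones make
  \<open>2 * (15 / 16) ^ 12\<close> and \<open>2 * (19 / 20) ^ 16\<close> smaller than
  \<open>1\<close>.\<close>

lemma fp_connected:
  fixes K L :: nat
  assumes K: "n \<le> 2 * K * d" "K > 0" and L: "L > 0" and sparse: "16 * n \<le> d * d"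
  shows "fp (T + d div 8 + 12 * (d + 1) + (n div 4 + d) + 12 * d + (n div 3 + d) + 16 * d)
      (\<lambda>h. connected_spanning n (maker_edges h)) []
    \<le> 8 * (real d + 1) / n + 4 * real n ^ 2 / real d ^ 2 / L
      + 2 ^ L * (1 - 1 / (4 * real K) / 2) ^ (d div 8)
      + (2 * (1 - (1 / 8) / 2) ^ 12) ^ (d + 1) + (1 / 2) ^ d * exp (64 * real K ^ 2)
      + (2 * (1 - (1 / 8) / 2) ^ 12) ^ d + (1 / 2) ^ d * exp (64 * real K ^ 2)
      + (2 * (1 - (1 / 10) / 2) ^ 16) ^ d"
proof -
  have \<epsilon>: "16 * real n / real d ^ 2 \<le> 1"
  proof -
    have "16 * real n \<le> real d ^ 2" using of_nat_le_iff[of "16 * n" "d * d", where 'a = real] sparse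
      by (simp add: power2_eq_square)
    then show ?thesis using d4 by simp
  qed
  note dn = div_bounds d_le n_large T_bounds
  have "fp T (\<lambda>h. deg_ctrl h \<and> real (card (S h - Q h)) < real L) []
      \<le> 8 * (real d + 1) / n + 4 * real n ^ 2 / real d ^ 2 / L"
    using fp_conj[OF reach_Nil, of T deg_ctrl "\<lambda>h. real (card (S h - Q h)) < real L"]
      fp_deg_ctrl fp_pending[of "real L"] L by simp
  then have "fp (T + d div 8) (\<lambda>h. S h - Q h = {} \<and> deg_ctrl h) [] \<le>
      8 * (real d + 1) / n + 4 * real n ^ 2 / real d ^ 2 / L
      + 2 ^ L * (1 - 1 / (4 * real K) / 2) ^ (d div 8)"
  proof (rule fp_then_add[OF reach_Nil, rotated])
    have r: "0 \<le> 1 - 1 / (4 * real K) / 2" using K(2) by (simp add: field_simps)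
    then show "0 \<le> 2 ^ L * (1 - 1 / (4 * real K) / 2) ^ (d div 8)" by simp
    fix h assume h: "reach h" "tm h = tm [] + T" "deg_ctrl h \<and> real (card (S h - Q h)) < real L"
    have "fp (d div 8) (\<lambda>h. S h - Q h = {} \<and> deg_ctrl h) h \<le> fp (d div 8) (\<lambda>h. S h - Q h = {}) h"
      by (rule fp_invariant[where tmax = "T + d div 8"]) (use h deg_ctrl_nxt in auto)
    also have "\<dots> \<le> 2 ^ card (S h - Q h) * (1 - 1 / (4 * real K) / 2) ^ (d div 8)"
    proof (rule fp_pending_phase[OF h(1)])
      have "real n \<le> 2 * real K * real d"
        using of_nat_le_iff[of n "2 * K * d", where 'a = real] K(1) by simp
      then show "1 / (4 * real K) * real n \<le> real d / 2" using K(2) by (simp add: field_simps)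
    qed (use h K(2) in auto)
    also have "\<dots> \<le> 2 ^ L * (1 - 1 / (4 * real K) / 2) ^ (d div 8)"
      by (rule mult_right_mono[OF power_increasing]) (use h r in auto)
    finally show "fp (d div 8) (\<lambda>h. S h - Q h = {} \<and> deg_ctrl h) h
        \<le> 2 ^ L * (1 - 1 / (4 * real K) / 2) ^ (d div 8)" .
  qed
  then have "fp (T + d div 8 + 12 * (d + 1)) (\<lambda>h. S h = {}) [] \<le>
      8 * (real d + 1) / n + 4 * real n ^ 2 / real d ^ 2 / L
      + 2 ^ L * (1 - 1 / (4 * real K) / 2) ^ (d div 8)
      + (2 * (1 - (1 / 8) / 2) ^ 12) ^ (d + 1)"
  proof (rule fp_then_add[OF reach_Nil, rotated])
    fix h assume h: "reach h" "tm h = tm [] + (T + d div 8)" "S h - Q h = {} \<and> deg_ctrl h"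
    have "fp (12 * (d + 1)) (\<lambda>h. S h = {}) h \<le> 2 ^ card (S h) * (1 - (1 / 8) / 2) ^ (12 * (d + 1))"
      by (rule fp_single_phase[OF h(1)]) (use h in auto)
    also have "\<dots> \<le> 2 ^ (d + 1) * (1 - (1 / 8) / 2) ^ (12 * (d + 1))"
    proof (rule mult_right_mono[OF power_increasing])
      have "card (S h) \<le> card (Q h)" by (rule card_mono) (use h(3) in auto)
      then show "card (S h) \<le> d + 1" using card_Q_late[OF h(1)] h(2) by simp
    qed auto
    also have "\<dots> = (2 * (1 - (1 / 8) / 2) ^ 12) ^ (d + 1)" by (simp only: power_mult power_mult_distrib)
    finally show "fp (12 * (d + 1)) (\<lambda>h. S h = {}) h \<le> (2 * (1 - (1 / 8) / 2) ^ 12) ^ (d + 1)" .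
  qed simp
  then have "fp (T + d div 8 + 12 * (d + 1) + (n div 4 + d)) (\<lambda>h. card (P h) < d \<and> S h = {}) [] \<le>
      8 * (real d + 1) / n + 4 * real n ^ 2 / real d ^ 2 / L
      + 2 ^ L * (1 - 1 / (4 * real K) / 2) ^ (d div 8)
      + (2 * (1 - (1 / 8) / 2) ^ 12) ^ (d + 1) + (1 / 2) ^ d * exp (64 * real K ^ 2)"
  proof (rule fp_then_add[OF reach_Nil, rotated])
    fix h assume h: "reach h" "tm h = tm [] + (T + d div 8 + 12 * (d + 1))" "S h = {}"
    have "fp (n div 4 + d) (\<lambda>h. card (P h) < d \<and> S h = {}) h \<le> fp (n div 4 + d) (\<lambda>h. card (P h) < d) h"
      by (rule fp_invariant[where tmax = "tm h + (n div 4 + d)"]) (use h S_nxt_empty in auto)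
    also have "\<dots> \<le> 2 ^ (n div 4) * (1 - (1 - 16 * real n / real d ^ 2) / 2) ^ (n div 4 + d)"
      by (rule fp_matching_phase[OF h(1) _ h(3) _ \<epsilon>]) (use h(2) dn in simp_all)
    also have "\<dots> \<le> (1 / 2) ^ d * exp (64 * real K ^ 2)"
      by (rule sparse_power_le[OF K(1)]) (use dn in simp)
    finally show "fp (n div 4 + d) (\<lambda>h. card (P h) < d \<and> S h = {}) h \<le> (1 / 2) ^ d * exp (64 * real K ^ 2)" .
  qed simp
  then have "fp (T + d div 8 + 12 * (d + 1) + (n div 4 + d) + 12 * d) (\<lambda>h. P h = {} \<and> S h = {}) [] \<le>
      8 * (real d + 1) / n + 4 * real n ^ 2 / real d ^ 2 / L
      + 2 ^ L * (1 - 1 / (4 * real K) / 2) ^ (d div 8)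
      + (2 * (1 - (1 / 8) / 2) ^ 12) ^ (d + 1) + (1 / 2) ^ d * exp (64 * real K ^ 2)
      + (2 * (1 - (1 / 8) / 2) ^ 12) ^ d"
  proof (rule fp_then_add[OF reach_Nil, rotated])
    fix h assume h: "reach h" "tm h = tm [] + (T + d div 8 + 12 * (d + 1) + (n div 4 + d))" "card (P h) < d \<and> S h = {}"
    have "fp (12 * d) (\<lambda>h. P h = {} \<and> S h = {}) h \<le> fp (12 * d) (\<lambda>h. P h = {}) h"
      by (rule fp_invariant[where tmax = "tm h + 12 * d"]) (use h S_nxt_empty in auto)
    also have "\<dots> \<le> 2 ^ card (P h) * (1 - (1 / 8) / 2) ^ (12 * d)"
      by (rule fp_pair_phase[OF h(1)]) (use h in auto)
    also have "\<dots> \<le> 2 ^ d * (1 - (1 / 8) / 2) ^ (12 * d)"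
      by (rule mult_right_mono[OF power_increasing]) (use h in auto)
    also have "\<dots> = (2 * (1 - (1 / 8) / 2) ^ 12) ^ d" by (simp only: power_mult power_mult_distrib)
    finally show "fp (12 * d) (\<lambda>h. P h = {} \<and> S h = {}) h \<le> (2 * (1 - (1 / 8) / 2) ^ 12) ^ d" .
  qed simp
  then have "fp (T + d div 8 + 12 * (d + 1) + (n div 4 + d) + 12 * d + (n div 3 + d))
        (\<lambda>h. card (graph_comps h) < d \<and> big_comps h) [] \<le>
      8 * (real d + 1) / n + 4 * real n ^ 2 / real d ^ 2 / L
      + 2 ^ L * (1 - 1 / (4 * real K) / 2) ^ (d div 8)
      + (2 * (1 - (1 / 8) / 2) ^ 12) ^ (d + 1) + (1 / 2) ^ d * exp (64 * real K ^ 2)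
      + (2 * (1 - (1 / 8) / 2) ^ 12) ^ d + (1 / 2) ^ d * exp (64 * real K ^ 2)"
  proof (rule fp_then_add[OF reach_Nil, rotated])
    fix h assume h: "reach h" "tm h = tm [] + (T + d div 8 + 12 * (d + 1) + (n div 4 + d) + 12 * d)"
      "P h = {} \<and> S h = {}"
    have big: "big_comps h" using h by (simp add: big_comps_def)
    have "fp (n div 3 + d) (\<lambda>h. card (graph_comps h) < d \<and> big_comps h) h
        \<le> fp (n div 3 + d) (\<lambda>h. card (graph_comps h) < d) h"
      by (rule fp_invariant[where tmax = "tm h + (n div 3 + d)"]) (use h big big_comps_nxt in auto)
    also have "\<dots> \<le> 2 ^ (n div 3) * (1 - (1 - 16 * real n / real d ^ 2) / 2) ^ (n div 3 + d)"
      by (rule fp_merge_phase[OF h(1) big _ \<epsilon>]) (use h(2) dn in simp)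
    also have "\<dots> \<le> (1 / 2) ^ d * exp (64 * real K ^ 2)"
      by (rule sparse_power_le[OF K(1)]) (use dn in simp)
    finally show "fp (n div 3 + d) (\<lambda>h. card (graph_comps h) < d \<and> big_comps h) h
        \<le> (1 / 2) ^ d * exp (64 * real K ^ 2)" .
  qed simp
  then have "fp (T + d div 8 + 12 * (d + 1) + (n div 4 + d) + 12 * d + (n div 3 + d) + 16 * d)
        (\<lambda>h. connected_spanning n (maker_edges h)) [] \<le>
      8 * (real d + 1) / n + 4 * real n ^ 2 / real d ^ 2 / L
      + 2 ^ L * (1 - 1 / (4 * real K) / 2) ^ (d div 8)
      + (2 * (1 - (1 / 8) / 2) ^ 12) ^ (d + 1) + (1 / 2) ^ d * exp (64 * real K ^ 2)
      + (2 * (1 - (1 / 8) / 2) ^ 12) ^ d + (1 / 2) ^ d * exp (64 * real K ^ 2)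
      + (2 * (1 - (1 / 10) / 2) ^ 16) ^ d"
  proof (rule fp_then_add[OF reach_Nil, rotated])
    fix h assume h: "reach h" "tm h = tm [] + (T + d div 8 + 12 * (d + 1) + (n div 4 + d) + 12 * d + (n div 3 + d))"
      "card (graph_comps h) < d \<and> big_comps h"
    have "fp (16 * d) (\<lambda>h. connected_spanning n (maker_edges h)) h \<le> fp (16 * d) (\<lambda>h. card (graph_comps h) \<le> 1) h"
      by (rule fp_mono[OF h(1)]) (rule connected_spanning_card_component_set)
    also have "\<dots> \<le> 2 ^ card (graph_comps h) * (1 - (1 / 10) / 2) ^ (16 * d)"
      by (rule fp_final_phase[OF h(1)]) (use h dn in simp_all)
    also have "\<dots> \<le> 2 ^ d * (1 - (1 / 10) / 2) ^ (16 * d)"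
      by (rule mult_right_mono[OF power_increasing]) (use h in auto)
    also have "\<dots> = (2 * (1 - (1 / 10) / 2) ^ 16) ^ d" by (simp only: power_mult power_mult_distrib)
    finally show "fp (16 * d) (\<lambda>h. connected_spanning n (maker_edges h)) h \<le> (2 * (1 - (1 / 10) / 2) ^ 16) ^ d" .
  qed simp
  then show ?thesis .
qed

end

section \<open>Choice of the constants and passage to the limit\<close>

lemma connectivity_high_probability:
  fixes a b K :: nat
  assumes ab: "a > 0" "b \<le> 2 * a" and K: "K \<ge> 1000"
  shows "eventually (\<lambda>n. \<exists>M. randomized_maker n M \<and>
     guarantees_win (spanning_trees n) n a b M (1 - 18 / real K)) sequentially"
proof -
  \<comment> \<open>The mean number of pending vertices is at most
    \<open>4 * (n / d) ^ 2 \<le> 16 * K ^ 2\<close>, so Markov's inequality with this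
    \<open>L\<close> costs \<open>1 / K\<close>.\<close>
  define L where "L = 16 * K ^ 3"
  have pos: "K > 0" "L > 0" using K by (auto simp: L_def)
  define rest :: "nat \<Rightarrow> real" where
    "rest d = 2 ^ L * (1 - 1 / (4 * real K) / 2) ^ (d div 8)
      + (2 * (1 - (1 / 8) / 2) ^ 12) ^ (d + 1) + (1 / 2) ^ d * exp (64 * real K ^ 2)
      + (2 * (1 - (1 / 8) / 2) ^ 12) ^ d + (1 / 2) ^ d * exp (64 * real K ^ 2)
      + (2 * (1 - (1 / 10) / 2) ^ 16) ^ d" for d
  have pow: "(\<lambda>d. x ^ d) \<longlonglongrightarrow> 0" if "0 \<le> x" "x < 1" for x :: real
    by (rule LIMSEQ_power_zero) (use that in simp)
  have l1: "(\<lambda>d. (1 - 1 / (4 * real K) / 2) ^ (d div 8)) \<longlonglongrightarrow> 0"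
    by (rule filterlim_compose[OF pow filterlim_div_at_top]) (use pos in \<open>auto simp: field_simps\<close>)
  have l2: "(\<lambda>d. (1 / 2 :: real) ^ d) \<longlonglongrightarrow> 0" by (rule pow) auto
  have l3: "(\<lambda>d. (2 * (1 - (1 / 8) / 2) ^ 12 :: real) ^ d) \<longlonglongrightarrow> 0"
    by (rule pow) (simp_all add: power_numeral_even power_numeral_odd)
  have l4: "(\<lambda>d. (2 * (1 - (1 / 10) / 2) ^ 16 :: real) ^ d) \<longlonglongrightarrow> 0"
    by (rule pow) (simp_all add: power_numeral_even power_numeral_odd)
  have "rest \<longlonglongrightarrow> 2 ^ L * 0 + 0 + 0 * exp (64 * real K ^ 2) + 0 + 0 * exp (64 * real K ^ 2) + 0"
    unfolding rest_def
    by (intro tendsto_add tendsto_mult_left tendsto_mult_right l1 l2 l3 l4 LIMSEQ_ignore_initial_segment[OF l3])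
  then have "(\<lambda>n. rest (n div K)) \<longlonglongrightarrow> 0"
    using filterlim_compose[OF _ filterlim_div_at_top[OF pos(1)]] by simp
  then have ev: "eventually (\<lambda>n. rest (n div K) < 1 / K) sequentially"
    by (rule order_tendstoD) (use pos in simp)
  show ?thesis
    using ev eventually_ge_at_top[of "64 * K * K + 4 * K + 100 * b + 10000"]
  proof eventually_elim
    case (elim n)
    define d where "d = n div K"
    have Kd: "K * d \<le> n" by (simp add: d_def)
    have "n < K * d + K" using dividend_less_times_div[OF pos(1), of n] by (simp add: d_def)
    moreover have d4: "d \<ge> 4" using elim(2) pos by (simp add: d_def less_eq_div_iff_mult_less_eq)
    then have "K \<le> K * d" by simp
    ultimately have "n \<le> 2 * (K * d)" by linarith
    then have n_le: "n \<le> 2 * K * d" by (simp only: mult.assoc)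
    have d_le: "1000 * d \<le> n" using mult_le_mono1[OF K, of d] Kd by linarith
    have "64 * K * K * n \<le> n * n" using elim(2) by (intro mult_le_mono1) simp
    also have "\<dots> \<le> (2 * K * d) * (2 * K * d)" using n_le by (intro mult_le_mono)
    finally have "K * K * (16 * n) \<le> K * K * (d * d)" by (simp add: algebra_simps)
    then have sparse: "16 * n \<le> d * d" using pos by simp
    show "\<exists>M. randomized_maker n M \<and> guarantees_win (spanning_trees n) n a b M (1 - 18 / real K)"
    proof -
      define T where "T = (n - d) div 2"
      have legal: "fast_opt n d T v \<subseteq> complete_edges n \<and> fast_opt n d T v \<noteq> {}" for v
        by (rule fast_opt_legal) (use elim(2) d4 in auto)
      define t where "t = T + d div 8 + 12 * (d + 1) + (n div 4 + d) + 12 * d + (n div 3 + d) + 16 * d"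
      have "1 - 18 / real K \<le> expect a \<beta> (fast_opt n d T) (t * a)
          (\<lambda>h. of_bool (connected_spanning n (maker_edges h))) []" if \<beta>: "breaker_legal n b \<beta>" for \<beta>
      proof -
        interpret fast_game n a b d T \<beta>
          using ab \<beta> d4 d_le elim(2) by unfold_locales (auto simp: T_def)
        have n_real: "real n \<le> 2 * real K * real d" "real K * real d \<le> real n"
          using of_nat_le_iff[of n "2 * K * d", where 'a = real] n_le
            of_nat_le_iff[of "K * d" n, where 'a = real] Kd by simp_all
        have "fp t (\<lambda>h. connected_spanning n (maker_edges h)) []
            \<le> 8 * (real d + 1) / n + 4 * real n ^ 2 / real d ^ 2 / L + rest d"
          using fp_connected[OF n_le pos sparse] by (simp add: t_def rest_def)
        \<comment> \<open>Degree control costs \<open>16 / K\<close>, the pending vertices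
          \<open>1 / K\<close> and all later phases together \<open>1 / K\<close>, which makes
          \<open>18 / K\<close>.\<close>
        moreover have "8 * (real d + 1) / n \<le> 16 / K"
        proof -
          have "real K * (8 * (real d + 1)) \<le> real K * (16 * real d)" using d4 by (intro mult_left_mono) auto
          also have "\<dots> \<le> 16 * real n" using n_real(2) by simp
          finally show ?thesis using pos elim(2) by (simp add: field_simps)
        qed
        moreover have "4 * real n ^ 2 / real d ^ 2 / L \<le> 1 / K"
        proof -
          have "real n / real d \<le> 2 * real K" using n_real(1) d4 by (simp add: field_simps)
          then have "(real n / real d) ^ 2 \<le> (2 * real K) ^ 2" by (intro power_mono) auto
          then have "4 * real n ^ 2 / real d ^ 2 \<le> 16 * real K ^ 2" by (simp add: power_divide power_mult_distrib)
          then have "4 * real n ^ 2 / real d ^ 2 / L \<le> 16 * real K ^ 2 / L" by (rule divide_right_mono) simp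
          also have "\<dots> = 1 / K" using pos by (simp add: L_def power2_eq_square power3_eq_cube)
          finally show ?thesis .
        qed
        moreover have "rest d < 1 / K" using elim(1) by (simp add: d_def)
        moreover have "16 / real K + 1 / real K + 1 / real K = 18 / real K" by (simp add: add_divide_distrib[symmetric])
        ultimately have "fp t (\<lambda>h. connected_spanning n (maker_edges h)) [] \<le> 1 - (1 - 18 / real K)" by linarith
        then show ?thesis by (rule win_prob_connected)
      qed
      then show ?thesis using legal
        by (intro strategy_from_expect[OF ab(1), where A = "fast_opt n d T" and k = t]) auto
    qed
  qed
qed

text \<open>A fixed \<open>K\<close> gives only \<open>1 - 18 / K\<close>, so \<open>K\<close> has
  to grow with \<open>n\<close>: the largest \<open>K \<le> n\<close> that works for this
  \<open>n\<close> is taken. The cap \<open>K \<le> n\<close> ensures that the maximum exists, and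
  each fixed \<open>K \<ge> N\<close> is eventually admissible, which drives the maximum to
  infinity.\<close>

lemma diagonal_limit:
  fixes good :: "nat \<Rightarrow> nat \<Rightarrow> bool"
  assumes "\<And>K. K \<ge> N \<Longrightarrow> eventually (\<lambda>n. good n K) sequentially"
  obtains \<kappa> where "filterlim \<kappa> at_top sequentially" "eventually (\<lambda>n. good n (\<kappa> n)) sequentially"
proof -
  define A where "A n = {K. N \<le> K \<and> K \<le> n \<and> good n K}" for n
  have fin: "finite (A n)" for n by (rule finite_subset[of _ "{..n}"]) (auto simp: A_def)
  have ev: "eventually (\<lambda>n. K \<in> A n) sequentially" if "K \<ge> N" for K
    using assms[OF that] eventually_ge_at_top[of K] by eventually_elim (use that in \<open>auto simp: A_def\<close>)
  show ?thesis
  proof (rule that[of "\<lambda>n. Max (A n)"])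
    show "filterlim (\<lambda>n. Max (A n)) at_top sequentially"
      unfolding filterlim_at_top
    proof
      fix m
      have "eventually (\<lambda>n. max N m \<in> A n) sequentially" by (rule ev) simp
      then show "eventually (\<lambda>n. m \<le> Max (A n)) sequentially"
      proof eventually_elim
        case (elim n)
        then show ?case using Max_ge[OF fin elim] by simp
      qed
    qed
    have "eventually (\<lambda>n. N \<in> A n) sequentially" by (rule ev) simp
    then show "eventually (\<lambda>n. good n (Max (A n))) sequentially"
    proof eventually_elim
      case (elim n)
      then have "Max (A n) \<in> A n" using fin by (intro Max_in) auto
      then show ?case by (simp add: A_def)
    qed
  qed
qed

theorem theorem5:
  fixes a b :: nat
  assumes "a > 0" and "b > 0"
  shows "(b > 2 * a \<longrightarrow>
            (\<exists>c::real. c > 0 \<and> (\<exists>n0::nat. \<forall>n\<ge>n0. \<exists>M. randomized_maker n M \<and>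
               guarantees_win (spanning_trees n) n a b M c)))
       \<and> (b \<le> 2 * a \<longrightarrow>
            (\<exists>p :: nat \<Rightarrow> real. p \<longlonglongrightarrow> 1 \<and>
               (\<forall>\<^sub>F n in sequentially. \<exists>M. randomized_maker n M \<and>
                  guarantees_win (spanning_trees n) n a b M (p n))))"
proof (intro conjI impI)
  show "\<exists>c::real. c > 0 \<and> (\<exists>n0::nat. \<forall>n\<ge>n0. \<exists>M. randomized_maker n M \<and>
      guarantees_win (spanning_trees n) n a b M c)"
    by (rule connectivity_positive_probability[OF assms])
next
  assume b: "b \<le> 2 * a"
  obtain \<kappa> where \<kappa>: "filterlim \<kappa> at_top sequentially"
    "\<forall>\<^sub>F n in sequentially. \<exists>M. randomized_maker n M \<and>
       guarantees_win (spanning_trees n) n a b M (1 - 18 / real (\<kappa> n))"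
    by (rule diagonal_limit[where N = 1000 and good = "\<lambda>n K. \<exists>M. randomized_maker n M \<and>
       guarantees_win (spanning_trees n) n a b M (1 - 18 / real K)"])
       (rule connectivity_high_probability[OF assms(1) b])
  have "(\<lambda>n. 1 - 18 / real (\<kappa> n)) \<longlonglongrightarrow> 1 - 0"
    by (intro tendsto_intros tendsto_divide_0[OF tendsto_const] filterlim_at_top_imp_at_infinity
        filterlim_compose[OF filterlim_real_sequentially \<kappa>(1)])
  then show "\<exists>p :: nat \<Rightarrow> real. p \<longlonglongrightarrow> 1 \<and>
      (\<forall>\<^sub>F n in sequentially. \<exists>M. randomized_maker n M \<and>
         guarantees_win (spanning_trees n) n a b M (p n))"
    using \<kappa>(2) by auto
qed

end
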